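(* Let $A$ be a connected, graded, graded-commutative algebra over a field $\Bbbk$, generated in degree $1$, with $\dim_\Bbbk A^1<\infty$ and $a^2=0$ for all $a\in A^1$. Let $a$ be a non-zero element of $A^1$ and set $B=A/aA$. Suppose $a\notin\bigcup_{i=1}^r\mathcal R^i_1(A)$, for some $r\ge1$. Then $$\mathfrak g_s(A)\cong\mathfrak g_s(B),\quad\text{for }2\le s\le r+1.$$
   Context: For $z\in A^1$, let $(A,z)$ be the cochain complex $A^0\to A^1\to A^2\to\cdots$ with differential right multiplication by $z$; $\mathcal R^i_1(A)=\{z\in A^1\mid H^i(A,z)\ne0\}$ for $i\ge1$. Holonomy Lie algebra: for a connected graded, graded-commutative $\Bbbk$-algebra $A$ with $\dim_\Bbbk A^1<\infty$ and $a^2=0$ for all $a\in A^1$, let $A_i=\operatorname{Hom}_\Bbbk(A^i,\Bbbk)$, let $\operatorname{Lie}(A_1)$ be the free Lie algebra on $A_1$, graded by bracket length, and let $\nabla\colon A_2\to A_1\wedge A_1=\operatorname{Lie}_2(A_1)$ be the dual of the multiplication map $\mu\colon A^1\wedge A^1\to A^2$. Then $\mathfrak h(A)=\operatorname{Lie}(A_1)/(\operatorname{im}\nabla)$, the quotient by the Lie ideal generated by the image of $\nabla$; it is a graded Lie algebra. $\mathfrak g(A)=\mathfrak h(A)/\mathfrak h''(A)$ is the maximal metabelian quotient, where $\mathfrak h''$ is the second derived Lie subalgebra of $\mathfrak h$, and $\mathfrak g_s(A)$ is its degree $s$ piece. The isomorphism in the claim is of $\Bbbk$-vector spaces. *)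

theory Defs
  imports "HOL-Algebra.QuotRing" "HOL-Algebra.Module"
begin

text \<open>
  The ground field is a type \<open>'k\<close> of class \<open>field\<close>, seen as a ring record by \<open>scalar_field\<close>.  Vector
  spaces, associative algebras and Lie algebras over it are all \<open>('k, 'a) module\<close> records, so that
  one quotient construction serves for all of them.  For a Lie algebra the field \<open>mult\<close> is the
  bracket and \<open>one\<close> is meaningless; for a bare vector space both are meaningless.
  A grading is a family \<open>nat \<Rightarrow> 'a set\<close> of subspaces of the carrier.
\<close>

abbreviation scalar_field :: "'k::field ring" where
  "scalar_field \<equiv> \<lparr> carrier = UNIV, mult = (*), one = 1, zero = 0, add = (+) \<rparr>"


section \<open>Linear algebra and quotients\<close>

definition lin_span :: "('k::field, 'a) module \<Rightarrow> 'a set \<Rightarrow> 'a set" where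
  "lin_span V S = \<Inter> {W. submodule W scalar_field V \<and> S \<subseteq> W}"

definition finite_dim :: "('k::field, 'a) module \<Rightarrow> 'a set \<Rightarrow> bool" where
  "finite_dim V W \<longleftrightarrow> (\<exists>S. finite S \<and> S \<subseteq> W \<and> lin_span V S = W)"

definition lin_isomorphic :: "('k::field, 'a) module \<Rightarrow> ('k, 'b) module \<Rightarrow> bool" where
  "lin_isomorphic V W \<longleftrightarrow>
    (\<exists>f \<in> iso (add_monoid V) (add_monoid W).
       \<forall>c. \<forall>x \<in> carrier V. f (c \<odot>\<^bsub>V\<^esub> x) = c \<odot>\<^bsub>W\<^esub> f x)"

text \<open>
  The quotient \<open>A/I\<close>, as a set of cosets: the library's quotient ring together with the induced
  scalar multiplication.  It is used for two-sided ideals \<open>I\<close> of associative algebras, for Lie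
  ideals of Lie algebras, and for subspaces (where only the linear structure is relevant).
\<close>

definition quot_alg :: "('k, 'a) module \<Rightarrow> 'a set \<Rightarrow> ('k, 'a set) module" where
  "quot_alg A I =
     ring.extend (A Quot I) (module.fields (\<lambda>c X. \<Union>x\<in>X. I +>\<^bsub>A\<^esub> (c \<odot>\<^bsub>A\<^esub> x)))"

definition quot_grading :: "('k, 'a) module \<Rightarrow> 'a set \<Rightarrow> (nat \<Rightarrow> 'a set) \<Rightarrow> nat \<Rightarrow> 'a set set" where
  "quot_grading A I gr n = (\<lambda>x. I +>\<^bsub>A\<^esub> x) ` gr n"

text \<open>
  \<open>Hom(W, k)\<close> for a subspace \<open>W\<close> of \<open>V\<close>.  Functionals are extensional functions on \<open>W\<close>, so that
  equality of functionals is equality of functions.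
\<close>

definition dual_space :: "('k::field, 'a) module \<Rightarrow> 'a set \<Rightarrow> ('k, 'a \<Rightarrow> 'k) module" where
  "dual_space V W =
    \<lparr> carrier = {\<phi> \<in> extensional W.
        (\<forall>x\<in>W. \<forall>y\<in>W. \<phi> (x \<oplus>\<^bsub>V\<^esub> y) = \<phi> x + \<phi> y) \<and>
        (\<forall>c. \<forall>x\<in>W. \<phi> (c \<odot>\<^bsub>V\<^esub> x) = c * \<phi> x)},
      mult = (\<lambda>\<phi> \<psi>. restrict (\<lambda>x. 0) W),
      one = restrict (\<lambda>x. 0) W,
      zero = restrict (\<lambda>x. 0) W,
      add = (\<lambda>\<phi> \<psi>. restrict (\<lambda>x. \<phi> x + \<psi> x) W),
      smult = (\<lambda>c \<phi>. restrict (\<lambda>x. c * \<phi> x) W) \<rparr>"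


section \<open>Graded algebras and resonance\<close>

locale graded_algebra = module scalar_field A + ring A
  for A :: "('k::field, 'a) module" (structure) +
  fixes gr :: "nat \<Rightarrow> 'a set"
  assumes smult_mult_left: "\<lbrakk>x \<in> carrier A; y \<in> carrier A\<rbrakk> \<Longrightarrow> (c \<odot> x) \<otimes> y = c \<odot> (x \<otimes> y)"
    and smult_mult_right: "\<lbrakk>x \<in> carrier A; y \<in> carrier A\<rbrakk> \<Longrightarrow> x \<otimes> (c \<odot> y) = c \<odot> (x \<otimes> y)"
    and gr_subspace: "submodule (gr i) scalar_field A"
    and gr_direct_sum: "x \<in> carrier A \<Longrightarrow>
      \<exists>!f. (\<forall>i. f i \<in> gr i) \<and> finite {i. f i \<noteq> \<zero>} \<and> (\<Oplus>i\<in>{i. f i \<noteq> \<zero>}. f i) = x"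
    and one_gr: "\<one> \<in> gr 0"
    and mult_gr: "\<lbrakk>x \<in> gr i; y \<in> gr j\<rbrakk> \<Longrightarrow> x \<otimes> y \<in> gr (i + j)"

definition connected_grading :: "('k::field, 'a) module \<Rightarrow> (nat \<Rightarrow> 'a set) \<Rightarrow> bool" where
  "connected_grading A gr \<longleftrightarrow> \<one>\<^bsub>A\<^esub> \<noteq> \<zero>\<^bsub>A\<^esub> \<and> gr 0 = range (\<lambda>c. c \<odot>\<^bsub>A\<^esub> \<one>\<^bsub>A\<^esub>)"

definition graded_commutative :: "('k::field, 'a) module \<Rightarrow> (nat \<Rightarrow> 'a set) \<Rightarrow> bool" where
  "graded_commutative A gr \<longleftrightarrow>
    (\<forall>i j. \<forall>x \<in> gr i. \<forall>y \<in> gr j. x \<otimes>\<^bsub>A\<^esub> y = (- 1) ^ (i * j) \<odot>\<^bsub>A\<^esub> (y \<otimes>\<^bsub>A\<^esub> x))"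

definition generated_in_degree_one :: "('k::field, 'a) module \<Rightarrow> (nat \<Rightarrow> 'a set) \<Rightarrow> bool" where
  "generated_in_degree_one A gr \<longleftrightarrow>
    (\<forall>S. submodule S scalar_field A \<and> \<one>\<^bsub>A\<^esub> \<in> S \<and> (\<forall>x\<in>S. \<forall>y\<in>S. x \<otimes>\<^bsub>A\<^esub> y \<in> S) \<and> gr 1 \<subseteq> S
       \<longrightarrow> S = carrier A)"

text \<open>
  \<open>H\<^sup>i(A,z)\<close> for the complex with differential \<open>x \<mapsto> x z\<close>; the space in degree \<open>-1\<close> is zero.
\<close>

definition cohomology :: "('k::field, 'a) module \<Rightarrow> (nat \<Rightarrow> 'a set) \<Rightarrow> 'a \<Rightarrow> nat \<Rightarrow> ('k, 'a set) module"
  where "cohomology A gr z i =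
    quot_alg (A\<lparr>carrier := {x \<in> gr i. x \<otimes>\<^bsub>A\<^esub> z = \<zero>\<^bsub>A\<^esub>}\<rparr>)
      (case i of 0 \<Rightarrow> {\<zero>\<^bsub>A\<^esub>} | Suc j \<Rightarrow> (\<lambda>y. y \<otimes>\<^bsub>A\<^esub> z) ` gr j)"

definition resonance :: "('k::field, 'a) module \<Rightarrow> (nat \<Rightarrow> 'a set) \<Rightarrow> nat \<Rightarrow> 'a set" where
  "resonance A gr i =
    {z \<in> gr 1. carrier (cohomology A gr z i) \<noteq> {\<zero>\<^bsub>cohomology A gr z i\<^esub>}}"


section \<open>The free Lie algebra on a vector space\<close>

text \<open>
  The free Lie algebra on a vector space \<open>V\<close> is the algebra of formal Lie expressions in the elements
  of \<open>V\<close>, modulo the congruence generated by the axioms of Lie algebras (with \<open>[x,x] = 0\<close>, so that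
  characteristic 2 is covered) and by the linearity of the inclusion of generators.
\<close>

datatype ('k, gens: 'v) lie_term =
    Gen 'v
  | Zero
  | Add "('k, 'v) lie_term" "('k, 'v) lie_term"
  | Scale 'k "('k, 'v) lie_term"
  | Bracket "('k, 'v) lie_term" "('k, 'v) lie_term"

definition lie_terms :: "('k, 'v) module \<Rightarrow> ('k, 'v) lie_term set" where
  "lie_terms V = {t. gens t \<subseteq> carrier V}"

inductive lie_eq :: "('k::field, 'v) module \<Rightarrow> ('k, 'v) lie_term \<Rightarrow> ('k, 'v) lie_term \<Rightarrow> bool"
  for V where
  refl: "lie_eq V t t"
| sym: "lie_eq V s t \<Longrightarrow> lie_eq V t s"
| trans: "lie_eq V s t \<Longrightarrow> lie_eq V t u \<Longrightarrow> lie_eq V s u"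
| cong_Add: "lie_eq V s s' \<Longrightarrow> lie_eq V t t' \<Longrightarrow> lie_eq V (Add s t) (Add s' t')"
| cong_Scale: "lie_eq V t t' \<Longrightarrow> lie_eq V (Scale c t) (Scale c t')"
| cong_Bracket: "lie_eq V s s' \<Longrightarrow> lie_eq V t t' \<Longrightarrow> lie_eq V (Bracket s t) (Bracket s' t')"
| add_assoc: "lie_eq V (Add (Add s t) u) (Add s (Add t u))"
| add_comm: "lie_eq V (Add s t) (Add t s)"
| add_zero: "lie_eq V (Add Zero t) t"
| add_inverse: "lie_eq V (Add (Scale (- 1) t) t) Zero"
| scale_add_left: "lie_eq V (Scale (c + d) t) (Add (Scale c t) (Scale d t))"
| scale_add_right: "lie_eq V (Scale c (Add s t)) (Add (Scale c s) (Scale c t))"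
| scale_scale: "lie_eq V (Scale (c * d) t) (Scale c (Scale d t))"
| scale_one: "lie_eq V (Scale 1 t) t"
| bracket_add_left: "lie_eq V (Bracket (Add s t) u) (Add (Bracket s u) (Bracket t u))"
| bracket_add_right: "lie_eq V (Bracket u (Add s t)) (Add (Bracket u s) (Bracket u t))"
| bracket_scale_left: "lie_eq V (Bracket (Scale c s) t) (Scale c (Bracket s t))"
| bracket_scale_right: "lie_eq V (Bracket s (Scale c t)) (Scale c (Bracket s t))"
| bracket_self: "lie_eq V (Bracket t t) Zero"
| jacobi: "lie_eq V
    (Add (Bracket s (Bracket t u)) (Add (Bracket t (Bracket u s)) (Bracket u (Bracket s t)))) Zero"
| gen_add: "v \<in> carrier V \<Longrightarrow> w \<in> carrier V \<Longrightarrow> lie_eq V (Gen (v \<oplus>\<^bsub>V\<^esub> w)) (Add (Gen v) (Gen w))"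
| gen_scale: "v \<in> carrier V \<Longrightarrow> lie_eq V (Gen (c \<odot>\<^bsub>V\<^esub> v)) (Scale c (Gen v))"

definition lie_class :: "('k::field, 'v) module \<Rightarrow> ('k, 'v) lie_term \<Rightarrow> ('k, 'v) lie_term set" where
  "lie_class V t = {s \<in> lie_terms V. lie_eq V t s}"

definition free_lie :: "('k::field, 'v) module \<Rightarrow> ('k, ('k, 'v) lie_term set) module" where
  "free_lie V =
    \<lparr> carrier = lie_class V ` lie_terms V,
      mult = (\<lambda>X Y. \<Union>s\<in>X. \<Union>t\<in>Y. lie_class V (Bracket s t)),
      one = lie_class V Zero,
      zero = lie_class V Zero,
      add = (\<lambda>X Y. \<Union>s\<in>X. \<Union>t\<in>Y. lie_class V (Add s t)),
      smult = (\<lambda>c X. \<Union>t\<in>X. lie_class V (Scale c t)) \<rparr>"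

inductive lie_homogeneous :: "nat \<Rightarrow> ('k, 'v) lie_term \<Rightarrow> bool" where
  "lie_homogeneous 1 (Gen v)"
| "lie_homogeneous n Zero"
| "lie_homogeneous n s \<Longrightarrow> lie_homogeneous n t \<Longrightarrow> lie_homogeneous n (Add s t)"
| "lie_homogeneous n t \<Longrightarrow> lie_homogeneous n (Scale c t)"
| "lie_homogeneous m s \<Longrightarrow> lie_homogeneous n t \<Longrightarrow> lie_homogeneous (m + n) (Bracket s t)"

definition free_lie_grading ::
    "('k::field, 'v) module \<Rightarrow> nat \<Rightarrow> ('k, 'v) lie_term set set" where
  "free_lie_grading V n = lie_class V ` {t \<in> lie_terms V. lie_homogeneous n t}"

definition lie_ideal_generated :: "('k::field, 'a) module \<Rightarrow> 'a set \<Rightarrow> 'a set" where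
  "lie_ideal_generated L S =
    \<Inter> {J. submodule J scalar_field L \<and> (\<forall>x \<in> carrier L. \<forall>y \<in> J. x \<otimes>\<^bsub>L\<^esub> y \<in> J) \<and> S \<subseteq> J}"

definition lie_derived :: "('k::field, 'a) module \<Rightarrow> 'a set \<Rightarrow> 'a set" where
  "lie_derived L S = lin_span L {x \<otimes>\<^bsub>L\<^esub> y | x y. x \<in> S \<and> y \<in> S}"


section \<open>The holonomy Lie algebra and its maximal metabelian quotient\<close>

text \<open>
  Under the identifications \<open>Lie\<^sub>2(A\<^sub>1) = A\<^sub>1 \<and> A\<^sub>1 = (A\<^sup>1 \<and> A\<^sup>1)\<^sup>*\<close>, the bracket \<open>[\<alpha>,\<beta>]\<close>
  is the form \<open>x \<and> y \<mapsto> \<alpha>(x) \<beta>(y) - \<alpha>(y) \<beta>(x)\<close>.  As \<open>\<nabla>\<close> is dual to the multiplication,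
  \<open>\<nabla>(\<phi>)\<close> is the element \<open>\<Sum>\<^sub>k [\<alpha>\<^sub>k,\<beta>\<^sub>k]\<close> whose form is \<open>x \<and> y \<mapsto> \<phi>(x y)\<close>; the
  predicate \<open>is_nabla A gr \<phi> w\<close> says that \<open>w = \<nabla>(\<phi>)\<close>.
\<close>

definition is_nabla :: "('k::field, 'a) module \<Rightarrow> (nat \<Rightarrow> 'a set) \<Rightarrow> ('a \<Rightarrow> 'k) \<Rightarrow>
    ('k, 'a \<Rightarrow> 'k) lie_term set \<Rightarrow> bool" where
  "is_nabla A gr \<phi> w \<longleftrightarrow>
    (let A1 = dual_space A (gr 1); L = free_lie A1 in
      \<exists>ps. set ps \<subseteq> carrier A1 \<times> carrier A1 \<and>
        w = foldr (\<lambda>(\<alpha>, \<beta>) u. (lie_class A1 (Gen \<alpha>) \<otimes>\<^bsub>L\<^esub> lie_class A1 (Gen \<beta>)) \<oplus>\<^bsub>L\<^esub> u) ps \<zero>\<^bsub>L\<^esub> \<and>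
        (\<forall>x \<in> gr 1. \<forall>y \<in> gr 1. (\<Sum>(\<alpha>, \<beta>) \<leftarrow> ps. \<alpha> x * \<beta> y - \<alpha> y * \<beta> x) = \<phi> (x \<otimes>\<^bsub>A\<^esub> y)))"

definition nabla_image ::
    "('k::field, 'a) module \<Rightarrow> (nat \<Rightarrow> 'a set) \<Rightarrow> ('k, 'a \<Rightarrow> 'k) lie_term set set" where
  "nabla_image A gr = {w. \<exists>\<phi> \<in> carrier (dual_space A (gr 2)). is_nabla A gr \<phi> w}"

definition holonomy_relations ::
    "('k::field, 'a) module \<Rightarrow> (nat \<Rightarrow> 'a set) \<Rightarrow> ('k, 'a \<Rightarrow> 'k) lie_term set set" where
  "holonomy_relations A gr =
     lie_ideal_generated (free_lie (dual_space A (gr 1))) (nabla_image A gr)"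

definition holonomy ::
    "('k::field, 'a) module \<Rightarrow> (nat \<Rightarrow> 'a set) \<Rightarrow> ('k, ('k, 'a \<Rightarrow> 'k) lie_term set set) module" where
  "holonomy A gr = quot_alg (free_lie (dual_space A (gr 1))) (holonomy_relations A gr)"

definition holonomy_grading ::
    "('k::field, 'a) module \<Rightarrow> (nat \<Rightarrow> 'a set) \<Rightarrow> nat \<Rightarrow> ('k, 'a \<Rightarrow> 'k) lie_term set set set" where
  "holonomy_grading A gr =
     quot_grading (free_lie (dual_space A (gr 1))) (holonomy_relations A gr)
       (free_lie_grading (dual_space A (gr 1)))"

definition holonomy_second_derived ::
    "('k::field, 'a) module \<Rightarrow> (nat \<Rightarrow> 'a set) \<Rightarrow> ('k, 'a \<Rightarrow> 'k) lie_term set set set" where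
  "holonomy_second_derived A gr =
     (let h = holonomy A gr in lie_derived h (lie_derived h (carrier h)))"

definition metabelian_holonomy ::
    "('k::field, 'a) module \<Rightarrow> (nat \<Rightarrow> 'a set) \<Rightarrow>
      ('k, ('k, 'a \<Rightarrow> 'k) lie_term set set set) module" where
  "metabelian_holonomy A gr = quot_alg (holonomy A gr) (holonomy_second_derived A gr)"

definition metabelian_holonomy_deg ::
    "('k::field, 'a) module \<Rightarrow> (nat \<Rightarrow> 'a set) \<Rightarrow> nat \<Rightarrow>
      ('k, ('k, 'a \<Rightarrow> 'k) lie_term set set set) module" where
  "metabelian_holonomy_deg A gr s =
     (metabelian_holonomy A gr)
       \<lparr>carrier := quot_grading (holonomy A gr) (holonomy_second_derived A gr)
                     (holonomy_grading A gr) s\<rparr>"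

end

theory Submission
  imports Defs "HOL-Library.Product_Plus"
begin

text \<open>
  Let \<open>w\<^sub>0 = a, w\<^sub>1, \<dots>, w\<^sub>n\<close> be a basis of \<open>A\<^sup>1\<close> and \<open>x\<^sub>0, \<dots>, x\<^sub>n\<close> the dual basis of \<open>A\<^sub>1\<close>.  The holonomy
  Lie algebra of \<open>A\<close> has the generators \<open>x\<^sub>0, \<dots>, x\<^sub>n\<close> and one relation
  \<open>\<Sum>\<^sub>i\<^sub><\<^sub>j \<phi>(w\<^sub>i w\<^sub>j) [x\<^sub>i, x\<^sub>j]\<close> for every functional \<open>\<phi>\<close> on \<open>A\<^sup>2\<close>.  That of \<open>B = A/aA\<close> has the generators
  \<open>x\<^sub>1, \<dots>, x\<^sub>n\<close> and those of the relations whose \<open>\<phi>\<close> vanishes on \<open>a A\<^sup>1\<close>.  So there is a homomorphism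
  \<open>\<g>(B) \<rightarrow> \<g>(A)\<close> that fixes \<open>x\<^sub>1, \<dots>, x\<^sub>n\<close>; it is the isomorphism of the theorem.

  It is surjective in degrees \<open>s \<ge> 2\<close>: exactness of the complex \<open>(A, a)\<close> in degree 1 says that
  \<open>a w\<^sub>1, \<dots>, a w\<^sub>n\<close> are linearly independent in \<open>A\<^sup>2\<close>, so there are functionals \<open>\<epsilon>\<^sub>k\<close> on \<open>A\<^sup>2\<close> with
  \<open>\<epsilon>\<^sub>k(a w\<^sub>j) = \<delta>\<^sub>j\<^sub>k\<close>.  The relation of \<open>\<epsilon>\<^sub>k\<close> expresses \<open>[x\<^sub>0, x\<^sub>k]\<close> by brackets of \<open>x\<^sub>1, \<dots>, x\<^sub>n\<close>.  Let \<open>D\<close> be the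
  derivation that sends \<open>x\<^sub>k\<close> to this expression; then the bracket with \<open>x\<^sub>0\<close> acts on the subalgebra
  generated by \<open>x\<^sub>1, \<dots>, x\<^sub>n\<close> as \<open>D\<close>, so this subalgebra contains everything of degree at least 2.

  For injectivity, suppose that \<open>D\<close> preserves the ideal of relations of \<open>B\<close>.  Then \<open>\<g>(B)\<close> extended by
  one element that acts as \<open>D\<close> is a Lie algebra to which \<open>\<g>(A)\<close> maps, and this map is a left inverse of
  \<open>\<g>(B) \<rightarrow> \<g>(A)\<close>.  The point is therefore the image under \<open>D\<close> of a relation
  \<open>\<Sum>\<^sub>i\<^sub><\<^sub>j M\<^sub>i\<^sub>j [x\<^sub>i, x\<^sub>j]\<close> with \<open>M\<^sub>i\<^sub>j = \<phi>(w\<^sub>i w\<^sub>j)\<close> and \<open>\<phi>(a A\<^sup>1) = 0\<close>.  Exactness in degree 2 says that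
  multiplication by \<open>a\<close> embeds \<open>A\<^sup>2 / a A\<^sup>1\<close> into \<open>A\<^sup>3\<close>, so \<open>\<phi>(x) = \<Phi>(a x)\<close> for a functional \<open>\<Phi>\<close> on \<open>A\<^sup>3\<close>.
  Put \<open>Z\<^sub>p\<^sub>q\<^sub>j = \<Phi>(w\<^sub>p w\<^sub>q w\<^sub>j)\<close>.  For fixed \<open>j\<close> the matrix \<open>Z\<^sub>p\<^sub>q\<^sub>j - \<Sum>\<^sub>i M\<^sub>i\<^sub>j \<epsilon>\<^sub>i(w\<^sub>p w\<^sub>q)\<close> comes from a
  functional on \<open>A\<^sup>2\<close> that vanishes on \<open>a A\<^sup>1\<close>, so it gives a relation \<open>\<rho>\<^sub>j\<close> of \<open>B\<close>.  As \<open>Z\<close> is alternating,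
  \<open>\<Sum> Z\<^sub>p\<^sub>q\<^sub>j [[x\<^sub>p, x\<^sub>q], x\<^sub>j]\<close> vanishes by the Jacobi identity, and \<open>D\<close> sends the given relation to
  \<open>\<Sum>\<^sub>j [\<rho>\<^sub>j, x\<^sub>j]\<close>.  This is \<open>cubic_extension\<close> together with \<open>p_injective_mod_KA\<close>.  In degree \<open>s = 2\<close>
  exactness in degree 1 suffices: the images under \<open>D\<close> of the relations have degree 3, so they
  vanish after passing to the quotient by all triple brackets (\<open>p_injective_degree_two\<close>).

  The calculations take place in one type, the free Lie algebra on the natural numbers, on which all
  maps are defined by its universal property; \<open>x\<^sub>i\<close> is the generator \<open>i\<close>.  The locale
  \<open>presentation\<close> transports them to the algebras in question: it says that such an algebra is the
  quotient of the free Lie algebra by a given ideal, and it is inherited by quotients.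
\<close>

section \<open>Lie algebras on a type and the free Lie algebra on a set\<close>

locale lie_structure =
  fixes scl :: "'k::field \<Rightarrow> 'b::ab_group_add \<Rightarrow> 'b"
    and br :: "'b \<Rightarrow> 'b \<Rightarrow> 'b"
  assumes scl_add_right: "scl c (x + y) = scl c x + scl c y"
    and scl_add_left: "scl (c + d) x = scl c x + scl d x"
    and scl_scl: "scl c (scl d x) = scl (c * d) x"
    and scl_one: "scl 1 x = x"
    and br_add_left: "br (x + y) z = br x z + br y z"
    and br_add_right: "br z (x + y) = br z x + br z y"
    and br_scl_left: "br (scl c x) y = scl c (br x y)"
    and br_scl_right: "br x (scl c y) = scl c (br x y)"
    and br_self: "br x x = 0"
    and br_jacobi: "br x (br y z) + (br y (br z x) + br z (br x y)) = 0"
begin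

lemma scl_zero_right: "scl c 0 = 0"
  using scl_add_right[of c 0 0] by simp

lemma scl_zero_left: "scl 0 x = 0"
  using scl_add_left[of 0 0 x] by simp

lemma scl_minus_right: "scl c (- x) = - scl c x"
  using scl_add_right[of c x "- x"] by (simp add: scl_zero_right eq_neg_iff_add_eq_0 add.commute)

lemma scl_minus_left: "scl (- c) x = - scl c x"
  using scl_add_left[of c "- c" x] by (simp add: scl_zero_left eq_neg_iff_add_eq_0 add.commute)

lemma scl_diff_left: "scl (c - d) x = scl c x - scl d x"
  using scl_add_left[of c "- d" x] by (simp add: scl_minus_left)

lemma scl_diff_right: "scl c (x - y) = scl c x - scl c y"
  using scl_add_right[of c x "- y"] by (simp add: scl_minus_right)

lemma br_zero_left: "br 0 y = 0"
  using br_add_left[of 0 0 y] by simp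

lemma br_zero_right: "br y 0 = 0"
  using br_add_right[of y 0 0] by simp

lemma br_minus_left: "br (- x) y = - br x y"
  using br_add_left[of x "- x" y] by (simp add: br_zero_left eq_neg_iff_add_eq_0 add.commute)

lemma br_minus_right: "br y (- x) = - br y x"
  using br_add_right[of y x "- x"] by (simp add: br_zero_right eq_neg_iff_add_eq_0 add.commute)

lemma br_diff_left: "br (x - y) z = br x z - br y z"
  using br_add_left[of x "- y" z] by (simp add: br_minus_left)

lemma br_diff_right: "br z (x - y) = br z x - br z y"
  using br_add_right[of z x "- y"] by (simp add: br_minus_right)

lemma br_anticommute: "br y x = - br x y"
proof -
  have "br x y + br y x = 0"
    using br_self[of "x + y"] br_self[of x] br_self[of y] by (simp add: br_add_left br_add_right ac_simps)
  then show ?thesis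
    by (simp add: eq_neg_iff_add_eq_0 add.commute)
qed

lemma br_leibniz: "br x (br y z) = br (br x y) z + br y (br x z)"
proof -
  have "br x (br y z) = - br y (br z x) - br z (br x y)"
    using br_jacobi[of x y z] by (simp add: eq_diff_eq eq_neg_iff_add_eq_0 ac_simps)
  also have "br y (br z x) = - br y (br x z)"
    by (simp add: br_anticommute[of z x] br_minus_right)
  also have "br z (br x y) = - br (br x y) z"
    by (rule br_anticommute)
  finally show ?thesis by simp
qed

lemma scl_sum_right: "scl c (sum f A) = (\<Sum>i\<in>A. scl c (f i))"
  by (induction A rule: infinite_finite_induct) (simp_all add: scl_zero_right scl_add_right)

lemma br_sum_left: "br (sum f A) x = (\<Sum>i\<in>A. br (f i) x)"
  by (induction A rule: infinite_finite_induct) (simp_all add: br_zero_left br_add_left)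

lemma br_sum_right: "br x (sum f A) = (\<Sum>i\<in>A. br x (f i))"
  by (induction A rule: infinite_finite_induct) (simp_all add: br_zero_right br_add_right)

end

primrec lie_eval ::
    "('k \<Rightarrow> 'b::ab_group_add \<Rightarrow> 'b) \<Rightarrow> ('b \<Rightarrow> 'b \<Rightarrow> 'b) \<Rightarrow> ('v \<Rightarrow> 'b) \<Rightarrow> ('k, 'v) lie_term \<Rightarrow> 'b" where
  "lie_eval scl br g (Gen v) = g v"
| "lie_eval scl br g Zero = 0"
| "lie_eval scl br g (Add s t) = lie_eval scl br g s + lie_eval scl br g t"
| "lie_eval scl br g (Scale c t) = scl c (lie_eval scl br g t)"
| "lie_eval scl br g (Bracket s t) = br (lie_eval scl br g s) (lie_eval scl br g t)"

lemma (in lie_structure) lie_eval_respects_lie_eq: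
  assumes "lie_eq V s t"
    and add: "\<And>v w. v \<in> carrier V \<Longrightarrow> w \<in> carrier V \<Longrightarrow> g (v \<oplus>\<^bsub>V\<^esub> w) = g v + g w"
    and scale: "\<And>c v. v \<in> carrier V \<Longrightarrow> g (c \<odot>\<^bsub>V\<^esub> v) = scl c (g v)"
  shows "lie_eval scl br g s = lie_eval scl br g t"
  using assms(1)
proof induction
  case (jacobi s t u)
  show ?case by (simp add: br_jacobi)
qed (simp_all add: add scale scl_add_left scl_add_right scl_scl scl_one scl_minus_left
      br_add_left br_add_right br_scl_left br_scl_right br_self algebra_simps)

text \<open>
  A module without elements imposes no relation on generators, so its congruence is that of the
  free Lie algebra on a set.  It does not depend on any vector space, so the quotient is a type.
\<close>

definition no_vectors :: "('k::field, 'v) module" where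
  "no_vectors = \<lparr> carrier = {}, mult = undefined, one = undefined, zero = undefined,
     add = undefined, smult = undefined \<rparr>"

lemma lie_eq_equivp: "equivp (lie_eq V)"
  by (rule equivpI; intro reflpI sympI transpI) (auto intro: lie_eq.intros)

quotient_type (overloaded) ('k, 'v) flie = "('k::field, 'v) lie_term" / "lie_eq no_vectors"
  by (rule lie_eq_equivp)

instantiation flie :: (field, type) ab_group_add
begin

lift_definition zero_flie :: "('a, 'b) flie" is Zero .
lift_definition plus_flie :: "('a, 'b) flie \<Rightarrow> ('a, 'b) flie \<Rightarrow> ('a, 'b) flie" is Add
  by (rule cong_Add)
lift_definition uminus_flie :: "('a, 'b) flie \<Rightarrow> ('a, 'b) flie" is "Scale (- 1)"
  by (rule cong_Scale)
lift_definition minus_flie :: "('a, 'b) flie \<Rightarrow> ('a, 'b) flie \<Rightarrow> ('a, 'b) flie"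
  is "\<lambda>x y. Add x (Scale (- 1) y)"
  by (intro cong_Add cong_Scale)

instance
  by standard (transfer; blast intro: lie_eq.intros)+

end

lift_definition fscale :: "'k::field \<Rightarrow> ('k, 'v) flie \<Rightarrow> ('k, 'v) flie" (infixr \<open>\<cdot>\<close> 75) is Scale
  by (rule cong_Scale)

lift_definition fbracket :: "('k::field, 'v) flie \<Rightarrow> ('k, 'v) flie \<Rightarrow> ('k, 'v) flie"
    (\<open>\<langle>_, _\<rangle>\<close>) is Bracket
  by (rule cong_Bracket)

lift_definition fgen :: "'v \<Rightarrow> ('k::field, 'v) flie" is Gen .

lemmas abs_flie_simps =
  fgen.abs_eq[symmetric] zero_flie.abs_eq[symmetric] plus_flie.abs_eq[symmetric]
  fscale.abs_eq[symmetric] fbracket.abs_eq[symmetric]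

interpretation F: lie_structure fscale fbracket
  by standard (transfer; blast intro: lie_eq.intros)+

lemma abs_rep_flie: "abs_flie (rep_flie x) = x"
  by (rule Quotient3_abs_rep[OF Quotient3_flie])

lemma flie_induct [case_names gen zero add scale bracket]:
  assumes "\<And>v. P (fgen v)" "P 0" "\<And>x y. P x \<Longrightarrow> P y \<Longrightarrow> P (x + y)"
    "\<And>c x. P x \<Longrightarrow> P (c \<cdot> x)" "\<And>x y. P x \<Longrightarrow> P y \<Longrightarrow> P \<langle>x, y\<rangle>"
  shows "P (x :: ('k::field, 'v) flie)"
proof -
  have "P (abs_flie t)" for t
    by (induction t) (simp_all add: abs_flie_simps assms)
  then show ?thesis
    by (metis abs_rep_flie)
qed

text \<open>
  The universal property of the free Lie algebra on a set.
\<close>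

context lie_structure
begin

definition lie_hom :: "('v \<Rightarrow> 'b) \<Rightarrow> ('k, 'v) flie \<Rightarrow> 'b" where
  "lie_hom g x = lie_eval scl br g (rep_flie x)"

lemma lie_hom_abs: "lie_hom g (abs_flie t) = lie_eval scl br g t"
proof -
  have "lie_eq no_vectors (rep_flie (abs_flie t)) t"
    using Quotient3_rep_abs[OF Quotient3_flie] refl by blast
  then show ?thesis
    unfolding lie_hom_def
    by (rule lie_eval_respects_lie_eq) (simp_all add: no_vectors_def)
qed

lemma lie_hom_simps [simp]:
  "lie_hom g (fgen v) = g v"
  "lie_hom g 0 = 0"
  "lie_hom g (x + y) = lie_hom g x + lie_hom g y"
  "lie_hom g (c \<cdot> x) = scl c (lie_hom g x)"
  "lie_hom g \<langle>x, y\<rangle> = br (lie_hom g x) (lie_hom g y)"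
proof -
  obtain s t where st: "x = abs_flie s" "y = abs_flie t"
    by (metis abs_rep_flie)
  show "lie_hom g (fgen v) = g v" "lie_hom g 0 = 0"
    using lie_hom_abs[of g "Gen v"] lie_hom_abs[of g Zero] by (simp_all add: abs_flie_simps)
  show "lie_hom g (x + y) = lie_hom g x + lie_hom g y"
    using lie_hom_abs[of g "Add s t"] lie_hom_abs[of g s] lie_hom_abs[of g t]
    by (simp add: abs_flie_simps st)
  show "lie_hom g (c \<cdot> x) = scl c (lie_hom g x)"
    using lie_hom_abs[of g "Scale c s"] lie_hom_abs[of g s]
    by (simp add: abs_flie_simps st)
  show "lie_hom g \<langle>x, y\<rangle> = br (lie_hom g x) (lie_hom g y)"
    using lie_hom_abs[of g "Bracket s t"] lie_hom_abs[of g s] lie_hom_abs[of g t]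
    by (simp add: abs_flie_simps st)
qed

lemma lie_hom_minus [simp]: "lie_hom g (- x) = - lie_hom g x"
  using lie_hom_simps(3)[of g x "- x"] by (simp add: eq_neg_iff_add_eq_0 add.commute)

lemma lie_hom_diff [simp]: "lie_hom g (x - y) = lie_hom g x - lie_hom g y"
  using lie_hom_simps(3)[of g x "- y"] by simp

lemma lie_hom_sum [simp]: "lie_hom g (sum f A) = (\<Sum>i\<in>A. lie_hom g (f i))"
  by (induction A rule: infinite_finite_induct) simp_all

end

text \<open>
  The homogeneous component of degree \<open>n\<close>.
\<close>

definition homog :: "nat \<Rightarrow> ('k::field, 'v) flie set" where
  "homog n = abs_flie ` {t. lie_homogeneous n t}"

lemma homog_zero: "0 \<in> homog n"
  unfolding homog_def zero_flie.abs_eq by (blast intro: lie_homogeneous.intros)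

lemma homog_gen: "fgen v \<in> homog 1"
  unfolding homog_def fgen.abs_eq by (intro imageI CollectI lie_homogeneous.intros)

lemma homog_add: "x \<in> homog n \<Longrightarrow> y \<in> homog n \<Longrightarrow> x + y \<in> homog n"
  unfolding homog_def by (force simp: plus_flie.abs_eq intro: lie_homogeneous.intros)

lemma homog_scale: "x \<in> homog n \<Longrightarrow> c \<cdot> x \<in> homog n"
  unfolding homog_def by (force simp: fscale.abs_eq intro: lie_homogeneous.intros)

lemma homog_bracket: "x \<in> homog m \<Longrightarrow> y \<in> homog n \<Longrightarrow> \<langle>x, y\<rangle> \<in> homog (m + n)"
  unfolding homog_def by (force simp: fbracket.abs_eq intro: lie_homogeneous.intros)

lemma homog_sum: "(\<And>i. i \<in> A \<Longrightarrow> f i \<in> homog n) \<Longrightarrow> sum f A \<in> homog n"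
  by (induction A rule: infinite_finite_induct) (simp_all add: homog_zero homog_add)

lemma homog_uminus: "x \<in> homog n \<Longrightarrow> - x \<in> homog n"
  using homog_scale[of x n "- 1"] by (simp add: F.scl_minus_left F.scl_one)

lemma homog_diff: "x \<in> homog n \<Longrightarrow> y \<in> homog n \<Longrightarrow> x - y \<in> homog n"
  using homog_add[of x n "- y"] homog_uminus[of y n] by simp

lemma homog_induct [consumes 1, case_names gen zero add scale bracket]:
  assumes "x \<in> homog n"
    and "\<And>v. P 1 (fgen v)" "\<And>n. P n 0"
    and "\<And>n x y. x \<in> homog n \<Longrightarrow> y \<in> homog n \<Longrightarrow> P n x \<Longrightarrow> P n y \<Longrightarrow> P n (x + y)"
    and "\<And>n c x. x \<in> homog n \<Longrightarrow> P n x \<Longrightarrow> P n (c \<cdot> x)"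
    and "\<And>m n x y. x \<in> homog m \<Longrightarrow> y \<in> homog n \<Longrightarrow> P m x \<Longrightarrow> P n y \<Longrightarrow> P (m + n) \<langle>x, y\<rangle>"
  shows "P n (x :: ('k::field, 'v) flie)"
proof -
  have "abs_flie t \<in> homog n \<and> P n (abs_flie t)" if "lie_homogeneous n t" for n and t :: "('k, 'v) lie_term"
    using that
    by induction (simp_all add: abs_flie_simps assms homog_gen homog_zero homog_add
        homog_scale homog_bracket del: One_nat_def)
  then show ?thesis
    using assms(1) unfolding homog_def by blast
qed

text \<open>
  Only zero is homogeneous of degree 0, because every generator has degree 1.
\<close>

lemma homog_0: "x \<in> homog 0 \<Longrightarrow> x = 0"
proof -
  have "n = 0 \<longrightarrow> x = 0" if "x \<in> homog n" for n and x :: "('k::field, 'v) flie"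
    using that by (induction rule: homog_induct) (simp_all add: F.scl_zero_right F.br_zero_left)
  then show "x \<in> homog 0 \<Longrightarrow> x = 0" by blast
qed

section \<open>Metabelian ideals\<close>

text \<open>
  The smallest ideal that contains \<open>S\<close> and the second derived subalgebra.  The double brackets are
  its only additional generators, since the ideal that they generate is the second derived subalgebra.
\<close>

inductive_set metabelian_ideal :: "('k::field, 'v) flie set \<Rightarrow> ('k, 'v) flie set" for S where
  base: "x \<in> S \<Longrightarrow> x \<in> metabelian_ideal S"
| double: "\<langle>\<langle>u, v\<rangle>, \<langle>x, y\<rangle>\<rangle> \<in> metabelian_ideal S"
| zero: "0 \<in> metabelian_ideal S"
| add: "x \<in> metabelian_ideal S \<Longrightarrow> y \<in> metabelian_ideal S \<Longrightarrow> x + y \<in> metabelian_ideal S"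
| scale: "x \<in> metabelian_ideal S \<Longrightarrow> c \<cdot> x \<in> metabelian_ideal S"
| bracket: "y \<in> metabelian_ideal S \<Longrightarrow> \<langle>x, y\<rangle> \<in> metabelian_ideal S"

lemma metabelian_ideal_uminus: "x \<in> metabelian_ideal S \<Longrightarrow> - x \<in> metabelian_ideal S"
  using metabelian_ideal.scale[of x S "- 1"] by (simp add: F.scl_minus_left F.scl_one)

lemma metabelian_ideal_diff:
  "x \<in> metabelian_ideal S \<Longrightarrow> y \<in> metabelian_ideal S \<Longrightarrow> x - y \<in> metabelian_ideal S"
  using metabelian_ideal.add[of x S "- y"] metabelian_ideal_uminus[of y S] by simp

lemma metabelian_ideal_bracket_left: "x \<in> metabelian_ideal S \<Longrightarrow> \<langle>x, y\<rangle> \<in> metabelian_ideal S"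
  using metabelian_ideal_uminus[OF metabelian_ideal.bracket[of x S y]]
  by (simp add: F.br_anticommute[of y x])

lemma metabelian_ideal_sum:
  "(\<And>i. i \<in> A \<Longrightarrow> f i \<in> metabelian_ideal S) \<Longrightarrow> sum f A \<in> metabelian_ideal S"
  by (induction A rule: infinite_finite_induct)
    (simp_all add: metabelian_ideal.zero metabelian_ideal.add)

lemmas metabelian_ideal_intros =
  metabelian_ideal.double metabelian_ideal.zero metabelian_ideal.add metabelian_ideal.scale
  metabelian_ideal.bracket metabelian_ideal_uminus metabelian_ideal_diff
  metabelian_ideal_bracket_left metabelian_ideal_sum

lemma metabelian_ideal_mono: "S \<subseteq> T \<Longrightarrow> x \<in> metabelian_ideal S \<Longrightarrow> x \<in> metabelian_ideal T"
  by (rotate_tac, induction rule: metabelian_ideal.induct)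
    (blast intro: metabelian_ideal.intros)+

inductive_set flie_derived :: "('k::field, 'v) flie set" where
  bracket: "\<langle>x, y\<rangle> \<in> flie_derived"
| zero: "0 \<in> flie_derived"
| add: "x \<in> flie_derived \<Longrightarrow> y \<in> flie_derived \<Longrightarrow> x + y \<in> flie_derived"
| scale: "x \<in> flie_derived \<Longrightarrow> c \<cdot> x \<in> flie_derived"

lemma flie_derived_uminus: "x \<in> flie_derived \<Longrightarrow> - x \<in> flie_derived"
  using flie_derived.scale[of x "- 1"] by (simp add: F.scl_minus_left F.scl_one)

lemma flie_derived_diff: "x \<in> flie_derived \<Longrightarrow> y \<in> flie_derived \<Longrightarrow> x - y \<in> flie_derived"
  using flie_derived.add[of x "- y"] flie_derived_uminus[of y] by simp

lemma flie_derived_sum: "(\<And>i. i \<in> A \<Longrightarrow> f i \<in> flie_derived) \<Longrightarrow> sum f A \<in> flie_derived"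
  by (induction A rule: infinite_finite_induct) (simp_all add: flie_derived.zero flie_derived.add)

lemma bracket_derived_in_metabelian_ideal:
  assumes "x \<in> flie_derived" "y \<in> flie_derived"
  shows "\<langle>x, y\<rangle> \<in> metabelian_ideal S"
  using assms(1)
proof induction
  case (bracket u v)
  show ?case
    using assms(2)
    by induction (simp_all add: F.br_zero_right F.br_add_right F.br_scl_right metabelian_ideal_intros)
qed (simp_all add: F.br_zero_left F.br_add_left F.br_scl_left metabelian_ideal_intros)

section \<open>Quadratic elements\<close>

text \<open>
  The element of degree 2 that is dual to the alternating form with matrix \<open>M\<close>.  The sum is over
  \<open>i < j\<close>, which avoids a division by 2.
\<close>

definition quad :: "nat set \<Rightarrow> (nat \<Rightarrow> nat \<Rightarrow> 'k::field) \<Rightarrow> ('k, nat) flie" where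
  "quad I M = (\<Sum>i\<in>I. \<Sum>j\<in>{j\<in>I. i < j}. M i j \<cdot> \<langle>fgen i, fgen j\<rangle>)"

lemma quad_zero: "quad I (\<lambda>i j. 0) = 0"
  by (simp add: quad_def F.scl_zero_left)

lemma quad_add: "quad I (\<lambda>i j. M i j + N i j) = quad I M + quad I N"
  by (simp add: quad_def F.scl_add_left sum.distrib)

lemma quad_diff: "quad I (\<lambda>i j. M i j - N i j) = quad I M - quad I N"
  by (simp add: quad_def F.scl_diff_left sum_subtractf)

lemma quad_scale: "quad I (\<lambda>i j. c * M i j) = c \<cdot> quad I M"
  by (simp add: quad_def F.scl_sum_right F.scl_scl)

lemma quad_sum: "quad I (\<lambda>i j. \<Sum>k\<in>A. c k * M k i j) = (\<Sum>k\<in>A. c k \<cdot> quad I (M k))"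
  by (induction A rule: infinite_finite_induct)
    (simp_all add: quad_zero quad_add quad_scale)

lemma homog_bracket_gens: "\<langle>fgen i, fgen j\<rangle> \<in> homog 2"
  using homog_bracket[OF homog_gen homog_gen] by (simp only: one_add_one)

lemma quad_homog: "quad I M \<in> homog 2"
  unfolding quad_def by (intro homog_sum homog_scale homog_bracket_gens)

lemma quad_derived: "quad I M \<in> flie_derived"
  unfolding quad_def by (intro flie_derived_sum flie_derived.scale flie_derived.bracket)

lemma sum_square_split:
  fixes T :: "nat \<Rightarrow> nat \<Rightarrow> 'b::ab_group_add"
  assumes "finite I"
  shows "(\<Sum>i\<in>I. \<Sum>j\<in>I. T i j) =
    (\<Sum>i\<in>I. T i i) + (\<Sum>i\<in>I. \<Sum>j\<in>{j\<in>I. i < j}. T i j + T j i)"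
proof -
  have "(\<Sum>j\<in>I. T i j) = T i i + (\<Sum>j\<in>{j\<in>I. i < j}. T i j) + (\<Sum>j\<in>{j\<in>I. j < i}. T i j)"
    if "i \<in> I" for i
  proof -
    have "I = insert i ({j\<in>I. i < j} \<union> {j\<in>I. j < i})"
      using that by auto
    then have "(\<Sum>j\<in>I. T i j) = (\<Sum>j\<in>insert i ({j\<in>I. i < j} \<union> {j\<in>I. j < i}). T i j)"
      by simp
    also have "\<dots> = T i i + (\<Sum>j\<in>{j\<in>I. i < j} \<union> {j\<in>I. j < i}. T i j)"
      using assms by (subst sum.insert) auto
    also have "(\<Sum>j\<in>{j\<in>I. i < j} \<union> {j\<in>I. j < i}. T i j) =
        (\<Sum>j\<in>{j\<in>I. i < j}. T i j) + (\<Sum>j\<in>{j\<in>I. j < i}. T i j)"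
      using assms by (intro sum.union_disjoint) auto
    finally show ?thesis by (simp add: add.assoc)
  qed
  then have "(\<Sum>i\<in>I. \<Sum>j\<in>I. T i j) = (\<Sum>i\<in>I. T i i) +
      (\<Sum>i\<in>I. \<Sum>j\<in>{j\<in>I. i < j}. T i j) + (\<Sum>i\<in>I. \<Sum>j\<in>{j\<in>I. j < i}. T i j)"
    by (simp add: sum.distrib)
  also have "(\<Sum>i\<in>I. \<Sum>j\<in>{j\<in>I. j < i}. T i j) = (\<Sum>j\<in>I. \<Sum>i\<in>{i\<in>I. j < i}. T i j)"
    using assms by (rule sum.swap_restrict[OF _ assms])
  finally show ?thesis
    by (simp add: sum.distrib add.assoc)
qed

text \<open>
  This is the identification of the bracket of two functionals with the form
  \<open>x \<and> y \<mapsto> \<alpha>(x) \<beta>(y) - \<alpha>(y) \<beta>(x)\<close>, in coordinates.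
\<close>

lemma bracket_of_combinations:
  assumes "finite I"
  shows "\<langle>\<Sum>i\<in>I. a i \<cdot> fgen i, \<Sum>j\<in>I. b j \<cdot> fgen j\<rangle> = quad I (\<lambda>i j. a i * b j - a j * b i)"
proof -
  have "\<langle>\<Sum>i\<in>I. a i \<cdot> fgen i, \<Sum>j\<in>I. b j \<cdot> fgen j\<rangle> =
      (\<Sum>i\<in>I. \<Sum>j\<in>I. (a i * b j) \<cdot> \<langle>fgen i, fgen j\<rangle>)"
    by (simp only: F.br_sum_left) (simp add: F.br_sum_right F.br_scl_left F.br_scl_right
        F.scl_scl F.scl_sum_right mult.commute)
  also have "\<dots> = (\<Sum>i\<in>I. \<Sum>j\<in>{j\<in>I. i < j}.
      (a i * b j) \<cdot> \<langle>fgen i, fgen j\<rangle> + (a j * b i) \<cdot> \<langle>fgen j, fgen i\<rangle>)"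
    by (subst sum_square_split[OF assms]) (simp add: F.br_self F.scl_zero_right)
  also have "\<dots> = quad I (\<lambda>i j. a i * b j - a j * b i)"
    unfolding quad_def
    by (intro sum.cong HOL.refl)
      (subst F.br_anticommute, simp add: F.scl_diff_left F.scl_minus_right)
  finally show ?thesis .
qed

text \<open>
  The triples with three different entries group into the three cyclic rotations of each
  \<open>p < q < j\<close>, and each group vanishes by the Jacobi identity.  The induction adds the largest
  index \<open>m\<close>: the new triples have \<open>m\<close> in the last place or as \<open>q\<close>, and these two parts cancel.
\<close>

lemma sum_alternating_jacobi:
  fixes T :: "nat \<Rightarrow> nat \<Rightarrow> nat \<Rightarrow> 'b::ab_group_add"
  assumes fin: "finite G"
    and sym: "\<And>p q j. T p q j = T q p j" and diag: "\<And>p q. T p q q = 0"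
    and jacobi: "\<And>p q j. T p q j + T q j p + T j p q = 0"
  shows "(\<Sum>j\<in>G. \<Sum>p\<in>G. \<Sum>q\<in>{q\<in>G. p < q}. T p q j) = 0"
  using fin
proof (induction G rule: finite_linorder_max_induct)
  case empty
  then show ?case by simp
next
  case (insert m G)
  have m: "m \<notin> G" using insert.hyps by auto
  have inner: "(\<Sum>p\<in>insert m G. \<Sum>q\<in>{q\<in>insert m G. p < q}. T p q j) =
      (\<Sum>p\<in>G. T p m j) + (\<Sum>p\<in>G. \<Sum>q\<in>{q\<in>G. p < q}. T p q j)" for j
  proof -
    have top: "{q\<in>insert m G. m < q} = {}"
      using insert.hyps by auto
    have rest: "{q\<in>insert m G. p < q} = insert m {q\<in>G. p < q}" if "p \<in> G" for p
      using insert.hyps that by auto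
    have "(\<Sum>p\<in>insert m G. \<Sum>q\<in>{q\<in>insert m G. p < q}. T p q j) =
        (\<Sum>p\<in>G. \<Sum>q\<in>{q\<in>insert m G. p < q}. T p q j)"
      by (simp only: sum.insert[OF insert.hyps(1) m] top sum.empty add_0_left)
    also have "\<dots> = (\<Sum>p\<in>G. T p m j + (\<Sum>q\<in>{q\<in>G. p < q}. T p q j))"
      using insert.hyps(1) m by (intro sum.cong[OF HOL.refl]) (simp only: rest, subst sum.insert, auto)
    finally show ?thesis
      by (simp add: sum.distrib)
  qed
  have "(\<Sum>j\<in>G. \<Sum>p\<in>G. T p m j) =
      (\<Sum>j\<in>G. T j m j) + (\<Sum>j\<in>G. \<Sum>p\<in>{p\<in>G. j < p}. T p m j + T j m p)"
    by (rule sum_square_split) (rule insert.hyps)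
  also have "(\<Sum>j\<in>G. T j m j) = 0"
    using sym diag by (metis (no_types, lifting) sum.neutral)
  also have "(\<Sum>j\<in>G. \<Sum>p\<in>{p\<in>G. j < p}. T p m j + T j m p) =
      - (\<Sum>j\<in>G. \<Sum>p\<in>{p\<in>G. j < p}. T j p m)"
  proof -
    have "T p m j + T j m p = - T j p m" for j p
      using jacobi[of j p m] sym[of m j p] by (simp add: eq_neg_iff_add_eq_0 ac_simps)
    then show ?thesis
      by (simp add: sum_negf)
  qed
  finally have mixed: "(\<Sum>j\<in>G. \<Sum>p\<in>G. T p m j) = - (\<Sum>p\<in>G. \<Sum>q\<in>{q\<in>G. p < q}. T p q m)"
    by simp
  have "(\<Sum>p\<in>G. T p m m) = 0"
    by (simp add: diag)
  then show ?case
    unfolding inner using insert m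
    by (simp add: sum.distrib mixed)
qed

section \<open>Lie algebras built from the free one\<close>

text \<open>
  Lie algebra homomorphisms into the dual numbers over a Lie algebra that are the identity modulo
  the infinitesimal are derivations.  So the universal property, applied to the dual numbers, gives
  a derivation with prescribed values on the generators.
\<close>

definition dual_scale :: "'k::field \<Rightarrow> ('k, 'v) flie \<times> ('k, 'v) flie \<Rightarrow> ('k, 'v) flie \<times> ('k, 'v) flie"
  where "dual_scale c x = (c \<cdot> fst x, c \<cdot> snd x)"

definition dual_bracket ::
    "('k::field, 'v) flie \<times> ('k, 'v) flie \<Rightarrow> ('k, 'v) flie \<times> ('k, 'v) flie \<Rightarrow>
      ('k, 'v) flie \<times> ('k, 'v) flie"
  where "dual_bracket x y = (\<langle>fst x, fst y\<rangle>, \<langle>snd x, fst y\<rangle> + \<langle>fst x, snd y\<rangle>)"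

lemma dual_simps [simp]:
  "fst (dual_scale c x) = c \<cdot> fst x" "snd (dual_scale c x) = c \<cdot> snd x"
  "fst (dual_bracket x y) = \<langle>fst x, fst y\<rangle>"
  "snd (dual_bracket x y) = \<langle>snd x, fst y\<rangle> + \<langle>fst x, snd y\<rangle>"
  by (simp_all add: dual_scale_def dual_bracket_def)

interpretation Dual: lie_structure dual_scale dual_bracket
proof
  fix x y z :: "('k::field, 'v) flie \<times> ('k, 'v) flie"
  show "dual_bracket x (dual_bracket y z) +
      (dual_bracket y (dual_bracket z x) + dual_bracket z (dual_bracket x y)) = 0"
  proof (rule prod_eqI)
    show "snd (dual_bracket x (dual_bracket y z) +
      (dual_bracket y (dual_bracket z x) + dual_bracket z (dual_bracket x y))) = snd (0 :: ('k, 'v) flie \<times> ('k, 'v) flie)"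
    proof -
      obtain x1 x2 y1 y2 z1 z2 where [simp]: "x = (x1, x2)" "y = (y1, y2)" "z = (z1, z2)"
        by (metis prod.exhaust)
      have "snd (dual_bracket x (dual_bracket y z) +
          (dual_bracket y (dual_bracket z x) + dual_bracket z (dual_bracket x y))) =
        (\<langle>x1, \<langle>y1, z2\<rangle>\<rangle> + (\<langle>y1, \<langle>z2, x1\<rangle>\<rangle> + \<langle>z2, \<langle>x1, y1\<rangle>\<rangle>)) +
        (\<langle>x1, \<langle>y2, z1\<rangle>\<rangle> + (\<langle>y2, \<langle>z1, x1\<rangle>\<rangle> + \<langle>z1, \<langle>x1, y2\<rangle>\<rangle>)) +
        (\<langle>x2, \<langle>y1, z1\<rangle>\<rangle> + (\<langle>y1, \<langle>z1, x2\<rangle>\<rangle> + \<langle>z1, \<langle>x2, y1\<rangle>\<rangle>))"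
        by (simp add: F.br_add_right ac_simps)
      then show ?thesis
        by (simp only: F.br_jacobi) simp
    qed
  qed (simp add: F.br_jacobi)
qed (simp_all add: prod_eq_iff F.scl_add_right F.scl_add_left
    F.scl_scl F.scl_one F.br_add_left F.br_add_right F.br_scl_left F.br_scl_right F.br_self ac_simps
    F.br_anticommute[of "snd x" "fst x" for x])

definition derivation_of :: "('v \<Rightarrow> ('k::field, 'v) flie) \<Rightarrow> ('k, 'v) flie \<Rightarrow> ('k, 'v) flie" where
  "derivation_of d x = snd (Dual.lie_hom (\<lambda>v. (fgen v, d v)) x)"

lemma fst_dual_hom: "fst (Dual.lie_hom (\<lambda>v. (fgen v, d v)) x) = x"
  by (induction x rule: flie_induct) simp_all

lemma derivation_of_simps [simp]:
  "derivation_of d (fgen v) = d v"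
  "derivation_of d 0 = 0"
  "derivation_of d (x + y) = derivation_of d x + derivation_of d y"
  "derivation_of d (c \<cdot> x) = c \<cdot> derivation_of d x"
  "derivation_of d \<langle>x, y\<rangle> = \<langle>derivation_of d x, y\<rangle> + \<langle>x, derivation_of d y\<rangle>"
  by (simp_all add: derivation_of_def fst_dual_hom)

text \<open>
  The semidirect product of a Lie algebra with a one-dimensional one that acts by the
  derivation \<open>D\<close>: the pair \<open>(x, c)\<close> stands for \<open>x + c t\<close>, where \<open>[t, x] = D x\<close>.
\<close>

locale flie_derivation =
  fixes D :: "('k::field, 'v) flie \<Rightarrow> ('k, 'v) flie"
  assumes D_add: "D (x + y) = D x + D y"
    and D_scale: "D (c \<cdot> x) = c \<cdot> D x"
    and D_bracket: "D \<langle>x, y\<rangle> = \<langle>D x, y\<rangle> + \<langle>x, D y\<rangle>"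
begin

definition semi_scale :: "'k \<Rightarrow> ('k, 'v) flie \<times> 'k \<Rightarrow> ('k, 'v) flie \<times> 'k" where
  "semi_scale c x = (c \<cdot> fst x, c * snd x)"

definition semi_bracket :: "('k, 'v) flie \<times> 'k \<Rightarrow> ('k, 'v) flie \<times> 'k \<Rightarrow> ('k, 'v) flie \<times> 'k" where
  "semi_bracket x y = (\<langle>fst x, fst y\<rangle> + snd x \<cdot> D (fst y) - snd y \<cdot> D (fst x), 0)"

lemma semi_simps [simp]:
  "fst (semi_scale c x) = c \<cdot> fst x" "snd (semi_scale c x) = c * snd x"
  "fst (semi_bracket x y) = \<langle>fst x, fst y\<rangle> + snd x \<cdot> D (fst y) - snd y \<cdot> D (fst x)"
  "snd (semi_bracket x y) = 0"
  by (simp_all add: semi_scale_def semi_bracket_def)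

lemma D_zero: "D 0 = 0"
  using D_add[of 0 0] by simp

lemma D_uminus: "D (- x) = - D x"
  using D_add[of x "- x"] by (simp add: D_zero eq_neg_iff_add_eq_0 add.commute)

lemma D_diff: "D (x - y) = D x - D y"
  using D_add[of x "- y"] by (simp add: D_uminus)

lemma D_sum: "D (sum f A) = (\<Sum>i\<in>A. D (f i))"
  by (induction A rule: infinite_finite_induct) (simp_all add: D_zero D_add)

sublocale Semi: lie_structure semi_scale semi_bracket
proof
  fix x y z :: "('k, 'v) flie \<times> 'k"
  obtain x1 c y1 d z1 e where [simp]: "x = (x1, c)" "y = (y1, d)" "z = (z1, e)"
    by (metis prod.exhaust)
  have anti: "\<langle>D x1, y1\<rangle> = - \<langle>y1, D x1\<rangle>" "\<langle>D y1, z1\<rangle> = - \<langle>z1, D y1\<rangle>"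
    "\<langle>D z1, x1\<rangle> = - \<langle>x1, D z1\<rangle>"
    by (simp_all add: F.br_anticommute[of "D _"] )
  have "fst (semi_bracket x (semi_bracket y z) +
      (semi_bracket y (semi_bracket z x) + semi_bracket z (semi_bracket x y))) =
      \<langle>x1, \<langle>y1, z1\<rangle>\<rangle> + (\<langle>y1, \<langle>z1, x1\<rangle>\<rangle> + \<langle>z1, \<langle>x1, y1\<rangle>\<rangle>)"
    by (simp add: F.br_add_right F.br_diff_right F.br_scl_right D_add D_diff
        D_scale D_bracket F.scl_add_right F.scl_diff_right F.scl_scl anti F.scl_minus_right
        F.scl_zero_left)
      (simp add: algebra_simps)
  then show "semi_bracket x (semi_bracket y z) +
      (semi_bracket y (semi_bracket z x) + semi_bracket z (semi_bracket x y)) = 0"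
    by (simp add: prod_eq_iff F.br_jacobi del: fst_add semi_simps(3))
qed (simp_all add: prod_eq_iff F.scl_add_right F.scl_add_left
    F.scl_scl F.scl_one F.br_add_left F.br_add_right F.br_scl_left F.br_scl_right F.br_self
    D_add D_scale F.scl_diff_right algebra_simps)

end

text \<open>
  A two-step nilpotent algebra whose two coordinates are the degrees 1 and 2.  The homomorphism to
  it that maps a generator to itself in degree 1 projects the free Lie algebra to its components of
  degree 1 and 2.
\<close>

definition step_bracket ::
    "('k::field, 'v) flie \<times> ('k, 'v) flie \<Rightarrow> ('k, 'v) flie \<times> ('k, 'v) flie \<Rightarrow>
      ('k, 'v) flie \<times> ('k, 'v) flie"
  where "step_bracket x y = (0, \<langle>fst x, fst y\<rangle>)"

lemma step_simps [simp]:
  "fst (step_bracket x y) = 0" "snd (step_bracket x y) = \<langle>fst x, fst y\<rangle>"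
  by (simp_all add: step_bracket_def)

interpretation Step: lie_structure dual_scale step_bracket
  by standard (simp_all add: prod_eq_iff F.scl_add_right
      F.scl_add_left F.scl_scl F.scl_one F.br_add_left F.br_add_right F.br_scl_left F.br_scl_right
      F.br_self F.br_zero_right F.scl_zero_right)

section \<open>Splitting off one generator\<close>

abbreviation quadratic_relations ::
    "nat set \<Rightarrow> (nat \<Rightarrow> nat \<Rightarrow> 'k::field) set \<Rightarrow> ('k, nat) flie set" where
  "quadratic_relations I Q \<equiv> fgen ` (- I) \<union> quad I ` Q"

definition triple_brackets :: "('k::field, 'v) flie set" where
  "triple_brackets = {\<langle>\<langle>u, v\<rangle>, w\<rangle> | u v w. True}"

lemma triple_brackets_right: "\<langle>w, \<langle>u, v\<rangle>\<rangle> \<in> triple_brackets"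
proof -
  have "\<langle>w, \<langle>u, v\<rangle>\<rangle> = \<langle>\<langle>v, u\<rangle>, w\<rangle>"
    by (simp add: F.br_anticommute[of _ w] F.br_anticommute[of v u] F.br_minus_right)
  then show ?thesis
    unfolding triple_brackets_def by blast
qed

lemma step_hom_degrees:
  assumes "x \<in> homog n"
  shows "Step.lie_hom (\<lambda>v. (fgen v, 0)) x = (if n = 1 then x else 0, if n = 2 then x else 0)"
  using assms
proof (induction rule: homog_induct)
  case (bracket m n x y)
  show ?case
  proof (cases "m = 0 \<or> n = 0")
    case True
    then have "x = 0 \<or> y = 0"
      using bracket.hyps homog_0 by blast
    then have "\<langle>x, y\<rangle> = 0"
      by (auto simp: F.br_zero_left F.br_zero_right)
    then show ?thesis
      by (simp add: zero_prod_def[symmetric] del: Step.lie_hom_simps(5))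
  next
    case False
    have "m + n = 2 \<longleftrightarrow> m = 1 \<and> n = 1"
      using False by auto
    then show ?thesis
      using False bracket.IH
      by (auto simp: prod_eq_iff F.br_zero_left F.br_zero_right)
  qed
qed (auto simp: prod_eq_iff F.scl_zero_right)

text \<open>
  Triple brackets have degree 3: the projection to the components of degree 1 and 2 kills them and
  the double brackets, and it fixes the other elements that generate the ideal, as these are
  homogeneous of degree 1 or 2.
\<close>

lemma metabelian_ideal_degree_two:
  assumes "x \<in> homog 2" and "x \<in> metabelian_ideal (quadratic_relations I Q \<union> triple_brackets)"
  shows "x \<in> metabelian_ideal (quadratic_relations I Q)"
proof -
  let ?pr = "Step.lie_hom (\<lambda>v. (fgen v, 0))"
  let ?K = "metabelian_ideal (quadratic_relations I Q)"
  have "fst (?pr x) \<in> ?K \<and> snd (?pr x) \<in> ?K"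
    using assms(2)
  proof induction
    case (base x)
    then consider i where "x = fgen i" "i \<in> - I" | M where "x = quad I M" "M \<in> Q"
      | u v w where "x = \<langle>\<langle>u, v\<rangle>, w\<rangle>"
      unfolding triple_brackets_def by blast
    then show ?case
    proof cases
      case 1
      then show ?thesis
        by (simp add: metabelian_ideal.zero metabelian_ideal.base)
    next
      case 2
      then show ?thesis
        by (simp add: step_hom_degrees[OF quad_homog] metabelian_ideal.zero metabelian_ideal.base)
    next
      case 3
      then show ?thesis
        by (simp add: F.br_zero_left metabelian_ideal.zero)
    qed
  qed (simp_all add: F.br_zero_left metabelian_ideal_intros)
  then show ?thesis
    using step_hom_degrees[OF assms(1)] by simp
qed

text \<open>
  The combinatorial core.  \<open>Q\<close> is the space of matrices of the forms \<open>\<phi>(w\<^sub>i w\<^sub>j)\<close>, where \<open>\<phi>\<close> runs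
  through the functionals on \<open>A\<^sup>2\<close>, and \<open>E k\<close> is the matrix of the functional \<open>\<epsilon>\<^sub>k\<close> dual to \<open>a w\<^sub>k\<close>.
  \<open>KA\<close> and \<open>KB\<close> are the ideals of relations of the metabelian holonomy Lie algebras of \<open>A\<close> and \<open>B\<close>, the latter
  with the generator 0 as an additional relation.
\<close>

locale split_generator =
  fixes n :: nat
    and Q :: "(nat \<Rightarrow> nat \<Rightarrow> 'k::field) set"
    and E :: "nat \<Rightarrow> nat \<Rightarrow> nat \<Rightarrow> 'k"
  assumes Q_zero: "(\<lambda>i j. 0) \<in> Q"
    and Q_add: "M \<in> Q \<Longrightarrow> N \<in> Q \<Longrightarrow> (\<lambda>i j. M i j + N i j) \<in> Q"
    and Q_scale: "M \<in> Q \<Longrightarrow> (\<lambda>i j. c * M i j) \<in> Q"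
    and Q_diagonal: "M \<in> Q \<Longrightarrow> M i i = 0"
    and Q_antisym: "M \<in> Q \<Longrightarrow> M j i = - M i j"
    and E_in_Q: "k \<in> {1..n} \<Longrightarrow> E k \<in> Q"
    and E_row: "k \<in> {1..n} \<Longrightarrow> j \<in> {1..n} \<Longrightarrow> E k 0 j = (if j = k then 1 else 0)"
begin

(* the degree 1 is not to be rewritten to Suc 0 *)
declare One_nat_def [simp del]

definition Q0 :: "(nat \<Rightarrow> nat \<Rightarrow> 'k) set" where
  "Q0 = {M \<in> Q. \<forall>j\<le>n. M 0 j = 0}"

abbreviation "KA \<equiv> metabelian_ideal (quadratic_relations {..n} Q)"
abbreviation "KB \<equiv> metabelian_ideal (quadratic_relations {1..n} Q0)"

text \<open>
  The homomorphism that induces \<open>\<g>(B) \<rightarrow> \<g>(A)\<close>.  It kills the generator 0, which is zero in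
  \<open>\<g>(B)\<close>, but not in \<open>\<g>(A)\<close>.
\<close>

definition p :: "('k, nat) flie \<Rightarrow> ('k, nat) flie" where
  "p = F.lie_hom (\<lambda>i. if i = 0 then 0 else fgen i)"

text \<open>
  Modulo the relation of \<open>E i\<close>, whose row 0 is a unit vector, the bracket of the generators 0 and
  \<open>i\<close> is this quadratic element in the generators \<open>1, \<dots>, n\<close>.
\<close>

definition D :: "('k, nat) flie \<Rightarrow> ('k, nat) flie" where
  "D = derivation_of (\<lambda>i. if i \<in> {1..n} then - quad {1..n} (E i) else 0)"

sublocale D: flie_derivation D
  by standard (simp_all add: D_def)

text \<open>
  The homomorphism to the semidirect product, in which the generator 0 becomes the element that acts as \<open>D\<close>.
\<close>

definition \<Psi> :: "('k, nat) flie \<Rightarrow> ('k, nat) flie \<times> 'k" where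
  "\<Psi> = D.Semi.lie_hom (\<lambda>i. if i = 0 then (0, 1) else (fgen i, 0))"

lemma p_simps [simp]:
  "p (fgen i) = (if i = 0 then 0 else fgen i)" "p 0 = 0" "p (x + y) = p x + p y"
  "p (c \<cdot> x) = c \<cdot> p x" "p \<langle>x, y\<rangle> = \<langle>p x, p y\<rangle>" "p (- x) = - p x" "p (x - y) = p x - p y"
  "p (sum f A) = (\<Sum>i\<in>A. p (f i))"
  by (simp_all add: p_def)

lemma D_gen: "D (fgen i) = (if i \<in> {1..n} then - quad {1..n} (E i) else 0)"
  by (simp add: D_def)

lemmas D_simps [simp] =
  D.D_add D.D_scale D.D_bracket D.D_zero D.D_uminus D.D_diff D.D_sum

lemma \<Psi>_simps [simp]:
  "\<Psi> (fgen i) = (if i = 0 then (0, 1) else (fgen i, 0))" "\<Psi> 0 = 0"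
  "\<Psi> (x + y) = \<Psi> x + \<Psi> y" "\<Psi> (c \<cdot> x) = D.semi_scale c (\<Psi> x)"
  "\<Psi> \<langle>x, y\<rangle> = D.semi_bracket (\<Psi> x) (\<Psi> y)" "\<Psi> (- x) = - \<Psi> x" "\<Psi> (x - y) = \<Psi> x - \<Psi> y"
  "\<Psi> (sum f A) = (\<Sum>i\<in>A. \<Psi> (f i))"
  by (simp_all add: \<Psi>_def)

lemma Q_sum: "(\<And>k. k \<in> A \<Longrightarrow> M k \<in> Q) \<Longrightarrow> (\<lambda>i j. \<Sum>k\<in>A. c k * M k i j) \<in> Q"
proof (induction A rule: infinite_finite_induct)
  case (insert k A)
  then show ?case
    using Q_add[OF Q_scale[of "M k" "c k"], of "\<lambda>i j. \<Sum>k\<in>A. c k * M k i j"] by simp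
qed (simp_all add: Q_zero)

lemma Q_diff: "M \<in> Q \<Longrightarrow> N \<in> Q \<Longrightarrow> (\<lambda>i j. M i j - N i j) \<in> Q"
  using Q_add[of M "\<lambda>i j. - 1 * N i j"] Q_scale[of N "- 1"] by simp

lemma p_quad: "p (quad {1..n} M) = quad {1..n} M"
  by (simp add: quad_def)

lemma quad_split: "quad {..n} M = (\<Sum>j\<in>{1..n}. M 0 j \<cdot> \<langle>fgen 0, fgen j\<rangle>) + quad {1..n} M"
proof -
  have I: "{..n} = insert 0 {1..n}" by auto
  have "{j\<in>{..n}. 0 < j} = {1..n}" by auto
  moreover have "{j\<in>{..n}. i < j} = {j\<in>{1..n}. i < j}" for i by auto
  ultimately show ?thesis
    unfolding quad_def
    by (subst (1) I) (subst sum.insert, simp_all)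
qed

lemma p_maps_KB_to_KA: "x \<in> KB \<Longrightarrow> p x \<in> KA"
proof (induction rule: metabelian_ideal.induct)
  case (base x)
  then consider i where "x = fgen i" "i \<notin> {1..n}" | M where "x = quad {1..n} M" "M \<in> Q0"
    by blast
  then show ?case
  proof cases
    case 1
    then show ?thesis
      by (cases "i = 0") (auto intro!: metabelian_ideal.zero metabelian_ideal.base)
  next
    case 2
    then have "p x = quad {..n} M"
      by (simp add: p_quad quad_split Q0_def F.scl_zero_left)
    then show ?thesis
      using 2 by (auto simp: Q0_def intro!: metabelian_ideal.base)
  qed
qed (simp_all add: metabelian_ideal_intros)

text \<open>
  Both sides are derivations along \<open>p\<close>, so it suffices to compare them on generators.
\<close>

lemma bracket_gen0_mod_KA: "\<langle>fgen 0, p z\<rangle> - p (D z) \<in> KA"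
proof (induction z rule: flie_induct)
  case (gen i)
  consider "i = 0" | "i \<in> {1..n}" | "i \<notin> {..n}"
    by fastforce
  then show ?case
  proof cases
    case 1
    then show ?thesis
      by (simp add: D_gen F.br_zero_right metabelian_ideal.zero)
  next
    case 2
    have "(\<Sum>j\<in>{1..n}. E i 0 j \<cdot> \<langle>fgen 0, fgen j\<rangle>) =
        (\<Sum>j\<in>{1..n}. if j = i then \<langle>fgen 0, fgen j\<rangle> else 0)"
      by (intro sum.cong HOL.refl) (simp add: E_row[OF 2] F.scl_one F.scl_zero_left)
    also have "\<dots> = \<langle>fgen 0, fgen i\<rangle>"
      using 2 by simp
    finally have "\<langle>fgen 0, p (fgen i)\<rangle> - p (D (fgen i)) = quad {..n} (E i)"
      using 2 by (simp add: D_gen p_quad quad_split)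
    then show ?thesis
      using E_in_Q[OF 2] by (auto intro!: metabelian_ideal.base)
  next
    case 3
    then have "fgen i \<in> KA"
      by (auto intro!: metabelian_ideal.base)
    then show ?thesis
      using 3 by (auto simp: D_gen metabelian_ideal_intros)
  qed
next
  case (add x y)
  then show ?case
    using metabelian_ideal.add by (fastforce simp: F.br_add_right algebra_simps)
next
  case (scale c x)
  then show ?case
    using metabelian_ideal.scale[of "\<langle>fgen 0, p x\<rangle> - p (D x)" _ c]
    by (simp add: F.br_scl_right F.scl_diff_right)
next
  case (bracket x y)
  have "\<langle>fgen 0, p \<langle>x, y\<rangle>\<rangle> - p (D \<langle>x, y\<rangle>) =
      \<langle>\<langle>fgen 0, p x\<rangle> - p (D x), p y\<rangle> + \<langle>p x, \<langle>fgen 0, p y\<rangle> - p (D y)\<rangle>"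
    by (simp add: F.br_leibniz[of "fgen 0"] F.br_diff_left F.br_diff_right)
  then show ?case
    using bracket.IH by (simp only: metabelian_ideal_intros)
qed (simp add: F.br_zero_right metabelian_ideal.zero)

text \<open>
  In \<open>\<g>(A)\<close>, the homomorphism \<open>p\<close>, extended to the semidirect product by sending the acting
  element to the generator 0, is a left inverse of \<open>\<Psi>\<close>.
\<close>

lemma decomposition_mod_KA: "y - p (fst (\<Psi> y)) - snd (\<Psi> y) \<cdot> fgen 0 \<in> KA"
proof (induction y rule: flie_induct)
  case (gen i)
  then show ?case
    by (simp add: F.scl_one F.scl_zero_left metabelian_ideal.zero)
next
  case (add x y)
  then show ?case
    using metabelian_ideal.add by (fastforce simp: F.scl_add_left algebra_simps)
next
  case (scale c x)
  then show ?case
    using metabelian_ideal.scale[of "x - p (fst (\<Psi> x)) - snd (\<Psi> x) \<cdot> fgen 0" _ c]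
    by (simp add: F.scl_diff_right F.scl_scl)
next
  case (bracket x y)
  define x' c where x': "x' = fst (\<Psi> x)" and c: "c = snd (\<Psi> x)"
  define y' d where y': "y' = fst (\<Psi> y)" and d: "d = snd (\<Psi> y)"
  define k l where k: "k = x - p x' - c \<cdot> fgen 0" and l: "l = y - p y' - d \<cdot> fgen 0"
  have kl: "k \<in> KA" "l \<in> KA"
    using bracket.IH by (simp_all add: k l x' c y' d)
  have xy: "x = k + p x' + c \<cdot> fgen 0" "y = l + p y' + d \<cdot> fgen 0"
    by (simp_all add: k l)
  have "\<langle>x, y\<rangle> - p (fst (\<Psi> \<langle>x, y\<rangle>)) - snd (\<Psi> \<langle>x, y\<rangle>) \<cdot> fgen 0 =
      \<langle>x, y\<rangle> - \<langle>p x', p y'\<rangle> - c \<cdot> p (D y') + d \<cdot> p (D x')"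
    by (simp add: x' y' c d F.scl_zero_left)
  also have "\<dots> = \<langle>k, y\<rangle> + \<langle>x - k, l\<rangle> + c \<cdot> (\<langle>fgen 0, p y'\<rangle> - p (D y'))
      - d \<cdot> (\<langle>fgen 0, p x'\<rangle> - p (D x'))"
    by (simp add: xy F.br_add_left F.br_add_right F.br_diff_left F.br_diff_right F.br_scl_left
        F.br_scl_right F.scl_diff_right F.br_self F.scl_zero_right F.br_anticommute[of "p x'" "fgen 0"]
        F.scl_minus_right)
  also have "\<dots> \<in> KA"
    using kl bracket_gen0_mod_KA by (simp only: metabelian_ideal_intros)
  finally show ?case .
qed (simp add: F.scl_zero_left metabelian_ideal.zero)

text \<open>
  In the other order, \<open>\<Psi>\<close> after \<open>p\<close> is the identity modulo the generator 0, which is a relation of \<open>B\<close>.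
\<close>

lemma \<Psi>_of_p: "snd (\<Psi> (p x)) = 0 \<and> fst (\<Psi> (p x)) - x \<in> KB"
proof (induction x rule: flie_induct)
  case (gen i)
  then show ?case
    using metabelian_ideal_uminus[OF metabelian_ideal.base[of "fgen 0" "quadratic_relations {1..n} Q0"]]
    by (cases "i = 0") (simp_all add: metabelian_ideal.zero)
next
  case (add x y)
  then show ?case
    using metabelian_ideal.add by (fastforce simp: algebra_simps)
next
  case (scale c x)
  then show ?case
    using metabelian_ideal.scale[of "fst (\<Psi> (p x)) - x" _ c] by (simp add: F.scl_diff_right)
next
  case (bracket x y)
  have "fst (\<Psi> (p \<langle>x, y\<rangle>)) - \<langle>x, y\<rangle> =
      \<langle>fst (\<Psi> (p x)) - x, fst (\<Psi> (p y))\<rangle> + \<langle>x, fst (\<Psi> (p y)) - y\<rangle>"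
    using bracket.IH by (simp add: F.br_diff_left F.br_diff_right F.scl_zero_left)
  also have "\<dots> \<in> KB"
    using bracket.IH by (simp only: metabelian_ideal_intros)
  finally show ?case
    by simp
qed (simp add: metabelian_ideal.zero)

lemma D_derived: "D x \<in> flie_derived"
  by (induction x rule: flie_induct)
    (auto simp: D_gen flie_derived.intros flie_derived_uminus quad_derived)

lemma D_homog: "x \<in> homog m \<Longrightarrow> D x \<in> homog (Suc m)"
proof (induction rule: homog_induct)
  case (gen i)
  have "quad {1..n} (E i) \<in> homog (Suc 1)"
    using quad_homog[of "{1..n}" "E i"] by (simp add: numeral_2_eq_2)
  then show ?case
    by (simp add: D_gen homog_zero homog_uminus)
next
  case (bracket k m x y)
  then show ?case
    using homog_bracket[OF bracket.IH(1) bracket.hyps(2)] homog_bracket[OF bracket.hyps(1) bracket.IH(2)]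
    by (simp add: homog_add)
qed (simp_all add: homog_zero homog_add homog_scale)

lemma p_homog: "x \<in> homog m \<Longrightarrow> p x \<in> homog m"
  by (induction rule: homog_induct)
    (simp_all add: homog_zero homog_add homog_scale homog_bracket homog_gen)

lemma \<Psi>_homog: "y \<in> homog m \<Longrightarrow> fst (\<Psi> y) \<in> homog m \<and> (m \<noteq> 1 \<longrightarrow> snd (\<Psi> y) = 0)"
proof (induction rule: homog_induct)
  case (gen i)
  then show ?case
    by (simp add: homog_zero homog_gen)
next
  case (bracket k m x y)
  have "snd (\<Psi> x) \<cdot> D (fst (\<Psi> y)) \<in> homog (k + m)"
    using bracket.IH D_homog[of "fst (\<Psi> y)" m]
    by (cases "k = 1") (simp_all add: homog_scale F.scl_zero_left homog_zero One_nat_def)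
  moreover have "snd (\<Psi> y) \<cdot> D (fst (\<Psi> x)) \<in> homog (k + m)"
    using bracket.IH D_homog[of "fst (\<Psi> x)" k]
    by (cases "m = 1") (simp_all add: homog_scale F.scl_zero_left homog_zero One_nat_def)
  ultimately show ?case
    using bracket.IH by (simp add: homog_add homog_diff homog_bracket)
qed (simp_all add: homog_zero homog_add homog_scale)

lemma p_surjective_mod_KA:
  assumes "y \<in> homog s" and "s \<ge> 2"
  shows "\<exists>x\<in>homog s. y - p x \<in> KA"
  using \<Psi>_homog[OF assms(1)] decomposition_mod_KA[of y] assms(2)
  by (auto simp: F.scl_zero_left)

text \<open>
  If \<open>D\<close> preserves an ideal that contains \<open>KB\<close>, then \<open>\<Psi>\<close> maps \<open>KA\<close> into it, and so it inverts
  \<open>p\<close> modulo this ideal.  The parameter \<open>T\<close> allows two uses: it is empty where \<open>D\<close> preserves \<open>KB\<close>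
  itself, and consists of the triple brackets where the relations are only compared in degree 2.
\<close>

lemma p_injective_mod_KA_aux:
  assumes T: "D ` (quad {1..n} ` Q0 \<union> T) \<subseteq> metabelian_ideal (quadratic_relations {1..n} Q0 \<union> T)"
    and x: "p x \<in> KA"
  shows "x \<in> metabelian_ideal (quadratic_relations {1..n} Q0 \<union> T)"
proof -
  let ?K = "metabelian_ideal (quadratic_relations {1..n} Q0 \<union> T)"
  have D_K: "D y \<in> ?K" if "y \<in> ?K" for y
    using that
  proof induction
    case (base y)
    then show ?case
      using T by (auto simp: D_gen metabelian_ideal.zero)
  qed (simp_all add: F.br_add_left F.br_add_right metabelian_ideal_intros)
  have \<Psi>_derived: "fst (\<Psi> \<langle>u, v\<rangle>) \<in> flie_derived" for u v
    by (auto intro!: flie_derived_diff flie_derived.intros D_derived)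
  have \<Psi>_K: "fst (\<Psi> y) \<in> ?K \<and> snd (\<Psi> y) = 0" if "y \<in> KA" for y
    using that
  proof induction
    case (base y)
    then consider i where "y = fgen i" "i \<notin> {..n}" | M where "y = quad {..n} M" "M \<in> Q"
      by blast
    then show ?case
    proof cases
      case 1
      then show ?thesis
        by (auto intro!: metabelian_ideal.base)
    next
      case 2
      \<comment> \<open>Row 0 of \<open>M\<close> yields the values \<open>D\<close> of generators; subtracting them leaves the matrix
        \<open>N\<close>, whose row 0 vanishes, so that it is a relation of \<open>B\<close>.\<close>
      define N where "N = (\<lambda>i j. M i j - (\<Sum>k\<in>{1..n}. M 0 k * E k i j))"
      have "N \<in> Q"
        unfolding N_def using 2 by (intro Q_diff Q_sum E_in_Q)
      moreover have "N 0 j = 0" if "j \<le> n" for j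
      proof (cases "j = 0")
        case True
        then show ?thesis
          using \<open>N \<in> Q\<close> Q_diagonal by blast
      next
        case False
        then have "j \<in> {1..n}" using that by simp
        have "(\<Sum>k\<in>{1..n}. M 0 k * E k 0 j) = (\<Sum>k\<in>{1..n}. if k = j then M 0 k else 0)"
          using \<open>j \<in> {1..n}\<close> by (intro sum.cong HOL.refl) (auto simp: E_row)
        then show ?thesis
          using \<open>j \<in> {1..n}\<close> by (simp add: N_def)
      qed
      ultimately have "N \<in> Q0"
        by (simp add: Q0_def)
      have quad1: "\<Psi> (quad {1..n} M) = (quad {1..n} M, 0)"
        by (simp add: quad_def prod_eq_iff fst_sum snd_sum F.scl_zero_left)
      have "\<Psi> y = (quad {1..n} N, 0)"
      proof (rule prod_eqI)
        have "fst (\<Psi> y) = (\<Sum>j\<in>{1..n}. M 0 j \<cdot> D (fgen j)) + quad {1..n} M"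
          unfolding 2(1) quad_split
          by (simp add: quad1 fst_sum F.br_zero_left F.scl_one F.scl_zero_left)
        also have "\<dots> = quad {1..n} N"
          by (simp add: N_def quad_diff quad_sum D_gen F.scl_minus_right sum_negf)
        finally show "fst (\<Psi> y) = fst (quad {1..n} N, 0 :: 'k)" by simp
        show "snd (\<Psi> y) = snd (quad {1..n} N, 0)"
          unfolding 2(1) quad_split by (simp add: quad1 snd_sum)
      qed
      then show ?thesis
        using \<open>N \<in> Q0\<close> by (auto intro!: metabelian_ideal.base)
    qed
  next
    case (double u v x y)
    have "snd (\<Psi> \<langle>u, v\<rangle>) = 0" "snd (\<Psi> \<langle>x, y\<rangle>) = 0"
      by simp_all
    then have "fst (\<Psi> \<langle>\<langle>u, v\<rangle>, \<langle>x, y\<rangle>\<rangle>) = \<langle>fst (\<Psi> \<langle>u, v\<rangle>), fst (\<Psi> \<langle>x, y\<rangle>)\<rangle>"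
      by (subst \<Psi>_simps(5)) (simp only: D.semi_simps F.scl_zero_left diff_zero add_0_right)
    also have "\<dots> \<in> ?K"
      by (intro bracket_derived_in_metabelian_ideal \<Psi>_derived)
    finally show ?case
      by (simp del: \<Psi>_simps(5)) (simp add: \<Psi>_simps(5))
  next
    case (bracket y x)
    then show ?case
      by (simp add: F.scl_zero_left metabelian_ideal_intros D_K)
  qed (simp_all add: metabelian_ideal_intros)
  have "fst (\<Psi> (p x)) \<in> ?K"
    using \<Psi>_K[OF x] by blast
  moreover have "fst (\<Psi> (p x)) - x \<in> ?K"
    using \<Psi>_of_p[of x] metabelian_ideal_mono[of "quadratic_relations {1..n} Q0"] by blast
  ultimately have "fst (\<Psi> (p x)) - (fst (\<Psi> (p x)) - x) \<in> ?K"
    by (rule metabelian_ideal_diff)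
  then show ?thesis by simp
qed

text \<open>
  Here \<open>D\<close> raises degrees by 1, so it maps the relations to triple brackets.
\<close>

lemma p_injective_degree_two:
  assumes "x \<in> homog 2" "p x \<in> KA"
  shows "x \<in> KB"
proof (rule metabelian_ideal_degree_two[OF assms(1)], rule p_injective_mod_KA_aux[OF _ assms(2)])
  let ?K = "metabelian_ideal (quadratic_relations {1..n} Q0 \<union> triple_brackets)"
  have triple: "\<langle>\<langle>u, v\<rangle>, w\<rangle> \<in> ?K" "\<langle>w, \<langle>u, v\<rangle>\<rangle> \<in> ?K" for u v w
    using triple_brackets_right by (auto simp: triple_brackets_def intro!: metabelian_ideal.base)
  have left: "\<langle>x, w\<rangle> \<in> ?K" if "x \<in> flie_derived" for x w
    using that
    by (induction rule: flie_derived.induct)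
      (simp_all add: triple F.br_zero_left F.br_add_left F.br_scl_left metabelian_ideal_intros)
  have right: "\<langle>w, x\<rangle> \<in> ?K" if "x \<in> flie_derived" for x w
    using that
    by (induction rule: flie_derived.induct)
      (simp_all add: triple F.br_zero_right F.br_add_right F.br_scl_right metabelian_ideal_intros)
  have D_br: "D \<langle>x, y\<rangle> \<in> ?K" for x y
    by (simp add: metabelian_ideal.add left right D_derived)
  have "D x \<in> ?K" if "x \<in> flie_derived" for x
    using that
    by (induction rule: flie_derived.induct) (simp_all add: D_br metabelian_ideal_intros del: D.D_bracket)
  then show "D ` (quad {1..n} ` Q0 \<union> triple_brackets) \<subseteq> ?K"
    by (auto simp: quad_derived triple_brackets_def flie_derived.bracket simp del: D.D_bracket)
qed

text \<open>
  By antisymmetry \<open>D\<close> maps the quadratic element of \<open>M\<close> to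
  \<open>- \<Sum>\<^sub>j \<Sum>\<^sub>p\<^sub><\<^sub>q (\<Sum>\<^sub>i M\<^sub>i\<^sub>j E\<^sub>i\<^sub>p\<^sub>q) [[x\<^sub>p, x\<^sub>q], x\<^sub>j]\<close>.  An alternating \<open>Z\<close> may be added to the coefficients
  for free, by the Jacobi identity, and by assumption it turns them into relations for each \<open>j\<close>.
\<close>

lemma p_injective_mod_KA:
  assumes extension: "\<And>M. M \<in> Q0 \<Longrightarrow>
      \<exists>Z. (\<forall>p q j. Z q p j = - Z p q j) \<and> (\<forall>p q j. Z p j q = - Z p q j) \<and> (\<forall>p q. Z p p q = 0) \<and>
        (\<forall>p q. Z p q q = 0) \<and>
        (\<forall>j\<in>{1..n}. (\<lambda>p q. Z p q j - (\<Sum>i\<in>{1..n}. M i j * E i p q)) \<in> Q0)"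
    and x: "p x \<in> KA"
  shows "x \<in> KB"
proof -
  have "D (quad {1..n} M) \<in> KB" if "M \<in> Q0" for M
  proof -
    obtain Z where Z: "\<And>p q j. Z q p j = - Z p q j" "\<And>p q j. Z p j q = - Z p q j"
        "\<And>p q. Z p p q = 0" "\<And>p q. Z p q q = 0"
      and rel: "\<And>j. j \<in> {1..n} \<Longrightarrow> (\<lambda>p q. Z p q j - (\<Sum>i\<in>{1..n}. M i j * E i p q)) \<in> Q0"
      using extension[OF \<open>M \<in> Q0\<close>] by blast
    have M: "M i i = 0" "M j i = - M i j" for i j
      using \<open>M \<in> Q0\<close> Q_diagonal Q_antisym by (auto simp: Q0_def)
    have "D (quad {1..n} M) = (\<Sum>i\<in>{1..n}. \<Sum>j\<in>{1..n}. M i j \<cdot> \<langle>D (fgen i), fgen j\<rangle>)"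
    proof -
      have "M i j \<cdot> \<langle>D (fgen i), fgen j\<rangle> + M j i \<cdot> \<langle>D (fgen j), fgen i\<rangle> =
          M i j \<cdot> (\<langle>D (fgen i), fgen j\<rangle> + \<langle>fgen i, D (fgen j)\<rangle>)" for i j
        by (subst M(2), subst F.br_anticommute[of "D (fgen j)"])
          (simp add: F.scl_minus_left F.scl_minus_right F.scl_add_right)
      then show ?thesis
        by (subst sum_square_split) (simp_all add: M(1) F.scl_zero_left quad_def)
    qed
    also have "\<dots> = (\<Sum>j\<in>{1..n}. \<Sum>i\<in>{1..n}. M i j \<cdot> \<langle>D (fgen i), fgen j\<rangle>)"
      by (rule sum.swap)
    also have "\<dots> = (\<Sum>j\<in>{1..n}. \<langle>quad {1..n} (\<lambda>p q. Z p q j - (\<Sum>i\<in>{1..n}. M i j * E i p q)), fgen j\<rangle>)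
        - (\<Sum>j\<in>{1..n}. \<langle>quad {1..n} (\<lambda>p q. Z p q j), fgen j\<rangle>)"
      unfolding sum_subtractf[symmetric]
    proof (intro sum.cong HOL.refl)
      fix j
      have "(\<Sum>i\<in>{1..n}. M i j \<cdot> \<langle>D (fgen i), fgen j\<rangle>) =
          - \<langle>quad {1..n} (\<lambda>p q. \<Sum>i\<in>{1..n}. M i j * E i p q), fgen j\<rangle>"
        by (simp add: D_gen quad_sum F.br_sum_left F.br_scl_left F.br_minus_left F.scl_minus_right
            sum_negf)
      then show "(\<Sum>i\<in>{1..n}. M i j \<cdot> \<langle>D (fgen i), fgen j\<rangle>) =
          \<langle>quad {1..n} (\<lambda>p q. Z p q j - (\<Sum>i\<in>{1..n}. M i j * E i p q)), fgen j\<rangle>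
          - \<langle>quad {1..n} (\<lambda>p q. Z p q j), fgen j\<rangle>"
        by (simp add: quad_diff F.br_diff_left)
    qed
    also have "(\<Sum>j\<in>{1..n}. \<langle>quad {1..n} (\<lambda>p q. Z p q j), fgen j\<rangle>) =
        (\<Sum>j\<in>{1..n}. \<Sum>p\<in>{1..n}. \<Sum>q\<in>{q\<in>{1..n}. p < q}. Z p q j \<cdot> \<langle>\<langle>fgen p, fgen q\<rangle>, fgen j\<rangle>)"
      unfolding quad_def by (simp add: F.br_sum_left F.br_scl_left)
    also have "\<dots> = 0"
    proof -
      define T where "T p q j = Z p q j \<cdot> \<langle>\<langle>fgen p, fgen q\<rangle>, fgen j\<rangle>" for p q j :: nat
      have sym: "T p q j = T q p j" for p q j
      proof -
        have "T q p j = (- Z p q j) \<cdot> \<langle>- \<langle>fgen p, fgen q\<rangle>, fgen j\<rangle>"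
          unfolding T_def Z(1)[of q p j] F.br_anticommute[of "fgen q" "fgen p"] by (rule HOL.refl)
        then show ?thesis
          by (simp add: T_def F.br_minus_left F.scl_minus_left F.scl_minus_right)
      qed
      have diag: "T p q q = 0" for p q
        by (simp add: T_def Z(4) F.scl_zero_left)
      have jacobi: "T p q j + T q j p + T j p q = 0" for p q j
      proof -
        have cyc: "Z q j p = Z p q j" "Z j p q = Z p q j"
          using Z(1)[of q p j] Z(2)[of q p j] Z(2)[of p j q] Z(1)[of j p q] by simp_all
        have anti: "\<langle>\<langle>fgen u, fgen v\<rangle>, fgen w\<rangle> = - (\<langle>fgen w, \<langle>fgen u, fgen v\<rangle>\<rangle> :: ('k, nat) flie)"
          for u v w :: nat
          by (rule F.br_anticommute)
        have "T p q j + T q j p + T j p q = - Z p q j \<cdot> (\<langle>fgen p, \<langle>fgen q, fgen j\<rangle>\<rangle> +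
            (\<langle>fgen q, \<langle>fgen j, fgen p\<rangle>\<rangle> + \<langle>fgen j, \<langle>fgen p, fgen q\<rangle>\<rangle>))"
          unfolding T_def cyc anti
          by (simp add: F.scl_minus_left F.scl_add_right F.scl_minus_right)
        then show ?thesis
          by (simp only: F.br_jacobi F.scl_zero_right)
      qed
      have "(\<Sum>j\<in>{1..n}. \<Sum>p\<in>{1..n}. \<Sum>q\<in>{q\<in>{1..n}. p < q}. T p q j) = 0"
        by (rule sum_alternating_jacobi) (simp, rule sym, rule diag, rule jacobi)
      then show ?thesis
        by (simp only: T_def)
    qed
    finally have "D (quad {1..n} M) =
        (\<Sum>j\<in>{1..n}. \<langle>quad {1..n} (\<lambda>p q. Z p q j - (\<Sum>i\<in>{1..n}. M i j * E i p q)), fgen j\<rangle>)"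
      by simp
    also have "\<dots> \<in> KB"
      by (intro metabelian_ideal_sum metabelian_ideal_bracket_left metabelian_ideal.base UnI2 imageI rel)
    finally show ?thesis .
  qed
  then show ?thesis
    using p_injective_mod_KA_aux[of "{}" x] x by auto
qed

end

section \<open>Quotients of modules\<close>

lemma cring_scalar_field: "cring (scalar_field :: 'k::field ring)"
  by (rule cringI)
    (auto intro!: abelian_groupI comm_monoidI simp: algebra_simps, metis add.right_inverse)

lemma quot_alg_simps:
  "carrier (quot_alg A I) = a_rcosets\<^bsub>A\<^esub> I"
  "mult (quot_alg A I) = rcoset_mult A I"
  "zero (quot_alg A I) = I"
  "add (quot_alg A I) = set_add A"
  "smult (quot_alg A I) = (\<lambda>c X. \<Union>x\<in>X. I +>\<^bsub>A\<^esub> (c \<odot>\<^bsub>A\<^esub> x))"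
  by (simp_all add: quot_alg_def FactRing_def ring.defs module.defs)

lemma neg_one_smult:
  fixes M :: "('k::field, 'c) module" (structure)
  assumes "module scalar_field M" "x \<in> carrier M"
  shows "(- 1) \<odot> x = \<ominus> x"
proof -
  interpret module scalar_field M by fact
  have "(- 1) \<odot> x \<oplus> x = \<zero>"
    using smult_l_distr[of "- 1" 1 x] smult_l_null[of x] smult_one[of x] assms(2) by simp
  then show ?thesis
    using minus_equality[of "(- 1) \<odot> x" x] smult_closed[of "- 1" x] assms(2) by simp
qed

text \<open>
  A subspace \<open>J\<close> of a vector space, for calculations in the quotient by \<open>J\<close> and with functionals on \<open>J\<close>.
\<close>

locale module_subspace = module scalar_field M for M :: "('k::field, 'c) module" (structure) +
  fixes J
  assumes J: "submodule J scalar_field M"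
begin

lemma J_closed:
  "\<zero> \<in> J" "x \<in> J \<Longrightarrow> x \<in> carrier M" "x \<in> J \<Longrightarrow> y \<in> J \<Longrightarrow> x \<oplus> y \<in> J"
  "x \<in> J \<Longrightarrow> \<ominus> x \<in> J" "x \<in> J \<Longrightarrow> c \<odot> x \<in> J"
  using submoduleE[OF J] subgroup.one_closed[OF submodule.axioms(1)[OF J]] by auto

sublocale S: abelian_subgroup J M
  using submodule.axioms(1)[OF J]
  by (intro abelian_subgroupI3 additive_subgroup.intro) (auto intro: abelian_group_axioms)

lemma coset_eq_iff:
  assumes "x \<in> carrier M" "y \<in> carrier M"
  shows "J +> x = J +> y \<longleftrightarrow> x \<ominus> y \<in> J"
  using S.a_rcos_module[OF assms(2,1)] assms
  by (metis S.a_repr_independence' S.a_repr_independenceD minus_eq)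

lemma quot_carrier: "carrier (quot_alg M J) = (\<lambda>x. J +> x) ` carrier M"
  by (auto simp: quot_alg_simps A_RCOSETS_def' )

lemma quot_zero: "\<zero>\<^bsub>quot_alg M J\<^esub> = J +> \<zero>"
  using S.a_subset by (simp add: quot_alg_simps a_coset_add_zero)

lemma quot_add:
  "x \<in> carrier M \<Longrightarrow> y \<in> carrier M \<Longrightarrow> (J +> x) \<oplus>\<^bsub>quot_alg M J\<^esub> (J +> y) = J +> (x \<oplus> y)"
  by (simp add: quot_alg_simps S.a_rcos_sum)

lemma in_coset: "x \<in> carrier M \<Longrightarrow> z \<in> J +> x \<longleftrightarrow> (\<exists>j\<in>J. z = j \<oplus> x)"
  by (auto simp: a_r_coset_def')

lemma coset_absorb: "x \<in> carrier M \<Longrightarrow> j \<in> J \<Longrightarrow> J +> (j \<oplus> x) = J +> x"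
  using S.a_repr_independence'[of "j \<oplus> x" x] by (auto simp: in_coset)

lemma quot_smult:
  assumes "x \<in> carrier M"
  shows "c \<odot>\<^bsub>quot_alg M J\<^esub> (J +> x) = J +> (c \<odot> x)"
proof -
  have "J +> (c \<odot> z) = J +> (c \<odot> x)" if "z \<in> J +> x" for z
    using that assms by (auto simp: in_coset smult_r_distr J_closed coset_absorb)
  then have "(\<Union>z\<in>J +> x. J +> (c \<odot> z)) = (\<Union>z\<in>J +> x. J +> (c \<odot> x))"
    by (intro SUP_cong HOL.refl)
  moreover have "J +> x \<noteq> {}"
    using S.a_rcos_self[OF assms] by blast
  ultimately show ?thesis
    by (simp add: quot_alg_simps)
qed

lemma quot_mult:
  assumes "x \<in> carrier M" "y \<in> carrier M"
    and "\<And>j k. j \<in> J \<Longrightarrow> k \<in> J \<Longrightarrow> J +> ((j \<oplus> x) \<otimes> (k \<oplus> y)) = J +> (x \<otimes> y)"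
  shows "(J +> x) \<otimes>\<^bsub>quot_alg M J\<^esub> (J +> y) = J +> (x \<otimes> y)"
proof -
  have "J +> (u \<otimes> v) = J +> (x \<otimes> y)" if "u \<in> J +> x" "v \<in> J +> y" for u v
    using that assms by (auto simp: in_coset)
  then have "(\<Union>u\<in>J +> x. \<Union>v\<in>J +> y. J +> (u \<otimes> v)) = (\<Union>u\<in>J +> x. \<Union>v\<in>J +> y. J +> (x \<otimes> y))"
    by (intro SUP_cong HOL.refl)
  moreover have "J +> x \<noteq> {}" "J +> y \<noteq> {}"
    using S.a_rcos_self assms(1,2) by blast+
  ultimately show ?thesis
    by (simp add: quot_alg_simps rcoset_mult_def)
qed

end

lemma lin_span_subset:
  assumes "submodule W scalar_field V" "S \<subseteq> W"
  shows "lin_span V S \<subseteq> W"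
  using assms by (auto simp: lin_span_def)

lemma subset_lin_span: "S \<subseteq> lin_span V S"
  by (auto simp: lin_span_def)

lemma (in module) submodule_Inter:
  assumes "\<And>W. W \<in> \<W> \<Longrightarrow> submodule W R M" "\<W> \<noteq> {}"
  shows "submodule (\<Inter> \<W>) R M"
proof (rule submoduleI)
  have zero: "\<zero>\<^bsub>M\<^esub> \<in> W" if "W \<in> \<W>" for W
    using subgroup.one_closed[OF submodule.axioms(1)[OF assms(1)[OF that]]] by simp
  show "\<Inter> \<W> \<subseteq> carrier M"
    using assms submoduleE(1) by blast
  show "\<zero>\<^bsub>M\<^esub> \<in> \<Inter> \<W>"
    using zero by blast
  show "\<ominus>\<^bsub>M\<^esub> x \<in> \<Inter> \<W>" if "x \<in> \<Inter> \<W>" for x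
    using that submoduleE(3)[OF assms(1)] by simp
  show "x \<oplus>\<^bsub>M\<^esub> y \<in> \<Inter> \<W>" if "x \<in> \<Inter> \<W>" "y \<in> \<Inter> \<W>" for x y
    using that submoduleE(5)[OF assms(1)] by simp
  show "c \<odot>\<^bsub>M\<^esub> x \<in> \<Inter> \<W>" if "c \<in> carrier R" "x \<in> \<Inter> \<W>" for c x
    using that submoduleE(4)[OF assms(1)] by simp
qed

lemma lin_span_submodule:
  assumes "module scalar_field M" "S \<subseteq> carrier M"
  shows "submodule (lin_span M S) scalar_field M"
proof -
  interpret module scalar_field M by fact
  show ?thesis
    unfolding lin_span_def
    using assms carrier_is_submodule by (intro submodule_Inter) auto
qed

section \<open>Presentations\<close>

text \<open>
  \<open>L\<close> is the quotient of a free Lie algebra by the ideal \<open>K\<close>, with projection \<open>f\<close>.  All laws of a Lie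
  algebra hold in \<open>L\<close> because they hold in the free one.
\<close>

locale presentation =
  fixes L :: "('k::field, 'c) module" (structure)
    and f :: "('k, 'v) flie \<Rightarrow> 'c"
    and K :: "('k, 'v) flie set"
  assumes carrier_eq: "carrier L = range f"
    and f_add: "f (x + y) = f x \<oplus> f y"
    and f_zero: "f 0 = \<zero>"
    and f_scale: "f (c \<cdot> x) = c \<odot> f x"
    and f_bracket: "f \<langle>x, y\<rangle> = f x \<otimes> f y"
    and f_eq_iff: "f x = f y \<longleftrightarrow> x - y \<in> K"
begin

lemma in_K_iff: "x \<in> K \<longleftrightarrow> f x = \<zero>"
  using f_eq_iff[of x 0] by (simp add: f_zero)

lemma f_in_carrier: "f x \<in> carrier L"
  by (simp add: carrier_eq)

lemma abelian_group_L: "abelian_group L"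
proof (rule abelian_groupI)
  fix u assume "u \<in> carrier L"
  then obtain x where "u = f x" by (auto simp: carrier_eq)
  then have "f (- x) \<oplus> u = \<zero>"
    by (simp add: f_add[symmetric] f_zero[symmetric])
  then show "\<exists>v\<in>carrier L. v \<oplus> u = \<zero>"
    using f_in_carrier by blast
qed (auto simp: carrier_eq f_add[symmetric] f_zero[symmetric] ac_simps)

sublocale module scalar_field L
  by (rule moduleI[OF cring_scalar_field abelian_group_L])
    (auto simp: carrier_eq f_scale[symmetric] f_add[symmetric] F.scl_add_left F.scl_add_right
      F.scl_scl F.scl_one)

lemma f_uminus: "f (- x) = \<ominus> f x"
  using minus_equality[of "f (- x)" "f x"] f_add[of "- x" x] by (simp add: f_zero f_in_carrier)

lemma f_diff: "f (x - y) = f x \<ominus> f y"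
  using f_add[of x "- y"] by (simp add: f_uminus a_minus_def)

lemma image_submodule:
  assumes "0 \<in> X" "\<And>x y. x \<in> X \<Longrightarrow> y \<in> X \<Longrightarrow> x + y \<in> X" "\<And>c x. x \<in> X \<Longrightarrow> c \<cdot> x \<in> X"
  shows "submodule (f ` X) scalar_field L"
proof (rule submoduleI)
  show "\<zero> \<in> f ` X"
    using assms(1) f_zero by (metis imageI)
  show "\<ominus> u \<in> f ` X" if "u \<in> f ` X" for u
  proof -
    obtain x where "x \<in> X" "u = f x" using \<open>u \<in> f ` X\<close> by blast
    then have "\<ominus> u = f (- 1 \<cdot> x)"
      by (simp add: F.scl_minus_left F.scl_one f_uminus)
    then show ?thesis
      using assms(3)[OF \<open>x \<in> X\<close>] by blast
  qed
  show "u \<oplus> v \<in> f ` X" if "u \<in> f ` X" "v \<in> f ` X" for u v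
    using that assms(2) by (auto simp: f_add[symmetric])
  show "c \<odot> u \<in> f ` X" if "u \<in> f ` X" for c u
    using that assms(3) by (auto simp: f_scale[symmetric])
qed (auto simp: f_in_carrier)

lemma quotient:
  assumes J: "submodule J scalar_field L" and ideal: "\<And>u v. u \<in> carrier L \<Longrightarrow> v \<in> J \<Longrightarrow> u \<otimes> v \<in> J"
  shows "presentation (quot_alg L J) (\<lambda>x. J +> f x) (f -` J)"
proof -
  interpret Q: module_subspace L J
    by (rule module_subspace.intro[OF _ module_subspace_axioms.intro[OF J]]) unfold_locales
  have right: "v \<otimes> u \<in> J" if "u \<in> carrier L" "v \<in> J" for u v
  proof -
    obtain x y where "u = f x" "v = f y"
      using \<open>u \<in> carrier L\<close> Q.J_closed(2)[OF \<open>v \<in> J\<close>] unfolding carrier_eq by blast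
    then have "v \<otimes> u = \<ominus> (u \<otimes> v)"
      by (simp add: f_bracket[symmetric] f_uminus[symmetric] F.br_anticommute[of y x])
    then show ?thesis
      using ideal[OF that] Q.J_closed(4) by simp
  qed
  have mult: "J +> ((j \<oplus> f x) \<otimes> (k \<oplus> f y)) = J +> (f x \<otimes> f y)" if jk: "j \<in> J" "k \<in> J" for j k x y
  proof -
    obtain j' k' where *: "j = f j'" "k = f k'"
      using jk[THEN Q.J_closed(2)] unfolding carrier_eq by blast
    have "(j \<oplus> f x) \<otimes> (k \<oplus> f y) = (j \<otimes> (k \<oplus> f y) \<oplus> f x \<otimes> k) \<oplus> f x \<otimes> f y"
      unfolding * by (simp add: f_bracket[symmetric] f_add[symmetric] F.br_add_left F.br_add_right ac_simps)
    moreover have "j \<otimes> (k \<oplus> f y) \<oplus> f x \<otimes> k \<in> J"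
      using jk by (intro Q.J_closed(3) right ideal) (auto simp: f_in_carrier Q.J_closed)
    ultimately show ?thesis
      using Q.coset_absorb[of "f x \<otimes> f y"] f_in_carrier by (simp add: f_bracket[symmetric])
  qed
  show ?thesis
  proof
    show "carrier (quot_alg L J) = range (\<lambda>x. J +> f x)"
      by (simp add: Q.quot_carrier carrier_eq image_image)
    show "J +> f x = J +> f y \<longleftrightarrow> x - y \<in> f -` J" for x y
      by (simp add: Q.coset_eq_iff f_in_carrier f_diff)
    show "J +> f \<langle>x, y\<rangle> = (J +> f x) \<otimes>\<^bsub>quot_alg L J\<^esub> (J +> f y)" for x y
      by (subst Q.quot_mult) (simp_all add: f_in_carrier mult f_bracket)
  qed (simp_all add: f_add f_zero f_scale Q.quot_add Q.quot_zero Q.quot_smult f_in_carrier)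
qed

end

section \<open>The free Lie algebra on a vector space with a basis\<close>

lemma lie_eq_mono: "lie_eq no_vectors s t \<Longrightarrow> lie_eq V s t"
  by (induction rule: lie_eq.induct) (auto intro: lie_eq.intros simp: no_vectors_def)

text \<open>
  Substitution of terms for generators is the term version of a
  homomorphism from the free Lie algebra on a set to the free Lie algebra on a vector space.
\<close>

primrec lie_subst :: "('u \<Rightarrow> ('k, 'v) lie_term) \<Rightarrow> ('k, 'u) lie_term \<Rightarrow> ('k, 'v) lie_term" where
  "lie_subst g (Gen v) = g v"
| "lie_subst g Zero = Zero"
| "lie_subst g (Add s t) = Add (lie_subst g s) (lie_subst g t)"
| "lie_subst g (Scale c t) = Scale c (lie_subst g t)"
| "lie_subst g (Bracket s t) = Bracket (lie_subst g s) (lie_subst g t)"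

lemma lie_subst_cong: "lie_eq no_vectors s t \<Longrightarrow> lie_eq V (lie_subst g s) (lie_subst g t)"
proof (induction rule: lie_eq.induct)
  case (trans s t u)
  then show ?case by (blast intro: lie_eq.trans)
qed (auto intro: lie_eq.intros simp: no_vectors_def)

lemma lie_subst_in_lie_terms: "(\<And>v. g v \<in> lie_terms V) \<Longrightarrow> lie_subst g t \<in> lie_terms V"
  by (induction t) (auto simp: lie_terms_def)

lemma lie_subst_homogeneous:
  assumes "lie_homogeneous n t" "\<And>v. lie_homogeneous 1 (g v)"
  shows "lie_homogeneous n (lie_subst g t)"
  using assms(1)
  by induction (simp_all add: lie_homogeneous.intros assms(2) del: One_nat_def)

lemma lie_terms_simps:
  "Gen v \<in> lie_terms V \<longleftrightarrow> v \<in> carrier V" "Zero \<in> lie_terms V"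
  "Add s t \<in> lie_terms V \<longleftrightarrow> s \<in> lie_terms V \<and> t \<in> lie_terms V"
  "Scale c t \<in> lie_terms V \<longleftrightarrow> t \<in> lie_terms V"
  "Bracket s t \<in> lie_terms V \<longleftrightarrow> s \<in> lie_terms V \<and> t \<in> lie_terms V"
  by (auto simp: lie_terms_def)

lemma lie_class_eq_iff:
  assumes "t \<in> lie_terms V"
  shows "lie_class V s = lie_class V t \<longleftrightarrow> lie_eq V s t"
proof
  assume "lie_class V s = lie_class V t"
  moreover have "t \<in> lie_class V t"
    using assms lie_eq.refl by (auto simp: lie_class_def)
  ultimately show "lie_eq V s t"
    by (auto simp: lie_class_def)
next
  assume "lie_eq V s t"
  then show "lie_class V s = lie_class V t"
    by (auto simp: lie_class_def intro: lie_eq.trans lie_eq.sym)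
qed

lemma lie_class_self: "t \<in> lie_terms V \<Longrightarrow> t \<in> lie_class V t"
  by (simp add: lie_class_def lie_eq.refl)

lemma lie_class_UN:
  assumes "t \<in> lie_terms V" "\<And>s. s \<in> lie_class V t \<Longrightarrow> h s = X"
  shows "(\<Union>s\<in>lie_class V t. h s) = X"
  using lie_class_self[OF assms(1)] assms(2) by auto

lemma free_lie_simps:
  "carrier (free_lie V) = lie_class V ` lie_terms V"
  "\<zero>\<^bsub>free_lie V\<^esub> = lie_class V Zero"
  by (simp_all add: free_lie_def)

lemma free_lie_ops:
  "s \<in> lie_terms V \<Longrightarrow> t \<in> lie_terms V \<Longrightarrow>
    lie_class V s \<oplus>\<^bsub>free_lie V\<^esub> lie_class V t = lie_class V (Add s t)"
  "t \<in> lie_terms V \<Longrightarrow> c \<odot>\<^bsub>free_lie V\<^esub> lie_class V t = lie_class V (Scale c t)"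
  "s \<in> lie_terms V \<Longrightarrow> t \<in> lie_terms V \<Longrightarrow>
    lie_class V s \<otimes>\<^bsub>free_lie V\<^esub> lie_class V t = lie_class V (Bracket s t)"
proof -
  have eq: "lie_class V u = lie_class V v" if "lie_eq V v u" "v \<in> lie_terms V" for u v
    using that lie_class_eq_iff lie_eq.sym by blast
  show "s \<in> lie_terms V \<Longrightarrow> t \<in> lie_terms V \<Longrightarrow>
      lie_class V s \<oplus>\<^bsub>free_lie V\<^esub> lie_class V t = lie_class V (Add s t)"
    "s \<in> lie_terms V \<Longrightarrow> t \<in> lie_terms V \<Longrightarrow>
      lie_class V s \<otimes>\<^bsub>free_lie V\<^esub> lie_class V t = lie_class V (Bracket s t)"
    "t \<in> lie_terms V \<Longrightarrow> c \<odot>\<^bsub>free_lie V\<^esub> lie_class V t = lie_class V (Scale c t)"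
    unfolding free_lie_def
    by (auto intro!: lie_class_UN eq intro: lie_eq.intros simp: lie_class_def lie_terms_simps)
qed

lemma dual_space_simps:
  "\<zero>\<^bsub>dual_space V W\<^esub> = restrict (\<lambda>x. 0) W"
  "u \<oplus>\<^bsub>dual_space V W\<^esub> v = restrict (\<lambda>x. u x + v x) W"
  "c \<odot>\<^bsub>dual_space V W\<^esub> v = restrict (\<lambda>x. c * v x) W"
  by (simp_all add: dual_space_def)

text \<open>
  The part of a graded algebra that its holonomy Lie algebra depends on, in coordinates: a basis
  \<open>w\<close> of the degree 1 part, indexed by \<open>I\<close>, with dual basis \<open>\<alpha>\<close>, and the fact that the product
  followed by a functional on the degree 2 part is an alternating bilinear form.  It is used for
  \<open>A\<close> with \<open>I = {0, \<dots>, n}\<close> and for \<open>B\<close> with \<open>I = {1, \<dots>, n}\<close>.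
\<close>

locale degree_one_basis =
  fixes C :: "('k::field, 'c) module" (structure)
    and gr :: "nat \<Rightarrow> 'c set"
    and I :: "nat set"
    and w :: "nat \<Rightarrow> 'c"
    and \<alpha> :: "nat \<Rightarrow> 'c \<Rightarrow> 'k"
  assumes finite_I: "finite I"
    and gr1_add: "x \<in> gr 1 \<Longrightarrow> y \<in> gr 1 \<Longrightarrow> x \<oplus> y \<in> gr 1"
    and gr1_smult: "x \<in> gr 1 \<Longrightarrow> c \<odot> x \<in> gr 1"
    and w_in: "w i \<in> gr 1"
    and \<alpha>_in: "i \<in> I \<Longrightarrow> \<alpha> i \<in> carrier (dual_space C (gr 1))"
    and \<alpha>_w: "i \<in> I \<Longrightarrow> j \<in> I \<Longrightarrow> \<alpha> i (w j) = (if i = j then 1 else 0)"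
    and expand: "v \<in> carrier (dual_space C (gr 1)) \<Longrightarrow> x \<in> gr 1 \<Longrightarrow>
      v x = (\<Sum>i\<in>I. v (w i) * \<alpha> i x)"
    and form_expand: "\<phi> \<in> carrier (dual_space C (gr 2)) \<Longrightarrow> x \<in> gr 1 \<Longrightarrow> y \<in> gr 1 \<Longrightarrow>
      \<phi> (x \<otimes> y) = (\<Sum>i\<in>I. \<Sum>j\<in>I. \<alpha> i x * \<alpha> j y * \<phi> (w i \<otimes> w j))"
    and form_diagonal: "\<phi> \<in> carrier (dual_space C (gr 2)) \<Longrightarrow> \<phi> (w i \<otimes> w i) = 0"
    and form_antisym: "\<phi> \<in> carrier (dual_space C (gr 2)) \<Longrightarrow> \<phi> (w j \<otimes> w i) = - \<phi> (w i \<otimes> w j)"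
begin

(* the degree 1 is not to be rewritten to Suc 0 *)
declare One_nat_def [simp del]

abbreviation "V \<equiv> dual_space C (gr 1)"
abbreviation "L \<equiv> free_lie V"

definition Q :: "(nat \<Rightarrow> nat \<Rightarrow> 'k) set" where
  "Q = (\<lambda>\<phi> i j. \<phi> (w i \<otimes> w j)) ` carrier (dual_space C (gr 2))"

abbreviation "K \<equiv> metabelian_ideal (quadratic_relations I Q)"

definition gen_image :: "nat \<Rightarrow> ('k, 'c \<Rightarrow> 'k) lie_term" where
  "gen_image i = (if i \<in> I then Gen (\<alpha> i) else Zero)"

text \<open>
  The projection of the free Lie algebra on the natural numbers to that on the dual of the degree 1
  part, which sends the generator \<open>i\<close> to \<open>\<alpha>\<^sub>i\<close>, or to zero if \<open>i\<close> is not in \<open>I\<close>.  Its right inverse \<open>\<theta>\<close>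
  writes a functional in the dual basis, and \<open>e\<close> is the idempotent \<open>\<theta> f\<close>.
\<close>

definition f :: "('k, nat) flie \<Rightarrow> ('k, 'c \<Rightarrow> 'k) lie_term set" where
  "f x = lie_class V (lie_subst gen_image (rep_flie x))"

definition \<theta> :: "('k, 'c \<Rightarrow> 'k) lie_term \<Rightarrow> ('k, nat) flie" where
  "\<theta> = lie_eval fscale fbracket (\<lambda>v. \<Sum>i\<in>I. v (w i) \<cdot> fgen i)"

definition e :: "('k, nat) flie \<Rightarrow> ('k, nat) flie" where
  "e = F.lie_hom (\<lambda>i. if i \<in> I then fgen i else 0)"

lemma V_add: "u \<in> carrier V \<Longrightarrow> v \<in> carrier V \<Longrightarrow> u \<oplus>\<^bsub>V\<^esub> v \<in> carrier V"
  by (auto simp: dual_space_def gr1_add gr1_smult algebra_simps)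

lemma V_smult: "v \<in> carrier V \<Longrightarrow> c \<odot>\<^bsub>V\<^esub> v \<in> carrier V"
  by (auto simp: dual_space_def gr1_add gr1_smult algebra_simps)

lemma subst_in_lie_terms: "lie_subst gen_image t \<in> lie_terms V"
  by (rule lie_subst_in_lie_terms) (simp add: gen_image_def lie_terms_simps \<alpha>_in)

lemma f_abs: "f (abs_flie t) = lie_class V (lie_subst gen_image t)"
proof -
  have "lie_eq no_vectors (rep_flie (abs_flie t)) t"
    using Quotient3_rep_abs[OF Quotient3_flie] lie_eq.refl by blast
  then show ?thesis
    unfolding f_def lie_class_eq_iff[OF subst_in_lie_terms] by (rule lie_subst_cong)
qed

lemma f_simps:
  "f (fgen i) = lie_class V (gen_image i)"
  "f 0 = \<zero>\<^bsub>L\<^esub>"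
  "f (x + y) = f x \<oplus>\<^bsub>L\<^esub> f y"
  "f (c \<cdot> x) = c \<odot>\<^bsub>L\<^esub> f x"
  "f \<langle>x, y\<rangle> = f x \<otimes>\<^bsub>L\<^esub> f y"
proof -
  obtain s t where st: "x = abs_flie s" "y = abs_flie t"
    by (metis abs_rep_flie)
  note ops = free_lie_ops subst_in_lie_terms
  show "f (fgen i) = lie_class V (gen_image i)" "f 0 = \<zero>\<^bsub>L\<^esub>"
    using f_abs[of "Gen i"] f_abs[of Zero] by (simp_all add: abs_flie_simps free_lie_simps)
  show "f (x + y) = f x \<oplus>\<^bsub>L\<^esub> f y"
    using f_abs[of "Add s t"] by (simp add: st f_abs ops plus_flie.abs_eq)
  show "f (c \<cdot> x) = c \<odot>\<^bsub>L\<^esub> f x"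
    using f_abs[of "Scale c s"] by (simp add: st f_abs ops fscale.abs_eq)
  show "f \<langle>x, y\<rangle> = f x \<otimes>\<^bsub>L\<^esub> f y"
    using f_abs[of "Bracket s t"] by (simp add: st f_abs ops fbracket.abs_eq)
qed

lemma lie_eq_scale_zero: "lie_eq U (Scale 0 t) Zero"
proof -
  have "abs_flie (Scale 0 t) = abs_flie Zero"
    by (simp add: abs_flie_simps F.scl_zero_left)
  then have "lie_eq no_vectors (Scale 0 t) Zero"
    by (simp add: flie.abs_eq_iff)
  then show ?thesis
    by (rule lie_eq_mono)
qed

text \<open>
  The congruence knows the linear structure of the vector space only through sums and multiples of
  generators, so the linearity for combinations of the \<open>\<alpha>\<^sub>i\<close> takes an induction.
\<close>

lemma f_combination:
  assumes "J \<subseteq> I"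
  shows "restrict (\<lambda>x. \<Sum>i\<in>J. c i * \<alpha> i x) (gr 1) \<in> carrier V \<and>
    f (\<Sum>i\<in>J. c i \<cdot> fgen i) = lie_class V (Gen (restrict (\<lambda>x. \<Sum>i\<in>J. c i * \<alpha> i x) (gr 1)))"
  using finite_subset[OF assms finite_I] assms
proof (induction J rule: finite_induct)
  case empty
  define z :: "'c \<Rightarrow> 'k" where "z = restrict (\<lambda>x. 0) (gr 1)"
  have z: "z \<in> carrier V"
    by (auto simp: z_def dual_space_def gr1_add gr1_smult)
  have "0 \<odot>\<^bsub>V\<^esub> z = z"
    by (simp add: dual_space_simps z_def)
  then have "lie_eq V (Gen z) (Scale 0 (Gen z))"
    using gen_scale[OF z, of 0] by simp
  then have "lie_eq V (Gen z) Zero"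
    using lie_eq_scale_zero lie_eq.trans by blast
  then have "lie_class V (Gen z) = lie_class V Zero"
    by (simp add: lie_class_eq_iff lie_terms_simps)
  then show ?case
    using z by (simp only: sum.empty f_simps(2) free_lie_simps z_def[symmetric] HOL.simp_thms)
next
  case (insert j J)
  define u where "u = restrict (\<lambda>x. \<Sum>i\<in>J. c i * \<alpha> i x) (gr 1)"
  have u: "u \<in> carrier V" and fu: "f (\<Sum>i\<in>J. c i \<cdot> fgen i) = lie_class V (Gen u)"
    using insert.IH insert.prems unfolding u_def by blast+
  have j: "\<alpha> j \<in> carrier V" "j \<in> I"
    using insert.prems \<alpha>_in by auto
  have sum: "restrict (\<lambda>x. \<Sum>i\<in>insert j J. c i * \<alpha> i x) (gr 1) = (c j \<odot>\<^bsub>V\<^esub> \<alpha> j) \<oplus>\<^bsub>V\<^esub> u"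
    using insert.hyps by (auto simp: u_def dual_space_simps)
  have "f (\<Sum>i\<in>insert j J. c i \<cdot> fgen i) =
      lie_class V (Add (Scale (c j) (Gen (\<alpha> j))) (Gen u))"
    using insert.hyps j u
    by (simp add: f_simps fu gen_image_def free_lie_ops lie_terms_simps)
  also have "\<dots> = lie_class V (Gen ((c j \<odot>\<^bsub>V\<^esub> \<alpha> j) \<oplus>\<^bsub>V\<^esub> u))"
  proof -
    have "lie_eq V (Gen ((c j \<odot>\<^bsub>V\<^esub> \<alpha> j) \<oplus>\<^bsub>V\<^esub> u)) (Add (Gen (c j \<odot>\<^bsub>V\<^esub> \<alpha> j)) (Gen u))"
      by (intro gen_add V_smult j u)
    moreover have "lie_eq V (Add (Gen (c j \<odot>\<^bsub>V\<^esub> \<alpha> j)) (Gen u)) (Add (Scale (c j) (Gen (\<alpha> j))) (Gen u))"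
      by (intro cong_Add lie_eq.refl gen_scale j)
    ultimately have "lie_eq V (Add (Scale (c j) (Gen (\<alpha> j))) (Gen u)) (Gen ((c j \<odot>\<^bsub>V\<^esub> \<alpha> j) \<oplus>\<^bsub>V\<^esub> u))"
      by (blast intro: lie_eq.trans lie_eq.sym)
    then show ?thesis
      by (simp add: lie_class_eq_iff lie_terms_simps V_add V_smult j u)
  qed
  finally show ?case
    unfolding sum using V_add V_smult j u by simp
qed

lemma f_coordinates:
  assumes "v \<in> carrier V"
  shows "f (\<Sum>i\<in>I. v (w i) \<cdot> fgen i) = lie_class V (Gen v)"
proof -
  have "restrict (\<lambda>x. \<Sum>i\<in>I. v (w i) * \<alpha> i x) (gr 1) = v"
  proof
    fix x
    show "restrict (\<lambda>x. \<Sum>i\<in>I. v (w i) * \<alpha> i x) (gr 1) x = v x"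
    proof (cases "x \<in> gr 1")
      case True
      then show ?thesis using expand[OF assms True] by simp
    next
      case False
      then show ?thesis using assms by (auto simp: dual_space_def extensional_def)
    qed
  qed
  then show ?thesis
    using f_combination[OF order.refl, of "\<lambda>i. v (w i)"] by simp
qed

lemma f_\<theta>: "t \<in> lie_terms V \<Longrightarrow> f (\<theta> t) = lie_class V t"
  by (induction t)
    (simp_all add: \<theta>_def lie_terms_simps f_coordinates f_simps free_lie_ops free_lie_simps)

lemma e_simps [simp]:
  "e (fgen i) = (if i \<in> I then fgen i else 0)" "e 0 = 0" "e (x + y) = e x + e y"
  "e (c \<cdot> x) = c \<cdot> e x" "e \<langle>x, y\<rangle> = \<langle>e x, e y\<rangle>" "e (x - y) = e x - e y"
  by (simp_all add: e_def)

lemma f_e: "f (e x) = f x"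
  by (induction x rule: flie_induct) (simp_all add: f_simps gen_image_def free_lie_simps)

lemma \<theta>_subst: "\<theta> (lie_subst gen_image t) = e (abs_flie t)"
proof (induction t)
  case (Gen i)
  have "(\<Sum>j\<in>I. \<alpha> i (w j) \<cdot> fgen j) = (\<Sum>j\<in>I. if i = j then fgen j else 0)" if "i \<in> I"
    by (intro sum.cong HOL.refl) (auto simp: \<alpha>_w that F.scl_one F.scl_zero_left)
  then show ?case
    by (simp add: \<theta>_def gen_image_def abs_flie_simps finite_I)
qed (simp_all add: \<theta>_def abs_flie_simps)

lemma f_eq_iff: "f x = f y \<longleftrightarrow> e x = e y"
proof
  assume "f x = f y"
  then have "lie_eq V (lie_subst gen_image (rep_flie x)) (lie_subst gen_image (rep_flie y))"
    by (simp add: f_def lie_class_eq_iff subst_in_lie_terms)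
  then have "\<theta> (lie_subst gen_image (rep_flie x)) = \<theta> (lie_subst gen_image (rep_flie y))"
    unfolding \<theta>_def
    by (rule F.lie_eval_respects_lie_eq)
      (simp_all add: dual_space_simps w_in F.scl_add_left sum.distrib F.scl_sum_right F.scl_scl)
  then show "e x = e y"
    by (simp add: \<theta>_subst abs_rep_flie)
qed (metis f_e)

text \<open>
  The kernel of \<open>f\<close> is the kernel of \<open>e\<close>, as \<open>f\<close> is injective on the image of the idempotent \<open>e\<close>.
\<close>

lemma free_presentation: "presentation L f {x. e x = 0}"
proof
  show "carrier L = range f"
    unfolding free_lie_simps
  proof (intro equalityI subsetI)
    fix X assume "X \<in> lie_class V ` lie_terms V"
    then obtain t where "t \<in> lie_terms V" "X = lie_class V t"
      by blast
    then have "X = f (\<theta> t)"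
      by (simp add: f_\<theta>)
    then show "X \<in> range f"
      by (rule range_eqI)
  qed (auto simp: f_def subst_in_lie_terms)
qed (simp_all add: f_simps f_eq_iff)

lemma f_homog: "f ` homog n = free_lie_grading V n"
proof (intro equalityI subsetI)
  fix X assume "X \<in> f ` homog n"
  then obtain t where "lie_homogeneous n t" "X = lie_class V (lie_subst gen_image t)"
    by (auto simp: homog_def f_abs)
  moreover have "lie_homogeneous 1 (gen_image i)" for i
    unfolding gen_image_def using lie_homogeneous.intros(1,2) by auto
  ultimately show "X \<in> free_lie_grading V n"
    unfolding free_lie_grading_def using subst_in_lie_terms lie_subst_homogeneous by blast
next
  fix X assume "X \<in> free_lie_grading V n"
  then obtain t where t: "t \<in> lie_terms V" "lie_homogeneous n t" "X = lie_class V t"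
    by (auto simp: free_lie_grading_def)
  have "\<theta> t \<in> homog n"
    using t(2)
    by induction (simp_all add: \<theta>_def homog_zero homog_add homog_scale homog_bracket homog_sum
        homog_gen del: One_nat_def)
  then show "X \<in> f ` homog n"
    using f_\<theta>[OF t(1)] t(3) by blast
qed

end

section \<open>The metabelian holonomy Lie algebra by generators and relations\<close>

lemma (in presentation) lie_derived_eq:
  "lie_derived L (carrier L) = f ` flie_derived"
proof
  show "lie_derived L (carrier L) \<subseteq> f ` flie_derived"
    unfolding lie_derived_def
    by (intro lin_span_subset image_submodule)
      (auto intro: flie_derived.intros simp: carrier_eq f_bracket[symmetric])
  have "submodule (lie_derived L (carrier L)) scalar_field L"
    unfolding lie_derived_def
    by (intro lin_span_submodule module_axioms) (auto simp: carrier_eq f_bracket[symmetric])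
  note closed = submoduleE[OF this] subgroup.one_closed[OF submodule.axioms(1)[OF this]]
  show "f ` flie_derived \<subseteq> lie_derived L (carrier L)"
  proof (rule image_subsetI)
    fix x :: "('k, 'v) flie" assume "x \<in> flie_derived"
    then show "f x \<in> lie_derived L (carrier L)"
    proof induction
      case (bracket x y)
      have "f x \<otimes> f y \<in> {x \<otimes> y | x y. x \<in> carrier L \<and> y \<in> carrier L}"
        using f_in_carrier by blast
      then show ?case
        unfolding f_bracket lie_derived_def by (rule subsetD[OF subset_lin_span])
    qed (use closed in \<open>auto simp: f_zero f_add f_scale\<close>)
  qed
qed

lemma foldr_lie_sum:
  assumes "presentation L f K"
    and "\<And>p. p \<in> set ps \<Longrightarrow> (case p of (\<alpha>, \<beta>) \<Rightarrow> h \<alpha> \<otimes>\<^bsub>L\<^esub> h \<beta>) = f (g p)"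
  shows "foldr (\<lambda>(\<alpha>, \<beta>) u. (h \<alpha> \<otimes>\<^bsub>L\<^esub> h \<beta>) \<oplus>\<^bsub>L\<^esub> u) ps \<zero>\<^bsub>L\<^esub> = f (\<Sum>p\<leftarrow>ps. g p)"
proof -
  interpret presentation L f K by fact
  show ?thesis
    using assms(2)
  proof (induction ps)
    case (Cons p ps)
    then show ?case by (cases p) (auto simp: f_add)
  qed (simp add: f_zero)
qed

lemma quad_sum_list:
  "(\<Sum>p\<leftarrow>ps. quad I (M p)) = quad I (\<lambda>i j. \<Sum>p\<leftarrow>ps. M p i j)"
  by (induction ps) (simp_all add: quad_zero quad_add)

context degree_one_basis
begin

lemma bracket_of_functionals:
  assumes "\<beta> \<in> carrier V" "\<gamma> \<in> carrier V"
  shows "lie_class V (Gen \<beta>) \<otimes>\<^bsub>L\<^esub> lie_class V (Gen \<gamma>) =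
    f (quad I (\<lambda>i j. \<beta> (w i) * \<gamma> (w j) - \<beta> (w j) * \<gamma> (w i)))"
  using f_coordinates[OF assms(1)] f_coordinates[OF assms(2)]
  by (simp add: bracket_of_combinations[OF finite_I, symmetric] f_simps)

lemma nabla_of_pairs:
  assumes "set ps \<subseteq> carrier V \<times> carrier V"
  shows "foldr (\<lambda>(\<beta>, \<gamma>) u. (lie_class V (Gen \<beta>) \<otimes>\<^bsub>L\<^esub> lie_class V (Gen \<gamma>)) \<oplus>\<^bsub>L\<^esub> u) ps \<zero>\<^bsub>L\<^esub> =
    f (quad I (\<lambda>i j. \<Sum>(\<beta>, \<gamma>)\<leftarrow>ps. \<beta> (w i) * \<gamma> (w j) - \<beta> (w j) * \<gamma> (w i)))"
proof -
  have "foldr (\<lambda>(\<beta>, \<gamma>) u. (lie_class V (Gen \<beta>) \<otimes>\<^bsub>L\<^esub> lie_class V (Gen \<gamma>)) \<oplus>\<^bsub>L\<^esub> u) ps \<zero>\<^bsub>L\<^esub> =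
      f (\<Sum>p\<leftarrow>ps. quad I (\<lambda>i j. case p of (\<beta>, \<gamma>) \<Rightarrow> \<beta> (w i) * \<gamma> (w j) - \<beta> (w j) * \<gamma> (w i)))"
    using assms by (intro foldr_lie_sum[OF free_presentation]) (auto simp: bracket_of_functionals)
  then show ?thesis
    by (simp only: quad_sum_list)
qed

text \<open>
  One inclusion reads off the coordinates of a given representation of \<open>\<nabla>(\<phi>)\<close>; for the other
  one, \<open>\<Sum>\<^sub>i\<^sub><\<^sub>j \<phi>(w\<^sub>i w\<^sub>j) [\<alpha>\<^sub>i, \<alpha>\<^sub>j]\<close> represents \<open>\<nabla>(\<phi>)\<close>.
\<close>

lemma nabla_image_eq: "nabla_image C gr = f ` quad I ` Q"
proof (intro equalityI subsetI)
  fix u assume "u \<in> nabla_image C gr"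
  then obtain \<phi> ps where \<phi>: "\<phi> \<in> carrier (dual_space C (gr 2))"
    and ps: "set ps \<subseteq> carrier V \<times> carrier V"
    and u: "u = foldr (\<lambda>(\<beta>, \<gamma>) u. (lie_class V (Gen \<beta>) \<otimes>\<^bsub>L\<^esub> lie_class V (Gen \<gamma>)) \<oplus>\<^bsub>L\<^esub> u) ps \<zero>\<^bsub>L\<^esub>"
    and form: "\<forall>x\<in>gr 1. \<forall>y\<in>gr 1. (\<Sum>(\<beta>, \<gamma>)\<leftarrow>ps. \<beta> x * \<gamma> y - \<beta> y * \<gamma> x) = \<phi> (x \<otimes> y)"
    by (auto simp: nabla_image_def is_nabla_def Let_def)
  have "u = f (quad I (\<lambda>i j. \<phi> (w i \<otimes> w j)))"
    unfolding u nabla_of_pairs[OF ps] using form w_in by simp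
  then show "u \<in> f ` quad I ` Q"
    using \<phi> by (auto simp: Q_def)
next
  fix u assume "u \<in> f ` quad I ` Q"
  then obtain \<phi> where \<phi>: "\<phi> \<in> carrier (dual_space C (gr 2))"
    and u: "u = f (quad I (\<lambda>i j. \<phi> (w i \<otimes> w j)))"
    by (auto simp: Q_def)
  define P where "P = (SIGMA i:I. {j\<in>I. i < j})"
  have "finite P"
    using finite_I by (auto simp: P_def)
  then obtain xs where xs: "set xs = P" "distinct xs"
    using finite_distinct_list by blast
  define ps where "ps = map (\<lambda>(i, j). (\<phi> (w i \<otimes> w j) \<odot>\<^bsub>V\<^esub> \<alpha> i, \<alpha> j)) xs"
  have ps: "set ps \<subseteq> carrier V \<times> carrier V"
    using xs V_smult \<alpha>_in by (auto simp: ps_def P_def)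
  have form: "(\<Sum>(\<beta>, \<gamma>)\<leftarrow>ps. \<beta> x * \<gamma> y - \<beta> y * \<gamma> x) = \<phi> (x \<otimes> y)" if "x \<in> gr 1" "y \<in> gr 1" for x y
  proof -
    have "(\<Sum>(\<beta>, \<gamma>)\<leftarrow>ps. \<beta> x * \<gamma> y - \<beta> y * \<gamma> x) =
        (\<Sum>(i, j)\<leftarrow>xs. \<phi> (w i \<otimes> w j) * (\<alpha> i x * \<alpha> j y - \<alpha> i y * \<alpha> j x))"
      unfolding ps_def map_map
      by (intro arg_cong[where f = sum_list] map_cong HOL.refl)
        (use that in \<open>auto simp: dual_space_simps algebra_simps\<close>)
    also have "\<dots> = (\<Sum>(i, j)\<in>P. \<phi> (w i \<otimes> w j) * (\<alpha> i x * \<alpha> j y - \<alpha> i y * \<alpha> j x))"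
      using xs by (simp add: sum_list_distinct_conv_sum_set)
    also have "\<dots> = (\<Sum>i\<in>I. \<Sum>j\<in>{j\<in>I. i < j}. \<phi> (w i \<otimes> w j) * (\<alpha> i x * \<alpha> j y - \<alpha> i y * \<alpha> j x))"
      unfolding P_def using finite_I by (subst sum.Sigma) auto
    also have "\<dots> = (\<Sum>i\<in>I. \<Sum>j\<in>{j\<in>I. i < j}. \<alpha> i x * \<alpha> j y * \<phi> (w i \<otimes> w j) + \<alpha> j x * \<alpha> i y * \<phi> (w j \<otimes> w i))"
    proof (intro sum.cong HOL.refl)
      fix i j
      show "\<phi> (w i \<otimes> w j) * (\<alpha> i x * \<alpha> j y - \<alpha> i y * \<alpha> j x) =
          \<alpha> i x * \<alpha> j y * \<phi> (w i \<otimes> w j) + \<alpha> j x * \<alpha> i y * \<phi> (w j \<otimes> w i)"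
        unfolding form_antisym[OF \<phi>, of j i] by (simp add: algebra_simps)
    qed
    also have "\<dots> = (\<Sum>i\<in>I. \<Sum>j\<in>I. \<alpha> i x * \<alpha> j y * \<phi> (w i \<otimes> w j))"
      by (simp add: sum_square_split[OF finite_I] form_diagonal[OF \<phi>])
    also have "\<dots> = \<phi> (x \<otimes> y)"
      by (rule form_expand[OF \<phi> that, symmetric])
    finally show ?thesis .
  qed
  have "u = foldr (\<lambda>(\<beta>, \<gamma>) u. (lie_class V (Gen \<beta>) \<otimes>\<^bsub>L\<^esub> lie_class V (Gen \<gamma>)) \<oplus>\<^bsub>L\<^esub> u) ps \<zero>\<^bsub>L\<^esub>"
    unfolding u nabla_of_pairs[OF ps] by (simp add: form w_in)
  then have "is_nabla C gr \<phi> u"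
    using ps form by (auto simp: is_nabla_def Let_def)
  then show "u \<in> nabla_image C gr"
    using \<phi> by (auto simp: nabla_image_def)
qed

text \<open>
  The generators outside \<open>I\<close> are relations, so modulo the relations \<open>e\<close> is the identity.
\<close>

lemma e_congruence: "x - e x \<in> metabelian_ideal (quadratic_relations I R)"
proof (induction x rule: flie_induct)
  case (gen i)
  then show ?case
    by (auto intro: metabelian_ideal.intros)
next
  case (add x y)
  then show ?case
    using metabelian_ideal.add by (fastforce simp: algebra_simps)
next
  case (scale c x)
  then show ?case
    using metabelian_ideal.scale[of "x - e x" _ c] by (simp add: F.scl_diff_right)
next
  case (bracket x y)
  have "\<langle>x, y\<rangle> - e \<langle>x, y\<rangle> = \<langle>x - e x, y\<rangle> + \<langle>e x, y - e y\<rangle>"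
    by (simp add: F.br_diff_left F.br_diff_right)
  then show ?case
    using bracket.IH by (simp only: metabelian_ideal_intros)
qed (simp add: metabelian_ideal.zero)

abbreviation "J \<equiv> holonomy_relations C gr"
abbreviation "h \<equiv> holonomy C gr"
abbreviation "J2 \<equiv> holonomy_second_derived C gr"

definition f1 where "f1 x = J +>\<^bsub>L\<^esub> f x"
definition f2 where "f2 x = J2 +>\<^bsub>h\<^esub> f1 x"

sublocale P: presentation L f "{x. e x = 0}"
  by (rule free_presentation)

lemma J_alt: "J = \<Inter> {J. submodule J scalar_field L \<and> (\<forall>x \<in> carrier L. \<forall>y \<in> J. x \<otimes>\<^bsub>L\<^esub> y \<in> J) \<and> f ` quad I ` Q \<subseteq> J}"
  by (simp add: holonomy_relations_def lie_ideal_generated_def nabla_image_eq)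

lemma image_K_ideal:
  "submodule (f ` K) scalar_field L" "\<And>x y. x \<in> carrier L \<Longrightarrow> y \<in> f ` K \<Longrightarrow> x \<otimes>\<^bsub>L\<^esub> y \<in> f ` K"
  "f ` quad I ` Q \<subseteq> f ` K"
proof -
  show "submodule (f ` K) scalar_field L"
    by (rule P.image_submodule) (simp_all add: metabelian_ideal_intros)
  show "x \<otimes>\<^bsub>L\<^esub> y \<in> f ` K" if "x \<in> carrier L" "y \<in> f ` K" for x y
    using that unfolding P.carrier_eq by (auto simp: P.f_bracket[symmetric] metabelian_ideal_intros)
  show "f ` quad I ` Q \<subseteq> f ` K"
    by (auto intro: metabelian_ideal.base)
qed

lemma J_ideal: "submodule J scalar_field L" "\<And>x y. x \<in> carrier L \<Longrightarrow> y \<in> J \<Longrightarrow> x \<otimes>\<^bsub>L\<^esub> y \<in> J"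
  unfolding J_alt using image_K_ideal by (blast intro!: P.submodule_Inter)+

lemma J_subset: "J \<subseteq> f ` K"
  unfolding J_alt using image_K_ideal by (intro Inter_lower) blast

lemma quad_in_J: "M \<in> Q \<Longrightarrow> f (quad I M) \<in> J"
  unfolding J_alt by blast

lemma presentation_f1: "presentation h f1 (f -` J)"
  unfolding holonomy_def f1_def using P.quotient[OF J_ideal] .

sublocale P1: presentation h f1 "f -` J"
  by (rule presentation_f1)

lemma second_derived_eq:
  "J2 = lin_span h {u \<otimes>\<^bsub>h\<^esub> v | u v. u \<in> f1 ` flie_derived \<and> v \<in> f1 ` flie_derived}"
  unfolding holonomy_second_derived_def Let_def P1.lie_derived_eq by (rule lie_derived_def)

lemma second_derived_subset: "J2 \<subseteq> f1 ` K"
  unfolding second_derived_eq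
  by (intro lin_span_subset P1.image_submodule)
    (auto simp: P1.f_bracket[symmetric] bracket_derived_in_metabelian_ideal metabelian_ideal_intros)

lemma second_derived_submodule: "submodule J2 scalar_field h"
  unfolding second_derived_eq
  by (intro lin_span_submodule P1.module_axioms)
    (auto simp: P1.f_bracket[symmetric] P1.f_in_carrier)

lemma bracket_in_second_derived:
  assumes "x \<in> flie_derived" "y \<in> flie_derived"
  shows "f1 \<langle>x, y\<rangle> \<in> J2"
proof -
  have "f1 \<langle>x, y\<rangle> \<in> {u \<otimes>\<^bsub>h\<^esub> v | u v. u \<in> f1 ` flie_derived \<and> v \<in> f1 ` flie_derived}"
    unfolding P1.f_bracket using assms by blast
  then show ?thesis
    unfolding second_derived_eq by (rule subsetD[OF subset_lin_span])
qed

sublocale Q2: module_subspace h J2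
  by (rule module_subspace.intro[OF P1.module_axioms module_subspace_axioms.intro[OF second_derived_submodule]])

text \<open>
  By the Leibniz rule, \<open>[x, [y, z]] = [[x, y], z] + [y, [x, z]]\<close>, and the derived algebra is an
  ideal.
\<close>

lemma second_derived_ideal:
  assumes "u \<in> carrier h" "v \<in> J2"
  shows "u \<otimes>\<^bsub>h\<^esub> v \<in> J2"
proof -
  let ?Z = "{z. \<forall>x. f1 \<langle>x, z\<rangle> \<in> J2}"
  have "\<langle>x, y\<rangle> \<in> ?Z" if "x \<in> flie_derived" "y \<in> flie_derived" for x y
    using that by (auto simp: F.br_leibniz[of _ x y] P1.f_add
        intro!: Q2.J_closed(3) bracket_in_second_derived flie_derived.bracket)
  then have "{u \<otimes>\<^bsub>h\<^esub> v | u v. u \<in> f1 ` flie_derived \<and> v \<in> f1 ` flie_derived} \<subseteq> f1 ` ?Z"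
    by (force simp: P1.f_bracket[symmetric])
  then have "J2 \<subseteq> f1 ` ?Z"
    by (subst second_derived_eq, intro lin_span_subset P1.image_submodule)
      (simp_all add: F.br_zero_right F.br_add_right F.br_scl_right P1.f_zero P1.f_add P1.f_scale
        Q2.J_closed)
  then obtain z where "v = f1 z" "\<forall>x. f1 \<langle>x, z\<rangle> \<in> J2"
    using assms(2) by blast
  then show ?thesis
    using assms(1) unfolding P1.carrier_eq by (auto simp: P1.f_bracket[symmetric])
qed

lemma f1_K_reflects: "f1 x \<in> f1 ` K \<Longrightarrow> x \<in> K"
proof -
  assume "f1 x \<in> f1 ` K"
  then obtain y where y: "y \<in> K" "x - y \<in> f -` J"
    using P1.f_eq_iff by auto
  then obtain z where z: "z \<in> K" "f (x - y) = f z"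
    using J_subset by auto
  have "(x - y - z) - e (x - y - z) \<in> K"
    by (rule e_congruence)
  moreover have "e (x - y - z) = 0"
    using z(2) unfolding P.f_eq_iff by simp
  ultimately have "x - y - z \<in> K" by simp
  then have "(x - y - z) + (y + z) \<in> K"
    by (intro metabelian_ideal.add y(1) z(1))
  then show "x \<in> K" by (simp add: algebra_simps)
qed

text \<open>
  The kernel of the projection from the free Lie algebra to the metabelian holonomy Lie algebra.
\<close>

lemma K_eq: "f1 -` J2 = K"
proof
  show "f1 -` J2 \<subseteq> K"
    by (intro subsetI f1_K_reflects subsetD[OF second_derived_subset]) (rule vimageD)
  show "K \<subseteq> f1 -` J2"
  proof
    fix x assume "x \<in> K"
    then show "x \<in> f1 -` J2"
    proof induction
      case (base x)
      then have "f x \<in> J"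
      proof
        assume "x \<in> fgen ` (- I)"
        then have "f x = \<zero>\<^bsub>L\<^esub>"
          using P.in_K_iff[of x] by auto
        then show ?thesis
          using subgroup.one_closed[OF submodule.axioms(1)[OF J_ideal(1)]] by simp
      next
        assume "x \<in> quad I ` Q"
        then show ?thesis
          using quad_in_J by blast
      qed
      then show ?case
        using P1.in_K_iff[of x] Q2.J_closed(1) by simp
    next
      case (bracket y x)
      then show ?case
        using second_derived_ideal P1.f_in_carrier by (simp add: P1.f_bracket)
    qed (simp_all add: Q2.J_closed bracket_in_second_derived flie_derived.bracket
        P1.f_add P1.f_scale P1.f_zero del: P1.f_bracket)
  qed
qed

lemma presentation_f2: "presentation (metabelian_holonomy C gr) f2 K"
  using P1.quotient[OF second_derived_submodule second_derived_ideal]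
  unfolding metabelian_holonomy_def f2_def K_eq .

lemma f2_homog: "carrier (metabelian_holonomy_deg C gr s) = f2 ` homog s"
  by (simp add: metabelian_holonomy_deg_def quot_grading_def holonomy_grading_def f_homog[symmetric]
      image_image f1_def f2_def)

end

section \<open>Linear functionals\<close>

definition linear_functional :: "('k::field, 'a) module \<Rightarrow> 'a set \<Rightarrow> ('a \<Rightarrow> 'k) \<Rightarrow> bool" where
  "linear_functional M W \<phi> \<longleftrightarrow>
    (\<forall>x\<in>W. \<forall>y\<in>W. \<phi> (x \<oplus>\<^bsub>M\<^esub> y) = \<phi> x + \<phi> y) \<and> (\<forall>c. \<forall>x\<in>W. \<phi> (c \<odot>\<^bsub>M\<^esub> x) = c * \<phi> x)"

lemma dual_space_iff:
  "\<phi> \<in> carrier (dual_space M W) \<longleftrightarrow> \<phi> \<in> extensional W \<and> linear_functional M W \<phi>"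
  by (auto simp: dual_space_def linear_functional_def)

lemma linear_functional_sum:
  "(\<And>i. i \<in> A \<Longrightarrow> linear_functional M W (\<phi> i)) \<Longrightarrow> linear_functional M W (\<lambda>x. \<Sum>i\<in>A. c i * \<phi> i x)"
  by (simp add: linear_functional_def sum.distrib algebra_simps sum_distrib_left)

lemma linear_functional_diff:
  "linear_functional M W \<phi> \<Longrightarrow> linear_functional M W \<psi> \<Longrightarrow> linear_functional M W (\<lambda>x. \<phi> x - \<psi> x)"
  by (simp add: linear_functional_def algebra_simps)

lemma linear_functional_scale:
  "linear_functional M W \<phi> \<Longrightarrow> linear_functional M W (\<lambda>x. c * \<phi> x)"
  by (simp add: linear_functional_def algebra_simps)

context module_subspace
begin

text \<open>
  A functional on a subspace of \<open>J\<close>, seen as its graph, so that extension becomes inclusion.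
\<close>

definition functional_graph :: "('c \<times> 'k) set \<Rightarrow> bool" where
  "functional_graph G \<longleftrightarrow> G \<subseteq> J \<times> UNIV \<and> (\<zero>, 0) \<in> G \<and>
    (\<forall>x c y d. (x, c) \<in> G \<longrightarrow> (y, d) \<in> G \<longrightarrow> (x \<oplus> y, c + d) \<in> G) \<and>
    (\<forall>x c d. (x, c) \<in> G \<longrightarrow> (d \<odot> x, d * c) \<in> G) \<and> (\<forall>c. (\<zero>, c) \<in> G \<longrightarrow> c = 0)"

lemma functional_graph_single_valued:
  assumes G: "functional_graph G" and "(x, c) \<in> G" "(x, d) \<in> G"
  shows "c = d"
proof -
  have x: "x \<in> carrier M"
    using assms J_closed by (auto simp: functional_graph_def)
  have "(- 1 \<odot> x, - 1 * d) \<in> G"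
    using assms unfolding functional_graph_def by blast
  then have "(x \<oplus> (- 1) \<odot> x, c + - 1 * d) \<in> G"
    using assms unfolding functional_graph_def by blast
  moreover have "x \<oplus> (- 1) \<odot> x = \<zero>"
    using x by (simp add: neg_one_smult[OF module_axioms] r_neg)
  ultimately show "c = d"
    using G unfolding functional_graph_def by auto
qed

text \<open>
  One step of the Hahn-Banach argument: the new direction \<open>u\<close> gets the value 0.
\<close>

lemma functional_graph_extend:
  assumes G: "functional_graph G" and u: "u \<in> J" "u \<notin> Domain G"
  defines "G' \<equiv> {(x \<oplus> c \<odot> u, d) | x c d. (x, d) \<in> G}"
  shows "functional_graph G'" "G \<subseteq> G'" "u \<in> Domain G'"
proof -
  have G_J: "x \<in> J" if "(x, d) \<in> G" for x d
    using G that by (auto simp: functional_graph_def)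
  have carr: "x \<in> carrier M" if "(x, d) \<in> G" for x d
    using G_J[OF that] by (rule J_closed)
  have uc: "u \<in> carrier M"
    using u(1) by (rule J_closed)
  have G_zero: "(\<zero>, 0) \<in> G" and G_add: "\<And>x c y d. (x, c) \<in> G \<Longrightarrow> (y, d) \<in> G \<Longrightarrow> (x \<oplus> y, c + d) \<in> G"
    and G_scale: "\<And>x c d. (x, c) \<in> G \<Longrightarrow> (d \<odot> x, d * c) \<in> G" and G_inj: "\<And>c. (\<zero>, c) \<in> G \<Longrightarrow> c = 0"
    using G by (auto simp: functional_graph_def)
  have zero_u: "0 \<odot> u = \<zero>"
    using smult_l_null[OF uc] by simp
  show sub: "G \<subseteq> G'"
  proof
    fix z assume "z \<in> G"
    then obtain x d where z: "z = (x, d)" "(x, d) \<in> G" by (cases z) auto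
    then have "z = (x \<oplus> 0 \<odot> u, d)"
      using carr by (simp add: zero_u)
    then show "z \<in> G'"
      unfolding G'_def using z by blast
  qed
  have "u = \<zero> \<oplus> 1 \<odot> u"
    using uc smult_one[OF uc] by simp
  then have "(u, 0) \<in> G'"
    unfolding G'_def using G_zero by blast
  then show "u \<in> Domain G'" by blast
  have "G' \<subseteq> J \<times> UNIV"
    unfolding G'_def using G_J u(1) J_closed by auto
  moreover have "(\<zero>, 0) \<in> G'"
    using sub G_zero by blast
  moreover have "(x \<oplus> y, c + d) \<in> G'" if xy: "(x, c) \<in> G'" "(y, d) \<in> G'" for x c y d
  proof -
    obtain x' c' y' d' where *: "x = x' \<oplus> c' \<odot> u" "(x', c) \<in> G" "y = y' \<oplus> d' \<odot> u" "(y', d) \<in> G"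
      using xy by (auto simp: G'_def)
    have "x \<oplus> y = (x' \<oplus> y') \<oplus> (c' + d') \<odot> u"
      using carr[OF *(2)] carr[OF *(4)] uc smult_l_distr[of c' d' u] smult_closed[of _ u]
      by (simp add: *(1,3) a_ac)
    then show ?thesis
      unfolding G'_def using G_add[OF *(2,4)] by blast
  qed
  moreover have "(d \<odot> x, d * c) \<in> G'" if xc: "(x, c) \<in> G'" for x c d
  proof -
    obtain x' c' where *: "x = x' \<oplus> c' \<odot> u" "(x', c) \<in> G"
      using xc by (auto simp: G'_def)
    have "d \<odot> x = (d \<odot> x') \<oplus> (d * c') \<odot> u"
      using carr[OF *(2)] uc smult_r_distr[of d x' "c' \<odot> u"] smult_closed[of _ u] smult_assoc1[of d c' u]
      by (simp add: *(1))
    then show ?thesis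
      unfolding G'_def using G_scale[OF *(2)] by blast
  qed
  moreover have "d = 0" if zd: "(\<zero>, d) \<in> G'" for d
  proof -
    obtain x c where *: "\<zero> = x \<oplus> c \<odot> u" "(x, d) \<in> G"
      using zd by (auto simp: G'_def)
    have xc: "x \<in> carrier M" "c \<odot> u \<in> carrier M"
      using carr[OF *(2)] uc smult_closed[of c u] by auto
    show "d = 0"
    proof (cases "c = 0")
      case True
      then show ?thesis
        using * xc G_inj by (simp add: zero_u)
    next
      case False
      have "c \<odot> u = \<ominus> x"
        using *(1) xc minus_equality[of "c \<odot> u" x] by (simp add: a_comm)
      also have "\<dots> = (- 1) \<odot> x"
        by (rule neg_one_smult[OF module_axioms xc(1), symmetric])
      finally have "inverse c \<odot> (c \<odot> u) = inverse c \<odot> ((- 1) \<odot> x)"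
        by simp
      moreover have "inverse c \<odot> (c \<odot> u) = u"
        using smult_assoc1[of "inverse c" c u] uc False smult_one[OF uc] by simp
      ultimately have "(u, inverse c * (- 1 * d)) \<in> G"
        using G_scale[OF G_scale[OF *(2)]] by metis
      then show ?thesis
        using u(2) by blast
    qed
  qed
  ultimately show "functional_graph G'"
    unfolding functional_graph_def by blast
qed

text \<open>
  A functional that vanishes on the kernel of a linear map factors through the map: it does so on
  the image, and from there it extends to all of \<open>J\<close> by Zorn's lemma.
\<close>

lemma functional_factor:
  assumes X: "submodule X scalar_field M"
    and g: "\<And>x. x \<in> X \<Longrightarrow> g x \<in> J" "\<And>x y. x \<in> X \<Longrightarrow> y \<in> X \<Longrightarrow> g (x \<oplus> y) = g x \<oplus> g y"
      "\<And>c x. x \<in> X \<Longrightarrow> g (c \<odot> x) = c \<odot> g x"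
    and \<phi>: "linear_functional M X \<phi>" and ker: "\<And>x. x \<in> X \<Longrightarrow> g x = \<zero> \<Longrightarrow> \<phi> x = 0"
  obtains \<psi> where "linear_functional M J \<psi>" "\<And>x. x \<in> X \<Longrightarrow> \<psi> (g x) = \<phi> x"
proof -
  note XE = submoduleE[OF X] subgroup.one_closed[OF submodule.axioms(1)[OF X]]
  define G0 where "G0 = (\<lambda>x. (g x, \<phi> x)) ` X"
  have zX: "\<zero> \<in> X" using XE by simp
  have g0: "g \<zero> = \<zero>" and \<phi>0: "\<phi> \<zero> = 0"
  proof -
    have "0 \<odot> \<zero> = \<zero>"
      using smult_l_null[OF zero_closed] by simp
    then show "g \<zero> = \<zero>" "\<phi> \<zero> = 0"
      using g(3)[OF zX, of 0] \<phi> zX J_closed(2)[OF g(1)[OF zX]] smult_l_null[of "g \<zero>"]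
      unfolding linear_functional_def by (auto, metis mult_zero_left)
  qed
  have G0: "functional_graph G0"
    unfolding functional_graph_def
  proof (intro conjI allI impI)
    show "G0 \<subseteq> J \<times> UNIV" using g(1) by (auto simp: G0_def)
    show "(\<zero>, 0) \<in> G0" using zX g0 \<phi>0 by (force simp: G0_def)
    show "(x \<oplus> y, c + d) \<in> G0" if xy: "(x, c) \<in> G0" "(y, d) \<in> G0" for x y c d
    proof -
      obtain x' y' where *: "x' \<in> X" "y' \<in> X" "x = g x'" "y = g y'" "c = \<phi> x'" "d = \<phi> y'"
        using xy by (auto simp: G0_def)
      then have "(x \<oplus> y, c + d) = (g (x' \<oplus> y'), \<phi> (x' \<oplus> y'))"
        using g \<phi> by (simp add: linear_functional_def)
      then show ?thesis
        using * XE by (auto simp: G0_def)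
    qed
    show "(d \<odot> x, d * c) \<in> G0" if xc: "(x, c) \<in> G0" for x c d
    proof -
      obtain x' where *: "x' \<in> X" "x = g x'" "c = \<phi> x'"
        using xc by (auto simp: G0_def)
      then have "(d \<odot> x, d * c) = (g (d \<odot> x'), \<phi> (d \<odot> x'))"
        using g \<phi> by (simp add: linear_functional_def)
      then show ?thesis
        using * XE by (auto simp: G0_def)
    qed
    show "c = 0" if "(\<zero>, c) \<in> G0" for c
      using that ker by (auto simp: G0_def)
  qed
  define \<A> where "\<A> = {G. functional_graph G \<and> G0 \<subseteq> G}"
  have "\<exists>G\<in>\<A>. \<forall>H\<in>\<A>. G \<subseteq> H \<longrightarrow> H = G"
  proof (rule subset_Zorn_nonempty)
    show "\<A> \<noteq> {}" using G0 by (auto simp: \<A>_def)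
    fix \<C> assume ne: "\<C> \<noteq> {}" and chain: "subset.chain \<A> \<C>"
    have mem: "\<And>G. G \<in> \<C> \<Longrightarrow> functional_graph G \<and> G0 \<subseteq> G"
      using chain by (auto simp: subset.chain_def \<A>_def)
    have lin: "\<And>G H. G \<in> \<C> \<Longrightarrow> H \<in> \<C> \<Longrightarrow> G \<subseteq> H \<or> H \<subseteq> G"
      using chain by (auto simp: subset.chain_def)
    have "functional_graph (\<Union>\<C>)"
      unfolding functional_graph_def
    proof (intro conjI allI impI)
      show "\<Union>\<C> \<subseteq> J \<times> UNIV" using mem unfolding functional_graph_def by blast
      show "(\<zero>, 0) \<in> \<Union>\<C>" using mem ne unfolding functional_graph_def by blast
      show "(d \<odot> x, d * c) \<in> \<Union>\<C>" if "(x, c) \<in> \<Union>\<C>" for x c d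
        using mem that unfolding functional_graph_def by blast
      show "c = 0" if "(\<zero>, c) \<in> \<Union>\<C>" for c
        using mem that unfolding functional_graph_def by blast
      show "(x \<oplus> y, c + d) \<in> \<Union>\<C>" if xy: "(x, c) \<in> \<Union>\<C>" "(y, d) \<in> \<Union>\<C>" for x y c d
      proof -
        obtain G H where GH: "G \<in> \<C>" "H \<in> \<C>" "(x, c) \<in> G" "(y, d) \<in> H"
          using xy by blast
        then obtain F where "F \<in> \<C>" "(x, c) \<in> F" "(y, d) \<in> F"
          using lin by blast
        then show ?thesis
          using mem unfolding functional_graph_def by blast
      qed
    qed
    moreover have "G0 \<subseteq> \<Union>\<C>" using mem ne by blast
    ultimately show "\<Union>\<C> \<in> \<A>" by (simp add: \<A>_def)
  qed
  then obtain G where G: "functional_graph G" "G0 \<subseteq> G"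
    and max: "\<And>H. functional_graph H \<Longrightarrow> G \<subseteq> H \<Longrightarrow> H = G"
    by (auto simp: \<A>_def)
  have dom: "\<exists>c. (y, c) \<in> G" if "y \<in> J" for y
    using functional_graph_extend[OF G(1) that] max by blast
  define \<psi> where "\<psi> y = (SOME c. (y, c) \<in> G)" for y
  have \<psi>_G: "(y, \<psi> y) \<in> G" if "y \<in> J" for y
    unfolding \<psi>_def using dom[OF that] by (rule someI_ex)
  have \<psi>_eq: "\<psi> y = c" if "(y, c) \<in> G" for y c
    unfolding \<psi>_def using that functional_graph_single_valued[OF G(1)] by blast
  have "linear_functional M J \<psi>"
    unfolding linear_functional_def
    using G(1) \<psi>_G by (auto intro!: \<psi>_eq simp: functional_graph_def)
  moreover have "\<psi> (g x) = \<phi> x" if "x \<in> X" for x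
    using that G(2) by (intro \<psi>_eq) (auto simp: G0_def)
  ultimately show ?thesis
    by (rule that)
qed

text \<open>
  The vectors \<open>w\<^sub>0, \<dots>, w\<^sub>n\<close> and the functionals \<open>\<alpha>\<^sub>0, \<dots>, \<alpha>\<^sub>n\<close> are dual to each other, and
  \<open>S\<close> lies in the span of the vectors.  The span is expressed by the expansion of all functionals, which only takes sums in the
  ground field.  Beyond \<open>n\<close>, only membership in \<open>J\<close> is required of \<open>w\<close>.
\<close>

definition dual_basis_on :: "'c set \<Rightarrow> nat \<Rightarrow> (nat \<Rightarrow> 'c) \<Rightarrow> (nat \<Rightarrow> 'c \<Rightarrow> 'k) \<Rightarrow> bool" where
  "dual_basis_on S n w \<alpha> \<longleftrightarrow> (\<forall>i. w i \<in> J) \<and> (\<forall>i\<le>n. linear_functional M J (\<alpha> i)) \<and>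
    (\<forall>i\<le>n. \<forall>j\<le>n. \<alpha> i (w j) = (if i = j then 1 else 0)) \<and>
    (\<forall>\<phi>. linear_functional M J \<phi> \<longrightarrow> (\<forall>x\<in>S. \<phi> x = (\<Sum>i\<le>n. \<phi> (w i) * \<alpha> i x)))"

text \<open>
  A finite spanning set is processed one vector at a time.  If a vector \<open>s\<close> is not yet expanded, some
  functional \<open>\<phi>\<^sub>0\<close> shows it; after subtraction of its expansion and normalization it becomes a
  functional \<open>\<beta>\<close> that vanishes on the old basis vectors and is 1 on \<open>s\<close>.  It is the dual of the new
  basis vector \<open>s\<close>, and a multiple of it corrects each old functional.
\<close>

lemma dual_basis_exists:
  assumes fin: "finite_dim M J" and a: "a \<in> J" and \<alpha>0: "linear_functional M J \<alpha>0" "\<alpha>0 a = 1"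
  shows "\<exists>n w \<alpha>. w 0 = a \<and> dual_basis_on J n w \<alpha>"
proof -
  define good where "good = (\<lambda>(n :: nat) w \<alpha> S. w 0 = a \<and> dual_basis_on S n w \<alpha>)"
  obtain S where S: "finite S" "S \<subseteq> J" "lin_span M S = J"
    using fin by (auto simp: finite_dim_def)
  have "\<exists>n w \<alpha>. good n w \<alpha> S"
    using S(1,2)
  proof (induction S rule: finite_induct)
    case empty
    have "good 0 (\<lambda>_. a) (\<lambda>_. \<alpha>0) {}"
      using a \<alpha>0 by (simp add: good_def dual_basis_on_def)
    then show ?case by blast
  next
    case (insert s S)
    then obtain n w \<alpha> where "good n w \<alpha> S" by blast
    then have w0: "w 0 = a" and wY: "\<And>i. w i \<in> J" and \<alpha>: "\<And>i. i \<le> n \<Longrightarrow> linear_functional M J (\<alpha> i)"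
      and \<delta>: "\<And>i j. i \<le> n \<Longrightarrow> j \<le> n \<Longrightarrow> \<alpha> i (w j) = (if i = j then 1 else 0)"
      and ex: "\<And>\<phi> x. linear_functional M J \<phi> \<Longrightarrow> x \<in> S \<Longrightarrow> \<phi> x = (\<Sum>i\<le>n. \<phi> (w i) * \<alpha> i x)"
      by (auto simp: good_def dual_basis_on_def)
    have s: "s \<in> J" using insert.prems by simp
    show ?case
    proof (cases "\<forall>\<phi>. linear_functional M J \<phi> \<longrightarrow> \<phi> s = (\<Sum>i\<le>n. \<phi> (w i) * \<alpha> i s)")
      case True
      then have "good n w \<alpha> (insert s S)"
        using w0 wY \<alpha> \<delta> ex by (simp add: good_def dual_basis_on_def)
      then show ?thesis by blast
    next
      case False
      then obtain \<phi>0 where \<phi>0: "linear_functional M J \<phi>0"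
        and "\<phi>0 s \<noteq> (\<Sum>i\<le>n. \<phi>0 (w i) * \<alpha> i s)" by blast
      define d where "d = \<phi>0 s - (\<Sum>i\<le>n. \<phi>0 (w i) * \<alpha> i s)"
      have d: "d \<noteq> 0"
        using \<open>\<phi>0 s \<noteq> _\<close> by (simp add: d_def)
      define \<beta> where "\<beta> x = inverse d * (\<phi>0 x - (\<Sum>i\<le>n. \<phi>0 (w i) * \<alpha> i x))" for x
      have \<beta>: "linear_functional M J \<beta>"
        unfolding \<beta>_def using \<phi>0 \<alpha>
        by (intro linear_functional_scale linear_functional_diff linear_functional_sum) auto
      have \<beta>_w: "\<beta> (w j) = 0" if "j \<le> n" for j
      proof -
        have "(\<Sum>i\<le>n. \<phi>0 (w i) * \<alpha> i (w j)) = (\<Sum>i\<le>n. if i = j then \<phi>0 (w i) else 0)"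
          using that by (intro sum.cong HOL.refl) (auto simp: \<delta>)
        then show ?thesis
          using that by (simp add: \<beta>_def)
      qed
      have \<beta>_s: "\<beta> s = 1"
        using d by (simp add: \<beta>_def d_def[symmetric])
      have \<beta>_S: "\<beta> x = 0" if "x \<in> S" for x
        using ex[OF \<phi>0 that] by (simp add: \<beta>_def)
      define w' where "w' = w(Suc n := s)"
      define \<alpha>' where "\<alpha>' i x = (if i = Suc n then \<beta> x else \<alpha> i x - \<alpha> i s * \<beta> x)" for i x
      have "linear_functional M J (\<alpha>' i)" if "i \<le> Suc n" for i
        using that \<alpha> \<beta>
        by (cases "i = Suc n")
          (auto simp: \<alpha>'_def[abs_def] intro!: linear_functional_diff linear_functional_scale)
      moreover have "\<alpha>' i (w' j) = (if i = j then 1 else 0)" if "i \<le> Suc n" "j \<le> Suc n" for i j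
        using that by (auto simp: \<alpha>'_def w'_def \<beta>_w \<beta>_s \<delta> le_Suc_eq)
      moreover have "\<phi> x = (\<Sum>i\<le>Suc n. \<phi> (w' i) * \<alpha>' i x)"
        if \<phi>: "linear_functional M J \<phi>" and x: "x \<in> insert s S" for \<phi> x
      proof -
        have "(\<Sum>i\<le>Suc n. \<phi> (w' i) * \<alpha>' i x) =
            (\<Sum>i\<le>n. \<phi> (w i) * (\<alpha> i x - \<alpha> i s * \<beta> x)) + \<phi> s * \<beta> x"
          by (simp add: w'_def \<alpha>'_def)
        also have "\<dots> = \<phi> x"
        proof (cases "x = s")
          case False
          then show ?thesis
            using ex[OF \<phi>, of x] x \<beta>_S by simp
        qed (simp add: \<beta>_s)
        finally show ?thesis by simp
      qed
      ultimately have "good (Suc n) w' \<alpha>' (insert s S)"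
        using w0 wY s by (simp add: good_def dual_basis_on_def w'_def)
      then show ?thesis by blast
    qed
  qed
  then obtain n w \<alpha> where "good n w \<alpha> S" by blast
  then have w0: "w 0 = a" and wY: "\<And>i. w i \<in> J" and \<alpha>: "\<And>i. i \<le> n \<Longrightarrow> linear_functional M J (\<alpha> i)"
    and \<delta>: "\<And>i j. i \<le> n \<Longrightarrow> j \<le> n \<Longrightarrow> \<alpha> i (w j) = (if i = j then 1 else 0)"
    and ex: "\<And>\<phi> x. linear_functional M J \<phi> \<Longrightarrow> x \<in> S \<Longrightarrow> \<phi> x = (\<Sum>i\<le>n. \<phi> (w i) * \<alpha> i x)"
    by (auto simp: good_def dual_basis_on_def)
  let ?E = "{x \<in> J. \<forall>\<phi>. linear_functional M J \<phi> \<longrightarrow> \<phi> x = (\<Sum>i\<le>n. \<phi> (w i) * \<alpha> i x)}"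
  have E_add: "x \<oplus> y \<in> ?E" if "x \<in> ?E" "y \<in> ?E" for x y
    using that \<alpha> J_closed
    by (auto simp: linear_functional_def algebra_simps sum.distrib)
  have E_smult: "c \<odot> x \<in> ?E" if "x \<in> ?E" for c x
  proof -
    have "\<phi> (c \<odot> x) = (\<Sum>i\<le>n. \<phi> (w i) * \<alpha> i (c \<odot> x))" if \<phi>: "linear_functional M J \<phi>" for \<phi>
    proof -
      have "(\<Sum>i\<le>n. \<phi> (w i) * \<alpha> i (c \<odot> x)) = (\<Sum>i\<le>n. c * (\<phi> (w i) * \<alpha> i x))"
        using \<alpha> \<open>x \<in> ?E\<close> by (intro sum.cong) (auto simp: linear_functional_def)
      also have "\<dots> = c * \<phi> x"
      proof -
        have "\<phi> x = (\<Sum>i\<le>n. \<phi> (w i) * \<alpha> i x)"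
          using \<phi> \<open>x \<in> ?E\<close> by blast
        then show ?thesis
          by (simp only: sum_distrib_left)
      qed
      finally show ?thesis
        using \<phi> \<open>x \<in> ?E\<close> by (auto simp: linear_functional_def)
    qed
    then show ?thesis
      using that J_closed by auto
  qed
  have "submodule ?E scalar_field M"
  proof (rule submoduleI)
    show "?E \<subseteq> carrier M" using J_closed by auto
    have null: "0 \<odot> \<zero> = \<zero>"
      using smult_l_null[OF zero_closed] by simp
    have lf0: "\<phi> \<zero> = 0" if "linear_functional M J \<phi>" for \<phi>
      using that null J_closed(1) unfolding linear_functional_def
      by (metis mult_zero_left)
    have sum0: "(\<Sum>i\<le>n. \<phi> (w i) * \<alpha> i \<zero>) = 0" for \<phi>
      by (intro sum.neutral ballI) (simp add: lf0[OF \<alpha>])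
    show "\<zero> \<in> ?E"
      by (intro CollectI conjI allI impI J_closed(1)) (rule HOL.trans[OF lf0 sum0[symmetric]])
    show "\<ominus> x \<in> ?E" if "x \<in> ?E" for x
    proof -
      have "x \<in> carrier M" using that J_closed by auto
      then have "\<ominus> x = (- 1) \<odot> x"
        by (rule neg_one_smult[OF module_axioms, symmetric])
      then show ?thesis using E_smult[OF that] by simp
    qed
  qed (use E_add E_smult in auto)
  then have "lin_span M S \<subseteq> ?E"
    using S ex by (intro lin_span_subset) auto
  then have "\<phi> x = (\<Sum>i\<le>n. \<phi> (w i) * \<alpha> i x)" if "linear_functional M J \<phi>" "x \<in> J" for \<phi> x
    using S that by blast
  then have "dual_basis_on J n w \<alpha>"
    using wY \<alpha> \<delta> by (simp add: dual_basis_on_def)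
  then show ?thesis
    using w0 by blast
qed

end

text \<open>
  The isomorphism is the inverse of the map that \<open>p\<close> induces, because \<open>p\<close> goes from the second
  algebra to the first.
\<close>

lemma lin_isomorphic_of_presentations:
  fixes f1 :: "('k::field, 'v) flie \<Rightarrow> 'a" and f2 :: "('k, 'u) flie \<Rightarrow> 'b"
  assumes "presentation M1 f1 K1" and "presentation M2 f2 K2"
    and X2: "\<And>x y. x \<in> X2 \<Longrightarrow> y \<in> X2 \<Longrightarrow> x + y \<in> X2" "\<And>c x. x \<in> X2 \<Longrightarrow> c \<cdot> x \<in> X2"
    and p: "\<And>x y. p (x + y) = p x + p y" "\<And>c x. p (c \<cdot> x) = c \<cdot> p x"
    and p_X: "\<And>x. x \<in> X2 \<Longrightarrow> p x \<in> X1"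
    and K: "\<And>x. x \<in> X2 \<Longrightarrow> p x \<in> K1 \<longleftrightarrow> x \<in> K2"
    and surj: "\<And>y. y \<in> X1 \<Longrightarrow> \<exists>x\<in>X2. y - p x \<in> K1"
  shows "lin_isomorphic (M1\<lparr>carrier := f1 ` X1\<rparr>) (M2\<lparr>carrier := f2 ` X2\<rparr>)"
proof -
  interpret P1: presentation M1 f1 K1 by fact
  interpret P2: presentation M2 f2 K2 by fact
  have p_diff: "p (x - y) = p x - p y" for x y
    using p(1)[of "x - y" y] by simp
  have X2_diff: "x - y \<in> X2" if "x \<in> X2" "y \<in> X2" for x y
    using X2(1)[OF that(1) X2(2)[OF that(2), of "- 1"]] by (simp add: F.scl_minus_left F.scl_one)
  have eq: "f1 (p x) = f1 (p y) \<longleftrightarrow> f2 x = f2 y" if "x \<in> X2" "y \<in> X2" for x y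
    unfolding P1.f_eq_iff P2.f_eq_iff p_diff[symmetric] by (rule K[OF X2_diff[OF that]])
  define g where "g z = f2 (SOME x. x \<in> X2 \<and> f1 (p x) = z)" for z
  have g: "g (f1 (p x)) = f2 x" if "x \<in> X2" for x
  proof -
    have "\<exists>y. y \<in> X2 \<and> f1 (p y) = f1 (p x)" using that by blast
    from someI_ex[OF this] show ?thesis
      unfolding g_def using eq that by blast
  qed
  have carrier1: "f1 ` X1 = (\<lambda>x. f1 (p x)) ` X2"
  proof (intro equalityI subsetI)
    fix z assume "z \<in> f1 ` X1"
    then obtain y where y: "y \<in> X1" "z = f1 y" by blast
    then obtain x where "x \<in> X2" "y - p x \<in> K1" using surj by blast
    then show "z \<in> (\<lambda>x. f1 (p x)) ` X2"
      using y P1.f_eq_iff by blast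
  qed (use p_X in blast)
  have "bij_betw g (f1 ` X1) (f2 ` X2)"
    unfolding bij_betw_def carrier1
  proof
    show "inj_on g ((\<lambda>x. f1 (p x)) ` X2)"
      by (rule inj_onI) (auto simp: g eq)
    show "g ` (\<lambda>x. f1 (p x)) ` X2 = f2 ` X2"
      by (simp add: image_image g cong: image_cong_simp)
  qed
  moreover have "g (x \<oplus>\<^bsub>M1\<^esub> y) = g x \<oplus>\<^bsub>M2\<^esub> g y" if xy: "x \<in> f1 ` X1" "y \<in> f1 ` X1" for x y
  proof -
    obtain x' y' where *: "x' \<in> X2" "y' \<in> X2" "x = f1 (p x')" "y = f1 (p y')"
      using xy unfolding carrier1 by blast
    then have "g (x \<oplus>\<^bsub>M1\<^esub> y) = g (f1 (p (x' + y')))"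
      by (simp add: P1.f_add p)
    then show ?thesis
      using * X2 by (simp add: g P2.f_add)
  qed
  moreover have "g (c \<odot>\<^bsub>M1\<^esub> x) = c \<odot>\<^bsub>M2\<^esub> g x" if x: "x \<in> f1 ` X1" for c x
  proof -
    obtain x' where *: "x' \<in> X2" "x = f1 (p x')"
      using x unfolding carrier1 by blast
    then have "g (c \<odot>\<^bsub>M1\<^esub> x) = g (f1 (p (c \<cdot> x')))"
      by (simp add: P1.f_scale p)
    then show ?thesis
      using * X2 by (simp add: g P2.f_scale)
  qed
  ultimately show ?thesis
    unfolding lin_isomorphic_def
    by (intro bexI[of _ g]) (auto simp: iso_def hom_def bij_betw_def)
qed

section \<open>Nonresonant elements\<close>

lemma restrict_in_dual_space:
  assumes "linear_functional M W \<phi>"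
    and "\<And>x y. x \<in> W \<Longrightarrow> y \<in> W \<Longrightarrow> x \<oplus>\<^bsub>M\<^esub> y \<in> W" "\<And>c x. x \<in> W \<Longrightarrow> c \<odot>\<^bsub>M\<^esub> x \<in> W"
  shows "restrict \<phi> W \<in> carrier (dual_space M W)"
  using assms by (simp add: dual_space_iff linear_functional_def)

context graded_algebra
begin

(* the degree 1 is not to be rewritten to Suc 0 *)
declare One_nat_def [simp del]

lemma gr_closed:
  "\<zero> \<in> gr i" "x \<in> gr i \<Longrightarrow> x \<in> carrier A" "x \<in> gr i \<Longrightarrow> y \<in> gr i \<Longrightarrow> x \<oplus> y \<in> gr i"
  "x \<in> gr i \<Longrightarrow> \<ominus> x \<in> gr i" "x \<in> gr i \<Longrightarrow> c \<odot> x \<in> gr i"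
  using submoduleE[OF gr_subspace] subgroup.one_closed[OF submodule.axioms(1)[OF gr_subspace]] by auto

lemma gr_module_subspace: "module_subspace A (gr i)"
  by (intro module_subspace.intro module_subspace_axioms.intro module_axioms gr_subspace)

text \<open>
  A coset of the trivial subquotient contains its representative, so the cocycle is a coboundary.
\<close>

lemma not_resonance_exact:
  assumes "z \<in> gr 1" "z \<notin> resonance A gr (Suc i)" "x \<in> gr (Suc i)" "x \<otimes> z = \<zero>"
  obtains y where "y \<in> gr i" "x = y \<otimes> z"
proof -
  let ?Z = "{x \<in> gr (Suc i). x \<otimes> z = \<zero>}" and ?I = "(\<lambda>y. y \<otimes> z) ` gr i"
  have zero_I: "\<zero> \<in> ?I"
    using gr_closed(1)[of i] gr_closed(2)[OF assms(1)] by (force simp: l_null)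
  have "a_rcosets\<^bsub>A\<lparr>carrier := ?Z\<rparr>\<^esub> ?I = {?I}"
    using assms(1,2) by (simp add: resonance_def cohomology_def quot_alg_simps)
  moreover have "?I +>\<^bsub>A\<lparr>carrier := ?Z\<rparr>\<^esub> x \<in> a_rcosets\<^bsub>A\<lparr>carrier := ?Z\<rparr>\<^esub> ?I"
    using assms(3,4) by (auto simp: A_RCOSETS_def')
  ultimately have "?I +>\<^bsub>A\<lparr>carrier := ?Z\<rparr>\<^esub> x = ?I"
    by blast
  moreover have "?I +>\<^bsub>A\<lparr>carrier := ?Z\<rparr>\<^esub> x = (\<Union>h\<in>?I. {h \<oplus> x})"
    unfolding a_r_coset_def' by simp
  moreover have "x \<in> (\<Union>h\<in>?I. {h \<oplus> x})"
    by (rule UN_I[OF zero_I]) (simp add: gr_closed(2)[OF assms(3)])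
  ultimately show ?thesis
    using that by blast
qed

text \<open>
  The summands \<open>a y\<^sub>i\<close> of \<open>a y\<close> lie in different degrees, so a homogeneous product is the product with
  one homogeneous component of \<open>y\<close>.
\<close>

lemma homogeneous_multiple:
  assumes a: "a \<in> gr 1" and y: "y \<in> carrier A" and m: "a \<otimes> y \<in> gr (Suc k)"
  obtains z where "z \<in> gr k" "a \<otimes> y = a \<otimes> z"
proof -
  obtain f where f: "\<And>i. f i \<in> gr i" "finite {i. f i \<noteq> \<zero>}" "(\<Oplus>i\<in>{i. f i \<noteq> \<zero>}. f i) = y"
    using gr_direct_sum[OF y] by blast
  have ac: "a \<in> carrier A" and fc: "\<And>i. f i \<in> carrier A"
    using a f(1) gr_closed(2) by blast+
  define F where "F j = (case j of 0 \<Rightarrow> \<zero> | Suc i \<Rightarrow> a \<otimes> f i)" for j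
  define X where "X j = (if j = Suc k then a \<otimes> y else \<zero>)" for j
  have F_gr: "F j \<in> gr j" for j
    using mult_gr[OF a f(1)] gr_closed(1) by (cases j) (simp_all add: F_def One_nat_def)
  have F_supp: "{j. F j \<noteq> \<zero>} \<subseteq> Suc ` {i. f i \<noteq> \<zero>}"
  proof
    fix j assume "j \<in> {j. F j \<noteq> \<zero>}"
    then show "j \<in> Suc ` {i. f i \<noteq> \<zero>}"
      using r_null[OF ac] by (cases j) (auto simp: F_def)
  qed
  have "(\<Oplus>j\<in>{j. F j \<noteq> \<zero>}. F j) = (\<Oplus>j\<in>Suc ` {i. f i \<noteq> \<zero>}. F j)"
    using F_supp f(2) F_gr gr_closed(2)
    by (intro add.finprod_mono_neutral_cong_left) auto
  also have "\<dots> = (\<Oplus>i\<in>{i. f i \<noteq> \<zero>}. F (Suc i))"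
    using F_gr gr_closed(2) by (intro add.finprod_reindex) auto
  also have "\<dots> = (\<Oplus>i\<in>{i. f i \<noteq> \<zero>}. a \<otimes> f i)"
    by (simp add: F_def)
  also have "\<dots> = a \<otimes> y"
    using finsum_rdistr[OF f(2) ac, of f] fc f(3) by auto
  finally have sum_F: "(\<Oplus>j\<in>{j. F j \<noteq> \<zero>}. F j) = a \<otimes> y" .
  have sum_X: "(\<Oplus>j\<in>{j. X j \<noteq> \<zero>}. X j) = a \<otimes> y"
  proof (cases "a \<otimes> y = \<zero>")
    case True
    then show ?thesis by (simp add: X_def)
  next
    case False
    then have "{j. X j \<noteq> \<zero>} = {Suc k}" by (auto simp: X_def)
    then show ?thesis
      using y ac by (simp add: X_def)
  qed
  have "X j \<in> gr j" for j
    using m gr_closed(1) by (simp add: X_def)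
  moreover have "finite {j. X j \<noteq> \<zero>}"
    by (rule finite_subset[of _ "{Suc k}"]) (auto simp: X_def)
  moreover have "finite {j. F j \<noteq> \<zero>}"
    using F_supp f(2) finite_subset by blast
  ultimately have "F = X"
    using gr_direct_sum[of "a \<otimes> y"] sum_F sum_X F_gr ac y by blast
  then have "F (Suc k) = X (Suc k)" by simp
  then have "a \<otimes> y = a \<otimes> f k"
    by (simp add: F_def X_def)
  then show ?thesis
    using that f(1) by blast
qed

end

text \<open>
  In the context of this locale \<open>(A, a)\<close> is exact in degree 1.  Exactness in degree 2 is an assumption
  of the lemmas that use it.
\<close>

locale nonresonant_element = graded_algebra A gr
  for A :: "('k::field, 'a) module" (structure) and gr +
  fixes a
  assumes connected: "connected_grading A gr"
    and graded_comm: "graded_commutative A gr"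
    and square_zero: "x \<in> gr 1 \<Longrightarrow> x \<otimes> x = \<zero>"
    and a_in: "a \<in> gr 1"
    and a_nonzero: "a \<noteq> \<zero>"
    and not_resonant: "a \<notin> resonance A gr 1"
begin

lemma a_carrier: "a \<in> carrier A"
  using a_in by (rule gr_closed)

lemma mult_gr1: "x \<in> gr 1 \<Longrightarrow> y \<in> gr 1 \<Longrightarrow> x \<otimes> y \<in> gr 2"
  using mult_gr[of x 1 y 1] by (simp add: numeral_2_eq_2 One_nat_def)

lemma anticommute: "x \<in> gr 1 \<Longrightarrow> y \<in> gr 1 \<Longrightarrow> y \<otimes> x = (- 1) \<odot> (x \<otimes> y)"
  using graded_comm unfolding graded_commutative_def by (metis mult_1 power_one_right)

lemma zero_smult: "x \<in> carrier A \<Longrightarrow> 0 \<odot> x = \<zero>"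
  using smult_l_null[of x] by simp

lemma smult_zero: "c \<odot> \<zero> = \<zero>"
  using smult_r_null[of c] by simp

lemma mult_a_zero:
  assumes "x \<in> gr m" "a \<otimes> x = \<zero>"
  shows "x \<otimes> a = \<zero>"
  using graded_comm a_in assms unfolding graded_commutative_def by (metis smult_zero)

lemma scalars: "y \<in> gr 0 \<Longrightarrow> \<exists>c. y = c \<odot> \<one>"
  using connected by (auto simp: connected_grading_def)

lemma mult_a_exact_1:
  assumes "x \<in> gr 1" "a \<otimes> x = \<zero>"
  obtains c where "x = c \<odot> a"
proof -
  obtain y where y: "y \<in> gr 0" "x = y \<otimes> a"
    using not_resonance_exact[of a 0 x] a_in not_resonant assms mult_a_zero[OF assms]
    by (auto simp: One_nat_def)
  then obtain c where "y = c \<odot> \<one>" using scalars by blast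
  then have "x = c \<odot> a"
    using y a_carrier by (simp add: smult_mult_left)
  then show ?thesis by (rule that)
qed

lemma mult_a_exact_2:
  assumes "a \<notin> resonance A gr 2" "x \<in> gr 2" "a \<otimes> x = \<zero>"
  obtains y where "y \<in> gr 1" "x = a \<otimes> y"
proof -
  obtain y where y: "y \<in> gr 1" "x = y \<otimes> a"
    using not_resonance_exact[of a 1 x] a_in assms mult_a_zero[OF assms(2,3)]
    by (auto simp: numeral_2_eq_2 One_nat_def)
  then have "x = a \<otimes> ((- 1) \<odot> y)"
    using anticommute[OF a_in y(1)] a_carrier gr_closed(2)[OF y(1)] by (simp add: smult_mult_right)
  then show ?thesis
    using that y gr_closed(5) by blast
qed

abbreviation "I\<^sub>a \<equiv> a <# carrier A"
abbreviation "B \<equiv> quot_alg A I\<^sub>a"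
abbreviation "grB \<equiv> quot_grading A I\<^sub>a gr"
abbreviation "q x \<equiv> I\<^sub>a +> x"

lemma I_iff: "x \<in> I\<^sub>a \<longleftrightarrow> (\<exists>y\<in>carrier A. x = a \<otimes> y)"
  by (auto simp: l_coset_def)

lemma I_submodule: "submodule I\<^sub>a scalar_field A"
proof (rule submoduleI)
  show "I\<^sub>a \<subseteq> carrier A"
    using a_carrier by (auto simp: I_iff)
  show "\<zero> \<in> I\<^sub>a"
    using r_null[OF a_carrier] by (auto simp: I_iff intro!: bexI[of _ \<zero>])
  show "\<ominus> x \<in> I\<^sub>a" if "x \<in> I\<^sub>a" for x
    using that a_carrier by (auto simp: I_iff r_minus[symmetric])
  show "x \<oplus> y \<in> I\<^sub>a" if "x \<in> I\<^sub>a" "y \<in> I\<^sub>a" for x y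
    using that a_carrier by (auto simp: I_iff r_distr[symmetric])
  show "c \<odot> x \<in> I\<^sub>a" if "x \<in> I\<^sub>a" for c x
    using that a_carrier smult_closed[of c] by (auto simp: I_iff smult_mult_right[symmetric])
qed

sublocale I: module_subspace A I\<^sub>a
  by (intro module_subspace.intro module_subspace_axioms.intro module_axioms I_submodule)

lemma I_gr_1: "x \<in> I\<^sub>a \<Longrightarrow> x \<in> gr 1 \<Longrightarrow> \<exists>c. x = c \<odot> a"
proof -
  assume "x \<in> I\<^sub>a" "x \<in> gr 1"
  then obtain y where "y \<in> carrier A" "x = a \<otimes> y" by (auto simp: I_iff)
  then obtain z where z: "z \<in> gr 0" "x = a \<otimes> z"
    using homogeneous_multiple[OF a_in, of y 0] \<open>x \<in> gr 1\<close> by (auto simp: One_nat_def)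
  then obtain c where "z = c \<odot> \<one>" using scalars by blast
  then show ?thesis
    using z a_carrier by (auto simp: smult_mult_right)
qed

lemma I_gr_2: "x \<in> I\<^sub>a \<Longrightarrow> x \<in> gr 2 \<Longrightarrow> \<exists>z\<in>gr 1. x = a \<otimes> z"
proof -
  assume "x \<in> I\<^sub>a" "x \<in> gr 2"
  then obtain y where "y \<in> carrier A" "x = a \<otimes> y" by (auto simp: I_iff)
  then show ?thesis
    using homogeneous_multiple[OF a_in, of y 1] \<open>x \<in> gr 2\<close> by (auto simp: numeral_2_eq_2 One_nat_def)
qed

lemma grB_eq: "grB m = q ` gr m"
  by (simp add: quot_grading_def)

lemma q_eq_iff: "x \<in> gr m \<Longrightarrow> y \<in> gr m \<Longrightarrow> q x = q y \<longleftrightarrow> x \<ominus> y \<in> I\<^sub>a"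
  using I.coset_eq_iff gr_closed(2) by blast

text \<open>
  Only products in degree 1 are computed in \<open>B\<close>, where the right ideal \<open>a A\<close> may be multiplied from the
  left by the anticommutation of \<open>a\<close> with elements of degree 1.
\<close>

lemma q_mult:
  assumes x: "x \<in> gr 1" and y: "y \<in> gr 1"
  shows "q x \<otimes>\<^bsub>B\<^esub> q y = q (x \<otimes> y)"
proof (rule I.quot_mult)
  show xc: "x \<in> carrier A" and yc: "y \<in> carrier A"
    using x y gr_closed(2) by blast+
  fix j k assume jk: "j \<in> I\<^sub>a" "k \<in> I\<^sub>a"
  then obtain u v where u: "u \<in> carrier A" "j = a \<otimes> u" and v: "v \<in> carrier A" "k = a \<otimes> v"
    by (auto simp: I_iff)
  have jc: "j \<in> carrier A" "k \<in> carrier A"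
    using jk I.J_closed(2) by blast+
  have "x \<otimes> k = (x \<otimes> a) \<otimes> v"
    using xc v a_carrier by (simp add: m_assoc)
  also have "\<dots> = a \<otimes> ((- 1) \<odot> (x \<otimes> v))"
    using xc v a_carrier anticommute[OF a_in x] smult_closed[of "- 1" "x \<otimes> v"]
    by (simp add: smult_mult_left smult_mult_right m_assoc)
  finally have "x \<otimes> k \<in> I\<^sub>a"
    using xc v smult_closed[of "- 1" "x \<otimes> v"] by (auto simp: I_iff)
  moreover have "j \<otimes> (k \<oplus> y) \<in> I\<^sub>a"
    using u jc yc a_carrier by (auto simp: I_iff m_assoc)
  ultimately have "j \<otimes> (k \<oplus> y) \<oplus> x \<otimes> k \<in> I\<^sub>a"
    by (rule I.J_closed(3)[rotated])
  moreover have "(j \<oplus> x) \<otimes> (k \<oplus> y) = (j \<otimes> (k \<oplus> y) \<oplus> x \<otimes> k) \<oplus> x \<otimes> y"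
    using xc yc jc by (simp add: l_distr r_distr a_ac)
  ultimately show "q ((j \<oplus> x) \<otimes> (k \<oplus> y)) = q (x \<otimes> y)"
    using I.coset_absorb[of "x \<otimes> y"] xc yc by simp
qed

lemma q_ops:
  "x \<in> gr m \<Longrightarrow> y \<in> gr m \<Longrightarrow> q x \<oplus>\<^bsub>B\<^esub> q y = q (x \<oplus> y)"
  "x \<in> gr m \<Longrightarrow> c \<odot>\<^bsub>B\<^esub> q x = q (c \<odot> x)"
  using I.quot_add I.quot_smult gr_closed(2) by blast+

lemma grB_closed:
  "X \<in> grB m \<Longrightarrow> Y \<in> grB m \<Longrightarrow> X \<oplus>\<^bsub>B\<^esub> Y \<in> grB m"
  "X \<in> grB m \<Longrightarrow> c \<odot>\<^bsub>B\<^esub> X \<in> grB m"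
  unfolding grB_eq using gr_closed by (auto simp: q_ops)

lemma functional_pullback:
  assumes "\<phi> \<in> carrier (dual_space B (grB m))"
  shows "linear_functional A (gr m) (\<lambda>x. \<phi> (q x))" "x \<in> gr m \<Longrightarrow> x \<in> I\<^sub>a \<Longrightarrow> \<phi> (q x) = 0"
proof -
  have lin: "linear_functional B (grB m) \<phi>"
    using assms by (simp add: dual_space_iff)
  show pull: "linear_functional A (gr m) (\<lambda>x. \<phi> (q x))"
    unfolding linear_functional_def
  proof (intro conjI ballI allI)
    fix x y c assume xy: "x \<in> gr m" "y \<in> gr m"
    then show "\<phi> (q (x \<oplus> y)) = \<phi> (q x) + \<phi> (q y)"
      using lin by (simp add: linear_functional_def grB_eq q_ops[symmetric])
  next
    fix x c assume x: "x \<in> gr m"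
    then show "\<phi> (q (c \<odot> x)) = c * \<phi> (q x)"
      using lin by (simp add: linear_functional_def grB_eq q_ops[symmetric])
  qed
  assume x: "x \<in> gr m" "x \<in> I\<^sub>a"
  have "q x = q \<zero>"
    using x gr_closed by (simp add: q_eq_iff[of _ m] a_minus_def)
  then have "\<phi> (q x) = \<phi> (q (0 \<odot> \<zero>))"
    by (simp add: smult_zero)
  also have "\<dots> = 0"
    using pull gr_closed(1) unfolding linear_functional_def by (metis mult_zero_left)
  finally show "\<phi> (q x) = 0" .
qed

lemma functional_descends:
  assumes \<psi>: "linear_functional A (gr m) \<psi>" and I: "\<And>x. x \<in> gr m \<Longrightarrow> x \<in> I\<^sub>a \<Longrightarrow> \<psi> x = 0"
  obtains \<phi> where "\<phi> \<in> carrier (dual_space B (grB m))" "\<And>x. x \<in> gr m \<Longrightarrow> \<phi> (q x) = \<psi> x"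
proof -
  have eq: "\<psi> x = \<psi> y" if xy: "x \<in> gr m" "y \<in> gr m" "q x = q y" for x y
  proof -
    have "x \<ominus> y \<in> I\<^sub>a"
      using xy q_eq_iff by blast
    moreover have "x \<ominus> y = x \<oplus> (- 1) \<odot> y"
      using gr_closed(2)[OF xy(2)] by (simp add: a_minus_def neg_one_smult[OF module_axioms])
    ultimately have "\<psi> (x \<oplus> (- 1) \<odot> y) = 0"
      using xy gr_closed by (intro I) auto
    then show ?thesis
      using \<psi> xy gr_closed(5) by (simp add: linear_functional_def)
  qed
  define \<phi> where "\<phi> X = \<psi> (SOME x. x \<in> gr m \<and> q x = X)" for X
  have \<phi>: "\<phi> (q x) = \<psi> x" if "x \<in> gr m" for x
  proof -
    have "\<exists>y. y \<in> gr m \<and> q y = q x" using that by blast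
    from someI_ex[OF this] show ?thesis
      unfolding \<phi>_def using eq that by blast
  qed
  have "linear_functional B (grB m) \<phi>"
    unfolding linear_functional_def grB_eq
    using \<psi> gr_closed by (auto simp: q_ops \<phi> linear_functional_def)
  then have "restrict \<phi> (grB m) \<in> carrier (dual_space B (grB m))"
    by (rule restrict_in_dual_space) (auto simp: grB_closed)
  moreover have "restrict \<phi> (grB m) (q x) = \<psi> x" if "x \<in> gr m" for x
    using that \<phi> by (simp add: grB_eq)
  ultimately show ?thesis
    by (rule that)
qed

lemma left_mult_factor:
  assumes \<phi>: "linear_functional A (gr i) \<phi>"
    and ker: "\<And>x. x \<in> gr i \<Longrightarrow> a \<otimes> x = \<zero> \<Longrightarrow> \<phi> x = 0"
  obtains \<psi> where "linear_functional A (gr (Suc i)) \<psi>" "\<And>x. x \<in> gr i \<Longrightarrow> \<psi> (a \<otimes> x) = \<phi> x"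
proof (rule module_subspace.functional_factor[OF gr_module_subspace[of "Suc i"] gr_subspace[of i] _ _ _ \<phi> ker])
  show "a \<otimes> x \<in> gr (Suc i)" if "x \<in> gr i" for x
    using mult_gr[OF a_in that] by (simp add: One_nat_def)
  show "a \<otimes> (x \<oplus> y) = a \<otimes> x \<oplus> a \<otimes> y" if "x \<in> gr i" "y \<in> gr i" for x y
    using that gr_closed(2) a_carrier by (simp add: r_distr)
  show "a \<otimes> (c \<odot> x) = c \<odot> (a \<otimes> x)" if "x \<in> gr i" for c x
    using that gr_closed(2) a_carrier by (simp add: smult_mult_right)
qed (use that in auto)

text \<open>
  Multiplication by the non-zero element \<open>a\<close> embeds \<open>A\<^sup>0\<close>, which is the ground field, into \<open>A\<^sup>1\<close>.
\<close>

lemma functional_one_on_a: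
  obtains \<alpha> where "linear_functional A (gr 1) \<alpha>" "\<alpha> a = 1"
proof -
  have one: "\<one> \<noteq> \<zero>" "gr 0 = range (\<lambda>c. c \<odot> \<one>)"
    using connected by (auto simp: connected_grading_def)
  have inj: "c = d" if "c \<odot> \<one> = d \<odot> \<one>" for c d
  proof (rule ccontr)
    assume "c \<noteq> d"
    have "(c - d) \<odot> \<one> = c \<odot> \<one> \<oplus> (- d) \<odot> \<one>"
      using smult_l_distr[of c "- d" \<one>] by simp
    also have "\<dots> = d \<odot> \<one> \<oplus> (- d) \<odot> \<one>"
      by (simp add: that)
    also have "\<dots> = \<zero>"
      using smult_l_distr[of d "- d" \<one>] zero_smult[of \<one>] by simp
    finally have "inverse (c - d) \<odot> ((c - d) \<odot> \<one>) = \<zero>"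
      by (simp add: smult_zero)
    then show False
      using smult_assoc1[of "inverse (c - d)" "c - d" \<one>] \<open>c \<noteq> d\<close> one(1) smult_one[of \<one>] by simp
  qed
  define \<phi> where "\<phi> x = (THE c. x = c \<odot> \<one>)" for x
  have \<phi>: "\<phi> (c \<odot> \<one>) = c" for c
    unfolding \<phi>_def using inj by blast
  have "linear_functional A (gr 0) \<phi>"
    unfolding linear_functional_def one(2)
    using smult_l_distr[symmetric] smult_assoc1[symmetric] by (auto simp: \<phi>)
  moreover have "\<phi> x = 0" if x: "x \<in> gr 0" "a \<otimes> x = \<zero>" for x
  proof -
    obtain c where c: "x = c \<odot> \<one>" using x(1) one(2) by blast
    then have ca: "c \<odot> a = \<zero>"
      using x(2) a_carrier by (simp add: smult_mult_right)
    have "c = 0"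
    proof (rule ccontr)
      assume "c \<noteq> 0"
      then have "a = inverse c \<odot> (c \<odot> a)"
        using smult_assoc1[of "inverse c" c a] a_carrier smult_one[of a] by simp
      then show False
        using a_nonzero by (simp add: ca smult_zero)
    qed
    then show ?thesis by (simp add: c \<phi>)
  qed
  ultimately obtain \<psi> where "linear_functional A (gr 1) \<psi>" "\<And>x. x \<in> gr 0 \<Longrightarrow> \<psi> (a \<otimes> x) = \<phi> x"
    using left_mult_factor[of 0 \<phi>] by (auto simp: One_nat_def)
  moreover have "\<phi> \<one> = 1"
    using \<phi>[of 1] smult_one[of \<one>] by simp
  ultimately show ?thesis
    using that one_gr a_carrier by force
qed

end

section \<open>The quotient by a nonresonant element\<close>

locale nonresonant_basis = nonresonant_element A gr a
  for A :: "('k::field, 'a) module" (structure) and gr and a +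
  fixes n :: nat and w :: "nat \<Rightarrow> 'a" and \<alpha> :: "nat \<Rightarrow> 'a \<Rightarrow> 'k"
  assumes w_0: "w 0 = a"
    and w_in: "w i \<in> gr 1"
    and \<alpha>_linear: "i \<le> n \<Longrightarrow> linear_functional A (gr 1) (\<alpha> i)"
    and \<alpha>_w: "i \<le> n \<Longrightarrow> j \<le> n \<Longrightarrow> \<alpha> i (w j) = (if i = j then 1 else 0)"
    and expansion: "linear_functional A (gr 1) \<phi> \<Longrightarrow> x \<in> gr 1 \<Longrightarrow> \<phi> x = (\<Sum>i\<le>n. \<phi> (w i) * \<alpha> i x)"
begin

lemma w_carrier: "w i \<in> carrier A"
  using w_in by (rule gr_closed)

lemma bilinear_expansion:
  assumes \<psi>: "linear_functional A (gr 2) \<psi>" and x: "x \<in> gr 1" and y: "y \<in> gr 1"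
  shows "\<psi> (x \<otimes> y) = (\<Sum>i\<le>n. \<Sum>j\<le>n. \<alpha> i x * \<alpha> j y * \<psi> (w i \<otimes> w j))"
proof -
  have left: "linear_functional A (gr 1) (\<lambda>x. \<psi> (x \<otimes> z))" if "z \<in> gr 1" for z
    using \<psi> that gr_closed(2) mult_gr1
    by (simp add: linear_functional_def l_distr smult_mult_left)
  have right: "linear_functional A (gr 1) (\<lambda>y. \<psi> (z \<otimes> y))" if "z \<in> gr 1" for z
    using \<psi> that gr_closed(2) mult_gr1
    by (simp add: linear_functional_def r_distr smult_mult_right)
  have "\<psi> (x \<otimes> y) = (\<Sum>i\<le>n. \<psi> (w i \<otimes> y) * \<alpha> i x)"
    by (rule expansion[OF left[OF y] x])
  also have "\<dots> = (\<Sum>i\<le>n. (\<Sum>j\<le>n. \<psi> (w i \<otimes> w j) * \<alpha> j y) * \<alpha> i x)"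
    by (intro sum.cong HOL.refl arg_cong2[where f = times] expansion[OF right[OF w_in] y])
  finally show ?thesis
    by (simp add: sum_distrib_left sum_distrib_right mult_ac)
qed

lemma functional_antisym:
  assumes \<psi>: "linear_functional A (gr 2) \<psi>" and "x \<in> gr 1" "y \<in> gr 1"
  shows "\<psi> (y \<otimes> x) = - \<psi> (x \<otimes> y)"
  using anticommute[OF assms(2,3)] mult_gr1[OF assms(2,3)] \<psi> by (simp add: linear_functional_def)

lemma functional_zero: "linear_functional A (gr m) \<psi> \<Longrightarrow> \<psi> \<zero> = 0"
  using smult_zero[of 0] gr_closed(1)[of m] unfolding linear_functional_def by (metis mult_zero_left)

sublocale BA: degree_one_basis A gr "{..n}" w "\<lambda>i. restrict (\<alpha> i) (gr 1)"
proof
  show "restrict (\<alpha> i) (gr 1) \<in> carrier (dual_space A (gr 1))" if "i \<in> {..n}" for i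
    using that gr_closed by (intro restrict_in_dual_space \<alpha>_linear) auto
  show "v x = (\<Sum>i\<in>{..n}. v (w i) * restrict (\<alpha> i) (gr 1) x)"
    if "v \<in> carrier (dual_space A (gr 1))" "x \<in> gr 1" for v x
    using that expansion[of v x] by (simp add: dual_space_iff)
  fix \<phi> assume "\<phi> \<in> carrier (dual_space A (gr 2))"
  then have \<phi>: "linear_functional A (gr 2) \<phi>" by (simp add: dual_space_iff)
  show "\<phi> (x \<otimes> y) = (\<Sum>i\<in>{..n}. \<Sum>j\<in>{..n}. restrict (\<alpha> i) (gr 1) x * restrict (\<alpha> j) (gr 1) y * \<phi> (w i \<otimes> w j))"
    if "x \<in> gr 1" "y \<in> gr 1" for x y
    using that bilinear_expansion[OF \<phi> that] by simp
  show "\<phi> (w i \<otimes> w i) = 0" for i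
    using square_zero[OF w_in] functional_zero[OF \<phi>] by simp
  show "\<phi> (w j \<otimes> w i) = - \<phi> (w i \<otimes> w j)" for i j
    by (rule functional_antisym[OF \<phi> w_in w_in])
qed (use gr_closed w_in \<alpha>_w in auto)

lemma BA_Q_iff: "M \<in> BA.Q \<longleftrightarrow> (\<exists>\<phi>. linear_functional A (gr 2) \<phi> \<and> M = (\<lambda>i j. \<phi> (w i \<otimes> w j)))"
proof
  assume "M \<in> BA.Q"
  then show "\<exists>\<phi>. linear_functional A (gr 2) \<phi> \<and> M = (\<lambda>i j. \<phi> (w i \<otimes> w j))"
    by (auto simp: BA.Q_def dual_space_iff)
next
  assume "\<exists>\<phi>. linear_functional A (gr 2) \<phi> \<and> M = (\<lambda>i j. \<phi> (w i \<otimes> w j))"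
  then obtain \<phi> where \<phi>: "linear_functional A (gr 2) \<phi>" "M = (\<lambda>i j. \<phi> (w i \<otimes> w j))" by blast
  have "restrict \<phi> (gr 2) \<in> carrier (dual_space A (gr 2))"
    using gr_closed by (intro restrict_in_dual_space \<phi>) auto
  moreover have "M = (\<lambda>i j. restrict \<phi> (gr 2) (w i \<otimes> w j))"
    using mult_gr1[OF w_in w_in] by (simp add: \<phi>(2))
  ultimately show "M \<in> BA.Q"
    unfolding BA.Q_def by blast
qed

text \<open>
  The functionals dual to \<open>a w\<^sub>1, \<dots>, a w\<^sub>n\<close>, which are linearly independent by exactness in degree 1.
\<close>

definition \<epsilon> :: "nat \<Rightarrow> 'a \<Rightarrow> 'k" where
  "\<epsilon> k = (SOME \<psi>. linear_functional A (gr 2) \<psi> \<and> (\<forall>x\<in>gr 1. \<psi> (a \<otimes> x) = \<alpha> k x))"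

lemma \<epsilon>:
  assumes "k \<in> {1..n}"
  shows "linear_functional A (gr 2) (\<epsilon> k)" "x \<in> gr 1 \<Longrightarrow> \<epsilon> k (a \<otimes> x) = \<alpha> k x"
proof -
  have lin: "linear_functional A (gr 1) (\<alpha> k)"
    using assms by (intro \<alpha>_linear) simp
  have "\<alpha> k a = 0"
    using \<alpha>_w[of k 0] assms w_0 by simp
  have zero: "\<alpha> k x = 0" if x: "x \<in> gr 1" "a \<otimes> x = \<zero>" for x
  proof -
    obtain c where "x = c \<odot> a" using mult_a_exact_1[OF x] .
    then show ?thesis
      using lin a_in \<open>\<alpha> k a = 0\<close> by (simp add: linear_functional_def)
  qed
  obtain \<psi> where "linear_functional A (gr (Suc 1)) \<psi>" "\<And>x. x \<in> gr 1 \<Longrightarrow> \<psi> (a \<otimes> x) = \<alpha> k x"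
    by (rule left_mult_factor[OF lin], rule zero) (assumption+, rule that)
  then have "\<exists>\<psi>. linear_functional A (gr 2) \<psi> \<and> (\<forall>x\<in>gr 1. \<psi> (a \<otimes> x) = \<alpha> k x)"
    by (auto simp: numeral_2_eq_2 One_nat_def)
  from someI_ex[OF this, folded \<epsilon>_def]
  show "linear_functional A (gr 2) (\<epsilon> k)" "x \<in> gr 1 \<Longrightarrow> \<epsilon> k (a \<otimes> x) = \<alpha> k x"
    by auto
qed

sublocale SG: split_generator n BA.Q "\<lambda>k i j. \<epsilon> k (w i \<otimes> w j)"
proof
  have "linear_functional A (gr 2) (\<lambda>x. 0)"
    by (simp add: linear_functional_def)
  then show "(\<lambda>i j. 0) \<in> BA.Q"
    unfolding BA_Q_iff by (intro exI[of _ "\<lambda>x. 0"]) simp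
  fix M N c
  assume "M \<in> BA.Q"
  then obtain \<phi> where \<phi>: "linear_functional A (gr 2) \<phi>" "M = (\<lambda>i j. \<phi> (w i \<otimes> w j))"
    unfolding BA_Q_iff by blast
  show "(\<lambda>i j. c * M i j) \<in> BA.Q"
    unfolding BA_Q_iff \<phi>(2) using linear_functional_scale[OF \<phi>(1)] by blast
  show "M i i = 0" for i
    using square_zero[OF w_in] functional_zero[OF \<phi>(1)] by (simp add: \<phi>(2))
  show "M j i = - M i j" for i j
    unfolding \<phi>(2) by (rule functional_antisym[OF \<phi>(1) w_in w_in])
  assume "N \<in> BA.Q"
  then obtain \<psi> where \<psi>: "linear_functional A (gr 2) \<psi>" "N = (\<lambda>i j. \<psi> (w i \<otimes> w j))"
    unfolding BA_Q_iff by blast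
  have "linear_functional A (gr 2) (\<lambda>x. \<phi> x + \<psi> x)"
    using \<phi>(1) \<psi>(1) by (simp add: linear_functional_def algebra_simps)
  then show "(\<lambda>i j. M i j + N i j) \<in> BA.Q"
    unfolding BA_Q_iff \<phi>(2) \<psi>(2) by blast
next
  fix k j assume k: "k \<in> {1..n}"
  show "(\<lambda>i j. \<epsilon> k (w i \<otimes> w j)) \<in> BA.Q"
    unfolding BA_Q_iff using \<epsilon>(1)[OF k] by blast
  assume "j \<in> {1..n}"
  then show "\<epsilon> k (w 0 \<otimes> w j) = (if j = k then 1 else 0)"
    using k \<epsilon>(2)[OF k w_in, of j] \<alpha>_w[of k j] by (auto simp: w_0)
qed

text \<open>
  The basis of the dual of \<open>B\<^sup>1\<close>: for \<open>i \<ge> 1\<close>, the functional \<open>\<alpha>\<^sub>i\<close> vanishes on \<open>a = w\<^sub>0\<close> and so descends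
  to \<open>B\<^sup>1\<close>.
\<close>

definition \<beta> :: "nat \<Rightarrow> 'a set \<Rightarrow> 'k" where
  "\<beta> i = (SOME \<phi>. \<phi> \<in> carrier (dual_space B (grB 1)) \<and> (\<forall>x\<in>gr 1. \<phi> (q x) = \<alpha> i x))"

lemma \<beta>:
  assumes "i \<in> {1..n}"
  shows "\<beta> i \<in> carrier (dual_space B (grB 1))" "x \<in> gr 1 \<Longrightarrow> \<beta> i (q x) = \<alpha> i x"
proof -
  have lin: "linear_functional A (gr 1) (\<alpha> i)"
    using assms by (intro \<alpha>_linear) simp
  have "\<alpha> i a = 0"
    using \<alpha>_w[of i 0] assms w_0 by simp
  have zero: "\<alpha> i x = 0" if x: "x \<in> gr 1" "x \<in> I\<^sub>a" for x
  proof -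
    obtain c where "x = c \<odot> a" using I_gr_1[OF x(2,1)] by blast
    then show ?thesis
      using lin a_in \<open>\<alpha> i a = 0\<close> by (simp add: linear_functional_def)
  qed
  obtain \<phi> where "\<phi> \<in> carrier (dual_space B (grB 1))" "\<And>x. x \<in> gr 1 \<Longrightarrow> \<phi> (q x) = \<alpha> i x"
    by (rule functional_descends[OF lin], rule zero) (assumption+, rule that)
  then have "\<exists>\<phi>. \<phi> \<in> carrier (dual_space B (grB 1)) \<and> (\<forall>x\<in>gr 1. \<phi> (q x) = \<alpha> i x)"
    by blast
  from someI_ex[OF this, folded \<beta>_def]
  show "\<beta> i \<in> carrier (dual_space B (grB 1))" "x \<in> gr 1 \<Longrightarrow> \<beta> i (q x) = \<alpha> i x"
    by auto
qed

lemma q_in: "x \<in> gr m \<Longrightarrow> q x \<in> grB m"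
  by (simp add: grB_eq)

lemma sum_from_1:
  assumes "h 0 = (0 :: 'k)"
  shows "(\<Sum>i\<le>n. h i) = (\<Sum>i\<in>{1..n}. h i)"
  using assms by (intro sum.mono_neutral_right) (auto simp: One_nat_def Suc_le_eq)

lemma a_mult_in_I: "x \<in> gr m \<Longrightarrow> a \<otimes> x \<in> I\<^sub>a"
  using gr_closed(2) by (auto simp: I_iff)

sublocale BB: degree_one_basis B grB "{1..n}" "\<lambda>i. q (w i)" \<beta>
proof
  show "v X = (\<Sum>i\<in>{1..n}. v (q (w i)) * \<beta> i X)"
    if v: "v \<in> carrier (dual_space B (grB 1))" and X: "X \<in> grB 1" for v X
  proof -
    obtain x where x: "x \<in> gr 1" "X = q x" using X by (auto simp: grB_eq)
    have "a = a \<otimes> \<one>" using a_carrier by simp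
    then have "a \<in> I\<^sub>a" unfolding I_iff by blast
    then have "v (q (w 0)) = 0"
      using functional_pullback(2)[OF v] w_0 a_in by simp
    have "v (q x) = (\<Sum>i\<le>n. v (q (w i)) * \<alpha> i x)"
      by (rule expansion[OF functional_pullback(1)[OF v] x(1)])
    also have "\<dots> = (\<Sum>i\<in>{1..n}. v (q (w i)) * \<alpha> i x)"
      using \<open>v (q (w 0)) = 0\<close> by (intro sum_from_1) simp
    also have "\<dots> = (\<Sum>i\<in>{1..n}. v (q (w i)) * \<beta> i X)"
      using x by (intro sum.cong HOL.refl) (simp add: \<beta>)
    finally show ?thesis by (simp add: x)
  qed
  fix \<phi> assume \<phi>: "\<phi> \<in> carrier (dual_space B (grB 2))"
  let ?\<psi> = "\<lambda>x. \<phi> (q x)"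
  have \<psi>: "linear_functional A (gr 2) ?\<psi>"
    by (rule functional_pullback[OF \<phi>])
  have \<psi>_a: "?\<psi> (a \<otimes> x) = 0" if "x \<in> gr 1" for x
    using that functional_pullback(2)[OF \<phi>] mult_gr1[OF a_in] a_mult_in_I by blast
  show "\<phi> (q (w i) \<otimes>\<^bsub>B\<^esub> q (w i)) = 0" for i
    using square_zero[OF w_in] functional_zero[OF \<psi>] by (simp add: q_mult w_in)
  show "\<phi> (q (w j) \<otimes>\<^bsub>B\<^esub> q (w i)) = - \<phi> (q (w i) \<otimes>\<^bsub>B\<^esub> q (w j))" for i j
    using functional_antisym[OF \<psi> w_in w_in, of j i] by (simp add: q_mult w_in)
  show "\<phi> (X \<otimes>\<^bsub>B\<^esub> Y) = (\<Sum>i\<in>{1..n}. \<Sum>j\<in>{1..n}. \<beta> i X * \<beta> j Y * \<phi> (q (w i) \<otimes>\<^bsub>B\<^esub> q (w j)))"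
    if X: "X \<in> grB 1" and Y: "Y \<in> grB 1" for X Y
  proof -
    obtain x y where xy: "x \<in> gr 1" "X = q x" "y \<in> gr 1" "Y = q y"
      using X Y by (auto simp: grB_eq)
    have "\<phi> (X \<otimes>\<^bsub>B\<^esub> Y) = ?\<psi> (x \<otimes> y)"
      by (simp add: xy q_mult)
    also have "\<dots> = (\<Sum>i\<le>n. \<Sum>j\<le>n. \<alpha> i x * \<alpha> j y * ?\<psi> (w i \<otimes> w j))"
      by (rule bilinear_expansion[OF \<psi> xy(1,3)])
    also have "\<dots> = (\<Sum>i\<in>{1..n}. \<Sum>j\<le>n. \<alpha> i x * \<alpha> j y * ?\<psi> (w i \<otimes> w j))"
      by (rule sum_from_1) (simp add: w_0 \<psi>_a[OF w_in])
    also have "\<dots> = (\<Sum>i\<in>{1..n}. \<Sum>j\<in>{1..n}. \<alpha> i x * \<alpha> j y * ?\<psi> (w i \<otimes> w j))"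
    proof (rule sum.cong[OF HOL.refl], rule sum_from_1)
      fix i
      show "\<alpha> i x * \<alpha> 0 y * ?\<psi> (w i \<otimes> w 0) = 0"
        using functional_antisym[OF \<psi> a_in w_in, of i] by (simp add: w_0 \<psi>_a[OF w_in])
    qed
    also have "\<dots> = (\<Sum>i\<in>{1..n}. \<Sum>j\<in>{1..n}. \<beta> i X * \<beta> j Y * \<phi> (q (w i) \<otimes>\<^bsub>B\<^esub> q (w j)))"
      using xy by (intro sum.cong HOL.refl) (simp add: \<beta> q_mult w_in)
    finally show ?thesis .
  qed
qed (use grB_closed q_in w_in \<beta> \<alpha>_w in auto)

lemma a_mult_zero_iff:
  assumes \<phi>: "linear_functional A (gr 2) \<phi>" and zero: "\<forall>j\<le>n. \<phi> (a \<otimes> w j) = 0" and x: "x \<in> gr 1"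
  shows "\<phi> (a \<otimes> x) = 0"
proof -
  have "linear_functional A (gr 1) (\<lambda>x. \<phi> (a \<otimes> x))"
    using \<phi> gr_closed(2) mult_gr1[OF a_in] a_carrier
    by (simp add: linear_functional_def r_distr smult_mult_right)
  from expansion[OF this x] show ?thesis
    using zero by simp
qed

text \<open>
  Functionals on \<open>B\<^sup>2\<close> are those on \<open>A\<^sup>2\<close> that vanish on \<open>a A\<^sup>1\<close>, which is the degree 2 part of \<open>a A\<close>.
\<close>

lemma BB_Q_eq: "BB.Q = SG.Q0"
proof (intro equalityI subsetI)
  fix M assume "M \<in> BB.Q"
  then obtain \<phi> where \<phi>: "\<phi> \<in> carrier (dual_space B (grB 2))" "M = (\<lambda>i j. \<phi> (q (w i) \<otimes>\<^bsub>B\<^esub> q (w j)))"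
    by (auto simp: BB.Q_def)
  then have M: "M = (\<lambda>i j. \<phi> (q (w i \<otimes> w j)))"
    by (simp add: q_mult w_in)
  have "M \<in> BA.Q"
    unfolding BA_Q_iff M using functional_pullback(1)[OF \<phi>(1)] by blast
  moreover have "M 0 j = 0" for j
    unfolding M w_0 using functional_pullback(2)[OF \<phi>(1)] mult_gr1[OF a_in w_in] a_mult_in_I[OF w_in]
    by blast
  ultimately show "M \<in> SG.Q0"
    by (simp add: SG.Q0_def)
next
  fix M assume "M \<in> SG.Q0"
  then obtain \<phi> where \<phi>: "linear_functional A (gr 2) \<phi>" and M: "M = (\<lambda>i j. \<phi> (w i \<otimes> w j))"
    and "\<forall>j\<le>n. M 0 j = 0"
    by (auto simp: SG.Q0_def BA_Q_iff)
  then have "\<phi> (a \<otimes> x) = 0" if "x \<in> gr 1" for x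
    using a_mult_zero_iff[OF \<phi> _ that] by (simp add: w_0)
  then have zero: "\<phi> x = 0" if "x \<in> gr 2" "x \<in> I\<^sub>a" for x
    using I_gr_2[OF that(2,1)] by blast
  obtain \<psi> where \<psi>: "\<psi> \<in> carrier (dual_space B (grB 2))" "\<And>x. x \<in> gr 2 \<Longrightarrow> \<psi> (q x) = \<phi> x"
    by (rule functional_descends[OF \<phi>], rule zero) (assumption+, rule that)
  have "M = (\<lambda>i j. \<psi> (q (w i) \<otimes>\<^bsub>B\<^esub> q (w j)))"
    unfolding M by (simp add: q_mult w_in \<psi>(2) mult_gr1)
  then show "M \<in> BB.Q"
    using \<psi>(1) by (auto simp: BB.Q_def)
qed

text \<open>
  The element \<open>M\<close> comes from a functional \<open>\<phi>\<close> on \<open>A\<^sup>2\<close> that vanishes on \<open>a A\<^sup>1\<close>.  Exactness in degree 2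
  gives a functional \<open>\<Phi>\<close> on \<open>A\<^sup>3\<close> with \<open>\<Phi>(a x) = \<phi>(x)\<close>, and \<open>Z\<^sub>p\<^sub>q\<^sub>j = \<Phi>(w\<^sub>p w\<^sub>q w\<^sub>j)\<close>.  Row 0 of the last matrix
  vanishes because \<open>\<Phi>(a w\<^sub>q w\<^sub>j) = \<phi>(w\<^sub>q w\<^sub>j) = M\<^sub>q\<^sub>j\<close> and \<open>\<epsilon>\<^sub>i(a w\<^sub>q) = \<delta>\<^sub>i\<^sub>q\<close>.
\<close>

lemma cubic_extension:
  assumes "a \<notin> resonance A gr 2" and "M \<in> SG.Q0"
  shows "\<exists>Z. (\<forall>p q j. Z q p j = - Z p q j) \<and> (\<forall>p q j. Z p j q = - Z p q j) \<and> (\<forall>p q. Z p p q = 0) \<and>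
        (\<forall>p q. Z p q q = 0) \<and>
        (\<forall>j\<in>{1..n}. (\<lambda>p q. Z p q j - (\<Sum>i\<in>{1..n}. M i j * \<epsilon> i (w p \<otimes> w q))) \<in> SG.Q0)"
proof -
  obtain \<phi> where \<phi>: "linear_functional A (gr 2) \<phi>" and M: "M = (\<lambda>i j. \<phi> (w i \<otimes> w j))"
    and M0: "\<forall>j\<le>n. M 0 j = 0"
    using assms(2) by (auto simp: SG.Q0_def BA_Q_iff)
  have \<phi>_a: "\<phi> (a \<otimes> x) = 0" if "x \<in> gr 1" for x
    using a_mult_zero_iff[OF \<phi> _ that] M0 by (simp add: w_0 M)
  have zero: "\<phi> x = 0" if x: "x \<in> gr 2" "a \<otimes> x = \<zero>" for x
  proof -
    obtain y where "y \<in> gr 1" "x = a \<otimes> y"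
      by (rule mult_a_exact_2[OF assms(1) x]) (rule that)
    then show ?thesis
      using \<phi>_a by simp
  qed
  obtain \<Phi> where \<Phi>: "linear_functional A (gr (Suc 2)) \<Phi>" "\<And>x. x \<in> gr 2 \<Longrightarrow> \<Phi> (a \<otimes> x) = \<phi> x"
    by (rule left_mult_factor[OF \<phi>], rule zero) (assumption+, rule that)
  have mult_21: "x \<otimes> y \<in> gr (Suc 2)" if "x \<in> gr 2" "y \<in> gr 1" for x y
    using mult_gr[OF that] by (simp add: One_nat_def)
  define Z where "Z p q j = \<Phi> (w p \<otimes> w q \<otimes> w j)" for p q j
  have \<Phi>_neg: "\<Phi> ((- 1) \<odot> x) = - \<Phi> x" if "x \<in> gr (Suc 2)" for x
    using \<Phi>(1) that by (simp add: linear_functional_def)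
  have Z1: "Z q p j = - Z p q j" for p q j
    using anticommute[OF w_in w_in, of q p] \<Phi>_neg[OF mult_21[OF mult_gr1[OF w_in w_in] w_in]] w_carrier
    by (simp add: Z_def smult_mult_left)
  have Z2: "Z p j q = - Z p q j" for p q j
    using anticommute[OF w_in w_in, of j q] \<Phi>_neg[OF mult_21[OF mult_gr1[OF w_in w_in] w_in]] w_carrier
    by (simp add: Z_def m_assoc smult_mult_right)
  \<comment> \<open>In characteristic 2 this does not follow from antisymmetry.\<close>
  have Z3: "Z p p q = 0" for p q
    using square_zero[OF w_in] functional_zero[OF \<Phi>(1)] w_carrier by (simp add: Z_def)
  have Z4: "Z p q q = 0" for p q
    using square_zero[OF w_in] functional_zero[OF \<Phi>(1)] w_carrier by (simp add: Z_def m_assoc)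
  have "(\<lambda>p q. Z p q j - (\<Sum>i\<in>{1..n}. M i j * \<epsilon> i (w p \<otimes> w q))) \<in> SG.Q0" if j: "j \<in> {1..n}" for j
  proof -
    let ?\<psi> = "\<lambda>x. \<Phi> (x \<otimes> w j) - (\<Sum>i\<in>{1..n}. M i j * \<epsilon> i x)"
    let ?N = "\<lambda>p q. Z p q j - (\<Sum>i\<in>{1..n}. M i j * \<epsilon> i (w p \<otimes> w q))"
    have "linear_functional A (gr 2) (\<lambda>x. \<Phi> (x \<otimes> w j))"
      using \<Phi>(1) gr_closed(2) mult_21[OF _ w_in] w_carrier
      by (simp add: linear_functional_def l_distr smult_mult_left)
    then have "linear_functional A (gr 2) ?\<psi>"
      by (intro linear_functional_diff linear_functional_sum \<epsilon>(1))
    then have N: "?N \<in> BA.Q"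
      unfolding BA_Q_iff Z_def by (intro exI[of _ ?\<psi>]) simp
    moreover have "?N 0 q = 0" if "q \<le> n" for q
    proof (cases "q = 0")
      case True
      then show ?thesis
        using SG.Q_diagonal[OF N, of 0] by simp
    next
      case False
      then have q: "q \<in> {1..n}" using that by (simp add: One_nat_def Suc_le_eq)
      have "Z 0 q j = \<phi> (w q \<otimes> w j)"
        using \<Phi>(2)[OF mult_gr1[OF w_in w_in]] w_carrier a_carrier by (simp add: Z_def w_0 m_assoc)
      moreover have "(\<Sum>i\<in>{1..n}. M i j * \<epsilon> i (w 0 \<otimes> w q)) = (\<Sum>i\<in>{1..n}. if i = q then M i j else 0)"
        using q by (intro sum.cong HOL.refl) (simp add: SG.E_row)
      ultimately show ?thesis
        using q by (simp add: M)
    qed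
    ultimately show ?thesis
      by (simp add: SG.Q0_def)
  qed
  then show ?thesis
    using Z1 Z2 Z3 Z4 by blast
qed

lemma metabelian_pieces_isomorphic:
  assumes "s \<ge> 2" and deg: "s = 2 \<or> a \<notin> resonance A gr 2"
  shows "lin_isomorphic (metabelian_holonomy_deg A gr s) (metabelian_holonomy_deg B grB s)"
proof -
  have pres: "metabelian_holonomy_deg C g s = metabelian_holonomy C g
      \<lparr>carrier := carrier (metabelian_holonomy_deg C g s)\<rparr>"
    for C :: "('k, 'c) module" and g
    by (simp add: metabelian_holonomy_deg_def)
  have "lin_isomorphic (metabelian_holonomy A gr\<lparr>carrier := BA.f2 ` homog s\<rparr>)
      (metabelian_holonomy B grB\<lparr>carrier := BB.f2 ` homog s\<rparr>)"
  proof (rule lin_isomorphic_of_presentations[OF BA.presentation_f2 BB.presentation_f2, where p = SG.p])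
    show "SG.p x \<in> BA.K \<longleftrightarrow> x \<in> BB.K" if x: "x \<in> homog s" for x
    proof
      assume px: "SG.p x \<in> BA.K"
      from deg show "x \<in> BB.K"
      proof
        assume "s = 2"
        then show ?thesis
          using SG.p_injective_degree_two x px by (simp add: BB_Q_eq)
      next
        assume "a \<notin> resonance A gr 2"
        then show ?thesis
          using SG.p_injective_mod_KA[OF cubic_extension px] by (simp add: BB_Q_eq)
      qed
    next
      assume "x \<in> BB.K"
      then show "SG.p x \<in> BA.K"
        using SG.p_maps_KB_to_KA by (simp add: BB_Q_eq)
    qed
    show "\<exists>x\<in>homog s. y - SG.p x \<in> BA.K" if "y \<in> homog s" for y
      using SG.p_surjective_mod_KA[OF that assms(1)] .
  qed (simp_all add: homog_add homog_scale SG.p_homog)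
  then show ?thesis
    by (subst (1 2) pres) (simp only: BA.f2_homog BB.f2_homog)
qed

end

theorem theorem8p1:
  fixes A :: "('k::field, 'a) module" and gr :: "nat \<Rightarrow> 'a set" and a :: 'a and r :: nat
    and B :: "('k, 'a set) module" and grB :: "nat \<Rightarrow> 'a set set"
  assumes "graded_algebra A gr"
    and "connected_grading A gr"
    and "graded_commutative A gr"
    and "generated_in_degree_one A gr"
    and "finite_dim A (gr 1)"
    and "\<And>x. x \<in> gr 1 \<Longrightarrow> x \<otimes>\<^bsub>A\<^esub> x = \<zero>\<^bsub>A\<^esub>"
    and "a \<in> gr 1" and "a \<noteq> \<zero>\<^bsub>A\<^esub>"
    and "B = quot_alg A (a <#\<^bsub>A\<^esub> carrier A)"
    and "grB = quot_grading A (a <#\<^bsub>A\<^esub> carrier A) gr"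
    and "r \<ge> 1"
    and "a \<notin> (\<Union>i\<in>{1..r}. resonance A gr i)"
  shows "\<forall>s. 2 \<le> s \<and> s \<le> r + 1 \<longrightarrow>
    lin_isomorphic (metabelian_holonomy_deg A gr s) (metabelian_holonomy_deg B grB s)"
proof (intro allI impI)
  fix s assume s: "2 \<le> s \<and> s \<le> r + 1"
  interpret graded_algebra A gr by fact
  have nonres: "a \<notin> resonance A gr i" if "1 \<le> i" "i \<le> r" for i
    using assms(12) that by auto
  interpret nonresonant_element A gr a
    by unfold_locales (use assms nonres in auto)
  interpret W: module_subspace A "gr 1"
    by (rule gr_module_subspace)
  obtain \<alpha>0 where \<alpha>0: "linear_functional A (gr 1) \<alpha>0" "\<alpha>0 a = 1"
    by (rule functional_one_on_a) (rule that)
  obtain n w \<alpha> where "w 0 = a" "W.dual_basis_on (gr 1) n w \<alpha>"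
    using W.dual_basis_exists[OF assms(5,7) \<alpha>0] by blast
  then interpret nonresonant_basis A gr a n w \<alpha>
    by unfold_locales (auto simp: W.dual_basis_on_def)
  have "s = 2 \<or> a \<notin> resonance A gr 2"
    using s nonres[of 2] by linarith
  then show "lin_isomorphic (metabelian_holonomy_deg A gr s) (metabelian_holonomy_deg B grB s)"
    unfolding assms(9,10) using s by (intro metabelian_pieces_isomorphic) auto
qed

end
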